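(* Let $K$ be a compact connected semi-simple Lie group with the bi-invariant Finsler metric induced by an $\operatorname{Ad}$-invariant Finsler norm $\|\cdot\|$ on its Lie algebra $\mathfrak{k}$, let $R$ be the radius of injectivity of $\|\cdot\|$, and let $\gamma:[a,b]\to K$ be a piecewise $C^1$ path. (i) If $\gamma$ is short for the bi-invariant metric, then there is a functional $\varphi\in\mathfrak{k}^*$ of unit norm such that $\varphi(\gamma_t^{-1}\dot\gamma_t)=\|\gamma_t^{-1}\dot\gamma_t\|$ for (almost) all $t\in[a,b]$. (ii) Reciprocally, if $[t_0,t_1]\subseteq[a,b]$, if $\varphi(\gamma_t^{-1}\dot\gamma_t)=\|\gamma_t^{-1}\dot\gamma_t\|$ holds for some unit norm functional $\varphi\in\mathfrak{k}^*$ and (almost) all $t\in[t_0,t_1]$, and if $L(\gamma)_{t_0}^{t_1}\le R$, then $\gamma$ is short in $[t_0,t_1]$.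
   Context: A Finsler norm on a finite-dimensional real vector space is a nonnegative function $\|\cdot\|$ that is subadditive, positively homogeneous ($\|\lambda x\|=\lambda\|x\|$ for $\lambda\ge 0$) and vanishes only at $0$; it need not be symmetric, smooth or strictly convex. The norm of a functional is $\|\varphi\|=\sup\{\varphi(v):\|v\|=1\}$. The metric on $K$ is obtained by (left or right) translation of $\|\cdot\|$: the length of a piecewise $C^1$ path is $L(\gamma)_{t_0}^{t_1}=\int_{t_0}^{t_1}\|\gamma_t^{-1}\dot\gamma_t\|\,dt=\int_{t_0}^{t_1}\|\dot\gamma_t\gamma_t^{-1}\|\,dt$ (the two agree since $\|\cdot\|$ is $\operatorname{Ad}$-invariant). A path is short if its length is minimal among all piecewise $C^1$ paths in $K$ with the same (ordered) endpoints. The radius of injectivity $R$ of $\|\cdot\|$ is the maximal $R>0$ such that, with $B_R=\{v\in\mathfrak{k}:\|v\|<R\}$, the exponential map $\exp:B_R\to\exp(B_R)$ is a diffeomorphism between open sets. *)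

theory Defs
  imports "HOL-Analysis.Analysis" "HOL-Algebra.Group"
begin

section \<open>Smooth maps and manifolds\<close>

text \<open>
  \<open>C\<^sup>k\<close> maps on an open subset of a Euclidean space. Since the domain is finite-dimensional,
  continuity of all iterated directional derivatives is continuity of all partial derivatives.
\<close>
primrec Ck_on ::
  "nat \<Rightarrow> ('a::euclidean_space \<Rightarrow> 'b::real_normed_vector) \<Rightarrow> 'a set \<Rightarrow> bool" where
  "Ck_on 0 f S \<longleftrightarrow> continuous_on S f"
| "Ck_on (Suc k) f S \<longleftrightarrow>
     (\<forall>x\<in>S. f differentiable (at x)) \<and>
     (\<forall>v. Ck_on k (\<lambda>x. frechet_derivative f (at x) v) S)"

definition smooth_on ::
  "('a::euclidean_space \<Rightarrow> 'b::real_normed_vector) \<Rightarrow> 'a set \<Rightarrow> bool" where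
  "smooth_on f S \<longleftrightarrow> (\<forall>k. Ck_on k f S)"

text \<open>
  A chart is a pair of an open domain and a coordinate map, which is only meaningful on the
  domain. An atlas is any set of compatible charts that covers; it need not be maximal.
\<close>
type_synonym ('g, 'e) chart = "'g set \<times> ('g \<Rightarrow> 'e)"

abbreviation chart_dom :: "('g, 'e) chart \<Rightarrow> 'g set" where
  "chart_dom c \<equiv> fst c"

abbreviation chart_map :: "('g, 'e) chart \<Rightarrow> 'g \<Rightarrow> 'e" where
  "chart_map c \<equiv> snd c"

definition chart_inv :: "('g, 'e) chart \<Rightarrow> 'e \<Rightarrow> 'g" where
  "chart_inv c = inv_into (chart_dom c) (chart_map c)"

definition is_chart :: "'g topology \<Rightarrow> ('g, 'e::euclidean_space) chart \<Rightarrow> bool" where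
  "is_chart T c \<longleftrightarrow>
     openin T (chart_dom c) \<and>
     open (chart_map c ` chart_dom c) \<and>
     homeomorphic_map (subtopology T (chart_dom c))
       (top_of_set (chart_map c ` chart_dom c)) (chart_map c)"

locale smooth_manifold =
  fixes T :: "'g topology" and A :: "('g, 'e::euclidean_space) chart set"
  assumes Hausdorff: "Hausdorff_space T"
    and second_countable: "second_countable T"
    and charts: "c \<in> A \<Longrightarrow> is_chart T c"
    and cover: "topspace T = (\<Union>c\<in>A. chart_dom c)"
    and compatible: "c \<in> A \<Longrightarrow> d \<in> A \<Longrightarrow>
      smooth_on (chart_map d \<circ> chart_inv c) (chart_map c ` (chart_dom c \<inter> chart_dom d))"

text \<open>Smoothness of a map on an open subset \<open>S\<close> of a manifold.\<close>
definition smooth_map_on ::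
  "'g topology \<Rightarrow> ('g, 'e::euclidean_space) chart set \<Rightarrow> 'g set \<Rightarrow>
   'h topology \<Rightarrow> ('h, 'f::euclidean_space) chart set \<Rightarrow> ('g \<Rightarrow> 'h) \<Rightarrow> bool" where
  "smooth_map_on T A S T' A' f \<longleftrightarrow>
     continuous_map (subtopology T S) T' f \<and>
     (\<forall>c\<in>A. \<forall>d\<in>A'.
        smooth_on (chart_map d \<circ> f \<circ> chart_inv c)
          (chart_map c ` {p \<in> chart_dom c \<inter> S. f p \<in> chart_dom d}))"

definition diffeomorphism_on ::
  "'g topology \<Rightarrow> ('g, 'e::euclidean_space) chart set \<Rightarrow> 'g set \<Rightarrow>
   'h topology \<Rightarrow> ('h, 'f::euclidean_space) chart set \<Rightarrow> ('g \<Rightarrow> 'h) \<Rightarrow> bool" where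
  "diffeomorphism_on T A S T' A' f \<longleftrightarrow>
     openin T S \<and> openin T' (f ` S) \<and> inj_on f S \<and>
     smooth_map_on T A S T' A' f \<and>
     smooth_map_on T' A' (f ` S) T A (inv_into S f)"

definition prod_atlas ::
  "('g, 'e::euclidean_space) chart set \<Rightarrow> ('h, 'f::euclidean_space) chart set \<Rightarrow>
   ('g \<times> 'h, 'e \<times> 'f) chart set" where
  "prod_atlas A B =
     {(chart_dom c \<times> chart_dom d, map_prod (chart_map c) (chart_map d)) | c d. c \<in> A \<and> d \<in> B}"

definition euclidean_atlas :: "('e, 'e::euclidean_space) chart set" where
  "euclidean_atlas = {(UNIV, id)}"


section \<open>Lie groups\<close>

locale lie_group = group G + smooth_manifold T A
  for G :: "('g, 'm) monoid_scheme" (structure)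
    and T :: "'g topology" and A :: "('g, 'e::euclidean_space) chart set" +
  assumes topspace_eq_carrier: "topspace T = carrier G"
    and smooth_mult:
      "smooth_map_on (prod_topology T T) (prod_atlas A A) (topspace (prod_topology T T)) T A
         (\<lambda>(g, h). g \<otimes> h)"
    and smooth_inv: "smooth_map_on T A (topspace T) T A (\<lambda>g. inv g)"

text \<open>
  The Lie algebra, i.e. the tangent space at \<open>\<one>\<close>, is realised on the model space \<open>'e\<close>: for a
  chart \<open>\<kappa>\<close> at \<open>\<one>\<close>, the differential of \<open>\<kappa>\<close> at \<open>\<one>\<close> is a linear isomorphism from the
  tangent space onto \<open>'e\<close>, and tangent vectors at \<open>\<one>\<close> are identified with their coordinate
  vectors in \<open>\<kappa>\<close>. All structure on the Lie algebra below is expressed in these coordinates.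
\<close>
definition identity_chart ::
  "('g, 'm) monoid_scheme \<Rightarrow> ('g, 'e::euclidean_space) chart set \<Rightarrow> ('g, 'e) chart \<Rightarrow> bool" where
  "identity_chart G A \<kappa> \<longleftrightarrow> \<kappa> \<in> A \<and> \<one>\<^bsub>G\<^esub> \<in> chart_dom \<kappa>"

text \<open>
  Coordinates, near \<open>\<one>\<close>, of the left-invariant vector field with value \<open>v\<close> at \<open>\<one>\<close>: at the
  point with coordinates \<open>y\<close> it is the image of \<open>v\<close> under the differential of left translation.
\<close>
definition left_invariant_field ::
  "('g, 'm) monoid_scheme \<Rightarrow> ('g, 'e::euclidean_space) chart \<Rightarrow> 'e \<Rightarrow> 'e \<Rightarrow> 'e" where
  "left_invariant_field G \<kappa> v y =
     frechet_derivative (\<lambda>z. chart_map \<kappa> (chart_inv \<kappa> y \<otimes>\<^bsub>G\<^esub> chart_inv \<kappa> z))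
       (at (chart_map \<kappa> \<one>\<^bsub>G\<^esub>)) v"

text \<open>
  Value at \<open>\<one>\<close> of the commutator of left-invariant vector fields; in coordinates
  \<open>[X, Y] = DY X - DX Y\<close>.
\<close>
definition lie_bracket ::
  "('g, 'm) monoid_scheme \<Rightarrow> ('g, 'e::euclidean_space) chart \<Rightarrow> 'e \<Rightarrow> 'e \<Rightarrow> 'e" where
  "lie_bracket G \<kappa> v w =
     frechet_derivative (left_invariant_field G \<kappa> w) (at (chart_map \<kappa> \<one>\<^bsub>G\<^esub>)) v -
     frechet_derivative (left_invariant_field G \<kappa> v) (at (chart_map \<kappa> \<one>\<^bsub>G\<^esub>)) w"

text \<open>The differential at \<open>\<one>\<close> of conjugation by \<open>g\<close>.\<close>
definition Ad ::
  "('g, 'm) monoid_scheme \<Rightarrow> ('g, 'e::euclidean_space) chart \<Rightarrow> 'g \<Rightarrow> 'e \<Rightarrow> 'e" where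
  "Ad G \<kappa> g v =
     frechet_derivative (\<lambda>y. chart_map \<kappa> (g \<otimes>\<^bsub>G\<^esub> chart_inv \<kappa> y \<otimes>\<^bsub>G\<^esub> inv\<^bsub>G\<^esub> g))
       (at (chart_map \<kappa> \<one>\<^bsub>G\<^esub>)) v"

definition one_parameter_subgroup ::
  "('g, 'm) monoid_scheme \<Rightarrow> 'g topology \<Rightarrow> ('g, 'e::euclidean_space) chart set \<Rightarrow>
   ('g, 'e) chart \<Rightarrow> 'e \<Rightarrow> (real \<Rightarrow> 'g) \<Rightarrow> bool" where
  "one_parameter_subgroup G T A \<kappa> v \<theta> \<longleftrightarrow>
     smooth_map_on euclidean euclidean_atlas UNIV T A \<theta> \<and>
     (\<forall>s t. \<theta> (s + t) = \<theta> s \<otimes>\<^bsub>G\<^esub> \<theta> t) \<and>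
     ((\<lambda>t. chart_map \<kappa> (\<theta> t)) has_vector_derivative v) (at 0)"

definition lie_exp ::
  "('g, 'm) monoid_scheme \<Rightarrow> 'g topology \<Rightarrow> ('g, 'e::euclidean_space) chart set \<Rightarrow>
   ('g, 'e) chart \<Rightarrow> 'e \<Rightarrow> 'g" where
  "lie_exp G T A \<kappa> v = (THE \<theta>. one_parameter_subgroup G T A \<kappa> v \<theta>) 1"


section \<open>Semisimple Lie algebras\<close>

definition lie_ideal :: "('e::real_vector \<Rightarrow> 'e \<Rightarrow> 'e) \<Rightarrow> 'e set \<Rightarrow> bool" where
  "lie_ideal br I \<longleftrightarrow> subspace I \<and> (\<forall>x\<in>I. \<forall>y. br y x \<in> I)"

definition derived_algebra :: "('e::real_vector \<Rightarrow> 'e \<Rightarrow> 'e) \<Rightarrow> 'e set \<Rightarrow> 'e set" where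
  "derived_algebra br I = span {br x y | x y. x \<in> I \<and> y \<in> I}"

definition solvable_algebra :: "('e::real_vector \<Rightarrow> 'e \<Rightarrow> 'e) \<Rightarrow> 'e set \<Rightarrow> bool" where
  "solvable_algebra br I \<longleftrightarrow> (\<exists>n. (derived_algebra br ^^ n) I = {0})"

definition semisimple_algebra :: "('e::real_vector \<Rightarrow> 'e \<Rightarrow> 'e) \<Rightarrow> bool" where
  "semisimple_algebra br \<longleftrightarrow> (\<forall>I. lie_ideal br I \<and> solvable_algebra br I \<longrightarrow> I = {0})"


section \<open>Finsler norms\<close>

definition finsler_norm :: "('e::real_vector \<Rightarrow> real) \<Rightarrow> bool" where
  "finsler_norm N \<longleftrightarrow>
     (\<forall>x. 0 \<le> N x) \<and>
     (\<forall>x y. N (x + y) \<le> N x + N y) \<and>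
     (\<forall>c x. 0 \<le> c \<longrightarrow> N (c *\<^sub>R x) = c * N x) \<and>
     (\<forall>x. N x = 0 \<longrightarrow> x = 0)"

definition functional_norm :: "('e::real_vector \<Rightarrow> real) \<Rightarrow> ('e \<Rightarrow> real) \<Rightarrow> real" where
  "functional_norm N \<phi> = (SUP v\<in>{v. N v = 1}. \<phi> v)"

definition unit_functional :: "('e::real_vector \<Rightarrow> real) \<Rightarrow> ('e \<Rightarrow> real) \<Rightarrow> bool" where
  "unit_functional N \<phi> \<longleftrightarrow> linear \<phi> \<and> functional_norm N \<phi> = 1"

definition Ad_invariant ::
  "('g, 'm) monoid_scheme \<Rightarrow> ('g, 'e::euclidean_space) chart \<Rightarrow> ('e \<Rightarrow> real) \<Rightarrow> bool" where
  "Ad_invariant G \<kappa> N \<longleftrightarrow> (\<forall>g\<in>carrier G. \<forall>v. N (Ad G \<kappa> g v) = N v)"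

definition exp_diffeo_radius ::
  "('g, 'm) monoid_scheme \<Rightarrow> 'g topology \<Rightarrow> ('g, 'e::euclidean_space) chart set \<Rightarrow>
   ('g, 'e) chart \<Rightarrow> ('e \<Rightarrow> real) \<Rightarrow> real \<Rightarrow> bool" where
  "exp_diffeo_radius G T A \<kappa> N r \<longleftrightarrow>
     0 < r \<and>
     diffeomorphism_on euclidean euclidean_atlas {v. N v < r} T A (lie_exp G T A \<kappa>)"

definition injectivity_radius ::
  "('g, 'm) monoid_scheme \<Rightarrow> 'g topology \<Rightarrow> ('g, 'e::euclidean_space) chart set \<Rightarrow>
   ('g, 'e) chart \<Rightarrow> ('e \<Rightarrow> real) \<Rightarrow> real \<Rightarrow> bool" where
  "injectivity_radius G T A \<kappa> N R \<longleftrightarrow>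
     exp_diffeo_radius G T A \<kappa> N R \<and>
     (\<forall>r. exp_diffeo_radius G T A \<kappa> N r \<longrightarrow> r \<le> R)"


section \<open>Piecewise smooth paths and their length\<close>

text \<open>\<open>C\<^sup>1\<close> on the closed interval, with one-sided derivatives at the end points.\<close>
definition C1_path ::
  "'g topology \<Rightarrow> ('g, 'e::euclidean_space) chart set \<Rightarrow> (real \<Rightarrow> 'g) \<Rightarrow> real \<Rightarrow> real \<Rightarrow> bool" where
  "C1_path T A \<gamma> c d \<longleftrightarrow>
     continuous_map (top_of_set {c..d}) T \<gamma> \<and>
     (\<forall>\<psi>\<in>A. \<exists>D.
        (\<forall>t\<in>{c..d}. \<gamma> t \<in> chart_dom \<psi> \<longrightarrow>
           ((\<lambda>s. chart_map \<psi> (\<gamma> s)) has_vector_derivative D t) (at t within {c..d})) \<and>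
        continuous_on {t\<in>{c..d}. \<gamma> t \<in> chart_dom \<psi>} D)"

text \<open>
  Unlike the library's \<open>piecewise_C1_differentiable_on\<close>, the derivative is required to have
  one-sided limits at the break points.
\<close>
definition piecewise_C1_path ::
  "'g topology \<Rightarrow> ('g, 'e::euclidean_space) chart set \<Rightarrow> (real \<Rightarrow> 'g) \<Rightarrow> real \<Rightarrow> real \<Rightarrow> bool" where
  "piecewise_C1_path T A \<gamma> a b \<longleftrightarrow>
     continuous_map (top_of_set {a..b}) T \<gamma> \<and>
     (\<exists>(n::nat) \<tau>. \<tau> 0 = a \<and> \<tau> n = b \<and>
        (\<forall>i<n. \<tau> i < \<tau> (Suc i) \<and> C1_path T A \<gamma> (\<tau> i) (\<tau> (Suc i))))"

text \<open>
  The left logarithmic derivative \<open>\<gamma>\<^sub>t\<^sup>-\<^sup>1 \<gamma>\<^sub>t'\<close>: the differential of left translation by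
  \<open>\<gamma>\<^sub>t\<^sup>-\<^sup>1\<close> applied to the velocity at \<open>t\<close> is the velocity at \<open>s = t\<close> of
  \<open>s \<mapsto> \<gamma>\<^sub>t\<^sup>-\<^sup>1 \<gamma>\<^sub>s\<close>, a path that passes through \<open>\<one>\<close> at that time. It is meaningful except
  at the finitely many break points and end points.
\<close>
definition left_velocity ::
  "('g, 'm) monoid_scheme \<Rightarrow> ('g, 'e::euclidean_space) chart \<Rightarrow> (real \<Rightarrow> 'g) \<Rightarrow> real \<Rightarrow> 'e" where
  "left_velocity G \<kappa> \<gamma> t =
     vector_derivative (\<lambda>s. chart_map \<kappa> (inv\<^bsub>G\<^esub> (\<gamma> t) \<otimes>\<^bsub>G\<^esub> \<gamma> s)) (at t)"

definition path_len ::
  "('g, 'm) monoid_scheme \<Rightarrow> ('g, 'e::euclidean_space) chart \<Rightarrow> ('e \<Rightarrow> real) \<Rightarrow>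
   (real \<Rightarrow> 'g) \<Rightarrow> real \<Rightarrow> real \<Rightarrow> real" where
  "path_len G \<kappa> N \<gamma> a b = integral {a..b} (\<lambda>t. N (left_velocity G \<kappa> \<gamma> t))"

text \<open>Competing paths may be parametrised over any compact interval.\<close>
definition short_path ::
  "('g, 'm) monoid_scheme \<Rightarrow> 'g topology \<Rightarrow> ('g, 'e::euclidean_space) chart set \<Rightarrow>
   ('g, 'e) chart \<Rightarrow> ('e \<Rightarrow> real) \<Rightarrow> (real \<Rightarrow> 'g) \<Rightarrow> real \<Rightarrow> real \<Rightarrow> bool" where
  "short_path G T A \<kappa> N \<gamma> a b \<longleftrightarrow>
     (\<forall>c d \<delta>. c \<le> d \<and> piecewise_C1_path T A \<delta> c d \<and> \<delta> c = \<gamma> a \<and> \<delta> d = \<gamma> b \<longrightarrow>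
        path_len G \<kappa> N \<gamma> a b \<le> path_len G \<kappa> N \<delta> c d)"

end

theory Submission
  imports Defs
begin

text \<open>
  (i) is a first variation argument. Let \<open>w = \<gamma>\<^sup>-\<^sup>1 \<gamma>'\<close> have mean \<open>m\<close>. Multiplying \<open>\<gamma>\<close> on the right by a small
  closed curve whose velocity is \<open>\<epsilon> (m - w)\<close> gives, since the norm is \<open>Ad\<close>-invariant, a competitor of length at
  most \<open>\<integral> \<parallel>(1 - \<epsilon>) w + \<epsilon> m\<parallel> + o(\<epsilon>)\<close>. Hence \<open>\<integral> \<parallel>w\<parallel> \<le> \<parallel>\<integral> w\<parallel>\<close>, and a functional that norms \<open>\<integral> w\<close> norms almost
  every \<open>w\<^sub>t\<close>.

  (ii) Let \<open>D\<^sub>x\<close> be the left logarithmic derivative of \<open>exp\<close> at \<open>x\<close>. Differentiating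
  \<open>exp ((s + t) x) = exp (s x) exp (t x)\<close> shows that \<open>s D\<^sub>s\<^sub>x\<close> is a cocycle for \<open>A\<^sub>s = Ad (exp (s x))\<^sup>-\<^sup>1\<close>, so
  \<open>D\<^sub>x\<close> is nonexpansive. It fixes \<open>x\<close>, and the mean ergodic argument gives
  \<open>\<parallel>x\<parallel> \<le> \<parallel>x + D\<^sub>x z - z\<parallel>\<close>; this is a Gauss lemma: \<open>\<parallel>log \<delta>\<parallel>\<close> grows at most as fast as the length of \<open>\<delta>\<close>.
  Conversely let \<open>\<phi>\<close> norm all \<open>w\<^sub>t\<close>. Then \<open>g \<mapsto> \<phi> (Ad g w\<^sub>t)\<close> is maximal at \<open>1\<close>, so \<open>\<phi> \<circ> ad w\<^sub>t = 0\<close> and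
  \<open>\<phi>\<close> is invariant under \<open>Ad (\<gamma>\<^sub>t\<^sub>0\<^sup>-\<^sup>1 \<gamma>\<^sub>t)\<close>. As \<open>D\<^sub>x\<close> is onto, the cocycle identity makes \<open>\<phi>\<close> invariant under all
  \<open>A\<^sub>s\<close> with \<open>x = log (\<gamma>\<^sub>t\<^sub>0\<^sup>-\<^sup>1 \<gamma>\<^sub>t)\<close>, whence \<open>\<phi> \<circ> D\<^sub>x = \<phi>\<close>. So \<open>\<phi> (log (\<gamma>\<^sub>t\<^sub>0\<^sup>-\<^sup>1 \<gamma>\<^sub>t))\<close> equals the length of
  \<open>\<gamma>\<close> on \<open>[t\<^sub>0, t]\<close>, and the Gauss lemma bounds every competitor from below by it.
\<close>

section \<open>Calculus\<close>

text \<open>\<open>N\<close> need be neither smooth, strictly convex nor symmetric, so there is no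
  gradient and no orthogonality to compute with. Part (i) rests on an inequality of lengths, not on
  an Euler-Lagrange equation. In part (ii) the Gauss lemma is an estimate of left slopes: at a
  corner of \<open>N\<close> one-sided slopes differ, and the ergodic inequality, which bounds the
  norm near x from below, controls only the left one.

  Tangent vectors away from \<one> are avoided: every velocity is translated to \<one> and read in
  \<kappa>, and other charts serve only to show that derivatives exist and are continuous.

  Maximality on an \<open>Ad\<close> orbit kills \<phi> on ad z w with z arbitrary, whereas
  invariance along \<gamma> needs the arguments in the other order. Antisymmetry of
  \<open>ad\<close> bridges this, and it comes from the symmetry of the second derivative of the
  multiplication.

  A competitor may leave the image of the ball of radius \<open>R\<close>, where log has no meaning,
  so the distance from \<one> is truncated. A path of length exactly \<open>R\<close> may end
  outside this image, so that case is reached by a limit.\<close>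

lemma Ck_on_SucD:
  assumes "Ck_on (Suc k) f S"
  shows "\<And>x. x \<in> S \<Longrightarrow> (f has_derivative frechet_derivative f (at x)) (at x)"
    and "\<And>v. Ck_on k (\<lambda>x. frechet_derivative f (at x) v) S"
  using assms unfolding Ck_on.simps(2) by (metis frechet_derivative_works, metis)

lemma smooth_on_has_derivative:
  assumes "smooth_on f S" "x \<in> S"
  shows "(f has_derivative frechet_derivative f (at x)) (at x)"
proof (rule Ck_on_SucD(1)[OF _ assms(2)])
  show "Ck_on (Suc 0) f S" using assms(1) unfolding smooth_on_def by (rule spec)
qed

text \<open>\<open>Ck_on\<close> provides continuity of derivatives one direction at a time. A
  direction that moves as well is handled by expanding it in the finite basis.\<close>

lemma tendsto_linear_families:
  fixes D :: "'a \<Rightarrow> 'b::euclidean_space \<Rightarrow> 'c::real_normed_vector"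
  assumes lin: "\<forall>\<^sub>F i in F. linear (D i)" and lin0: "linear D0"
    and D: "\<And>b. b \<in> Basis \<Longrightarrow> ((\<lambda>i. D i b) \<longlongrightarrow> D0 b) F" and V: "(V \<longlongrightarrow> v) F"
  shows "((\<lambda>i. D i (V i)) \<longlongrightarrow> D0 v) F"
proof -
  have expand: "L v = (\<Sum>b\<in>Basis. (v \<bullet> b) *\<^sub>R L b)"
    if "linear L" for L :: "'b \<Rightarrow> 'c" and v
  proof -
    have "L v = L (\<Sum>b\<in>Basis. (v \<bullet> b) *\<^sub>R b)" by (simp add: euclidean_representation)
    also have "\<dots> = (\<Sum>b\<in>Basis. (v \<bullet> b) *\<^sub>R L b)"
      using that by (simp add: linear_sum linear_scale)
    finally show ?thesis .
  qed
  have "((\<lambda>i. \<Sum>b\<in>Basis. (V i \<bullet> b) *\<^sub>R D i b) \<longlongrightarrow> (\<Sum>b\<in>Basis. (v \<bullet> b) *\<^sub>R D0 b)) F"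
    by (intro tendsto_intros D V)
  moreover have "\<forall>\<^sub>F i in F. D i (V i) = (\<Sum>b\<in>Basis. (V i \<bullet> b) *\<^sub>R D i b)"
    using lin by eventually_elim (rule expand)
  ultimately have "((\<lambda>i. D i (V i)) \<longlongrightarrow> (\<Sum>b\<in>Basis. (v \<bullet> b) *\<^sub>R D0 b)) F"
    by (subst tendsto_cong)
  then show ?thesis by (subst expand[OF lin0])
qed

text \<open>Convergence on finitely many basis vectors is automatically uniform in v. The uniformity
  allows error terms proportional to the norm of a vector that varies with i.\<close>

lemma linear_families_near_id:
  fixes D :: "'a \<Rightarrow> 'b::euclidean_space \<Rightarrow> 'b"
  assumes lin: "\<forall>\<^sub>F i in F. linear (D i)" and D: "\<And>b. b \<in> Basis \<Longrightarrow> ((\<lambda>i. D i b) \<longlongrightarrow> b) F" and \<eta>: "0 < \<eta>"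
  shows "\<forall>\<^sub>F i in F. \<forall>v. norm (D i v - v) \<le> \<eta> * norm v"
proof -
  have "((\<lambda>i. \<Sum>b\<in>Basis. norm (D i b - b)) \<longlongrightarrow> (\<Sum>b\<in>(Basis::'b set). norm (b - b))) F"
    by (intro tendsto_sum tendsto_norm tendsto_diff tendsto_const D)
  then have "\<forall>\<^sub>F i in F. (\<Sum>b\<in>Basis. norm (D i b - b)) < \<eta>"
    using \<eta> by (intro order_tendstoD(2)) simp_all
  with lin show ?thesis
  proof eventually_elim
    case (elim i)
    have *: "linear (\<lambda>v. D i v - v)" by (intro linear_compose_sub elim(1) linear_ident)
    show ?case
    proof
      fix v :: 'b
      have "D i v - v = (\<lambda>v. D i v - v) (\<Sum>b\<in>Basis. (v \<bullet> b) *\<^sub>R b)"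
        by (simp add: euclidean_representation)
      also have "\<dots> = (\<Sum>b\<in>Basis. (v \<bullet> b) *\<^sub>R (D i b - b))"
        by (simp only: linear_sum[OF *] linear_scale[OF *])
      also have "norm \<dots> \<le> (\<Sum>b\<in>Basis. norm v * norm (D i b - b))"
        by (intro sum_norm_le) (simp add: mult_right_mono Basis_le_norm)
      also have "\<dots> = norm v * (\<Sum>b\<in>Basis. norm (D i b - b))" by (simp add: sum_distrib_left)
      also have "\<dots> \<le> norm v * \<eta>" using elim(2) by (intro mult_left_mono) auto
      finally show "norm (D i v - v) \<le> \<eta> * norm v" by (simp add: mult.commute)
    qed
  qed
qed

lemma smooth_on_tendsto_derivative:
  fixes f :: "'a::euclidean_space \<Rightarrow> 'b::real_normed_vector"
  assumes f: "smooth_on f S" and S: "open S" "x \<in> S"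
    and X: "(X \<longlongrightarrow> x) F" and V: "(V \<longlongrightarrow> v) F"
  shows "((\<lambda>i. frechet_derivative f (at (X i)) (V i)) \<longlongrightarrow> frechet_derivative f (at x) v) F"
proof (rule tendsto_linear_families[where D="\<lambda>i. frechet_derivative f (at (X i))", OF _ _ _ V])
  have lin: "linear (frechet_derivative f (at y))" if "y \<in> S" for y
    using smooth_on_has_derivative[OF f that] by (rule has_derivative_linear)
  show "linear (frechet_derivative f (at x))" by (rule lin) fact
  have "\<forall>\<^sub>F i in F. X i \<in> S" using X S by (rule topological_tendstoD)
  then show "\<forall>\<^sub>F i in F. linear (frechet_derivative f (at (X i)))"
    by eventually_elim (rule lin)
  fix b :: 'a
  have "Ck_on (Suc 0) f S" using f unfolding smooth_on_def by blast
  then have "continuous_on S (\<lambda>x. frechet_derivative f (at x) b)" by simp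
  then have "isCont (\<lambda>x. frechet_derivative f (at x) b) x"
    using S continuous_on_eq_continuous_at by blast
  then show "((\<lambda>i. frechet_derivative f (at (X i)) b) \<longlongrightarrow> frechet_derivative f (at x) b) F"
    by (rule isCont_tendsto_compose) fact
qed

lemma has_real_derivative_along_line:
  fixes f :: "'a::real_normed_vector \<Rightarrow> real"
  assumes "(f has_derivative D) (at (p + s *\<^sub>R u))"
  shows "((\<lambda>s. f (p + s *\<^sub>R u)) has_real_derivative D u) (at s)"
proof -
  have "((\<lambda>s. p + s *\<^sub>R u) has_derivative (\<lambda>k. k *\<^sub>R u)) (at s)"
    by (auto intro!: derivative_eq_intros)
  from has_derivative_compose[OF this assms]
  show ?thesis
    using linear_scale[OF has_derivative_linear[OF assms]]
    by (simp add: has_field_derivative_def mult_commute_abs)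
qed

text \<open>Schwarz's theorem by the classical argument: two applications of the mean value theorem
  show that the second difference quotient over a small parallelogram tends to
  \<open>D2 x u v\<close>, and the quotient does not change when u and v are exchanged.\<close>

lemma second_derivative_symmetric_real:
  fixes f :: "'a::real_normed_vector \<Rightarrow> real"
  assumes S: "open S" "x \<in> S"
    and D: "\<And>p. p \<in> S \<Longrightarrow> (f has_derivative D p) (at p)"
    and D2: "\<And>p w. p \<in> S \<Longrightarrow> ((\<lambda>p. D p w) has_derivative D2 p w) (at p)"
    and cont: "\<And>w w'. continuous_on S (\<lambda>p. D2 p w w')"
  shows "D2 x u v = D2 x v u"
proof -
  have main: "\<forall>d>0. \<exists>h0>0. \<forall>h. 0 < h \<and> h < h0 \<longrightarrow>
     \<bar>(f (x + h *\<^sub>R u + h *\<^sub>R v) - f (x + h *\<^sub>R u) - f (x + h *\<^sub>R v) + f x) / h\<^sup>2 - D2 x u v\<bar> < d"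
    for u v
  proof (intro allI impI)
    fix d :: real assume "d > 0"
    have "isCont (\<lambda>p. D2 p u v) x" using S cont continuous_on_eq_continuous_at by blast
    then obtain e1 where e1: "e1 > 0" "\<And>p. dist p x < e1 \<Longrightarrow> \<bar>D2 p u v - D2 x u v\<bar> < d"
      using \<open>d > 0\<close> unfolding continuous_at_eps_delta by (auto simp: dist_real_def)
    obtain e2 where e2: "e2 > 0" "ball x e2 \<subseteq> S" using S open_contains_ball by blast
    define e where "e = min e1 e2"
    have e: "e > 0" "e \<le> e1" "e \<le> e2" using e1 e2 by (auto simp: e_def)
    \<comment> \<open>Small enough for the whole parallelogram to lie in the ball of radius e around
      x; the summand 1 keeps the denominator positive when u and v vanish.\<close>
    define h0 where "h0 = e / (norm u + norm v + 1)"
    have pos: "norm u + norm v + 1 > 0" by (smt (verit) norm_ge_zero)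
    have h0: "h0 > 0" using e pos by (simp add: h0_def)
    have near: "dist (x + s *\<^sub>R u + t *\<^sub>R v) x < e" if "0 \<le> s" "s \<le> h" "0 \<le> t" "t \<le> h" "h < h0" for s t h
    proof -
      have "dist (x + s *\<^sub>R u + t *\<^sub>R v) x = norm (s *\<^sub>R u + t *\<^sub>R v)"
        by (simp add: dist_norm algebra_simps)
      also have "\<dots> \<le> s * norm u + t * norm v"
        using norm_triangle_ineq[of "s *\<^sub>R u" "t *\<^sub>R v"] that by simp
      also have "\<dots> \<le> h * norm u + h * norm v"
        using that by (intro add_mono mult_right_mono) auto
      also have "\<dots> \<le> h * (norm u + norm v + 1)" using that by (simp add: algebra_simps)
      also have "\<dots> < e" using that(5) pos by (simp add: h0_def field_simps)
      finally show ?thesis .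
    qed
    have inS: "x + s *\<^sub>R u + t *\<^sub>R v \<in> S" if "0 \<le> s" "s \<le> h" "0 \<le> t" "t \<le> h" "h < h0" for s t h
      using near[OF that] e e2 by (auto simp: dist_commute mem_ball subset_iff)
    show "\<exists>h0>0. \<forall>h. 0 < h \<and> h < h0 \<longrightarrow>
     \<bar>(f (x + h *\<^sub>R u + h *\<^sub>R v) - f (x + h *\<^sub>R u) - f (x + h *\<^sub>R v) + f x) / h\<^sup>2 - D2 x u v\<bar> < d"
    proof (intro exI[of _ h0] conjI h0 allI impI, elim conjE)
      fix h :: real assume h: "0 < h" "h < h0"
      define F where "F s = f (x + s *\<^sub>R u + h *\<^sub>R v) - f (x + s *\<^sub>R u + 0 *\<^sub>R v)" for s
      have F: "(F has_real_derivative D (x + s *\<^sub>R u + h *\<^sub>R v) u - D (x + s *\<^sub>R u + 0 *\<^sub>R v) u) (at s)"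
        if "0 \<le> s" "s \<le> h" for s
      proof -
        have *: "((\<lambda>s. f (x + s *\<^sub>R u + t *\<^sub>R v)) has_real_derivative D (x + s *\<^sub>R u + t *\<^sub>R v) u) (at s)"
          if t: "0 \<le> t" "t \<le> h" for t
        proof -
          have p: "x + s *\<^sub>R u + t *\<^sub>R v \<in> S" using inS[OF _ _ t] \<open>0 \<le> s\<close> \<open>s \<le> h\<close> h by blast
          then show ?thesis
            using has_real_derivative_along_line[of f _ "x + t *\<^sub>R v" s u] D[OF p]
            by (simp add: add.commute add.left_commute)
        qed
        show ?thesis unfolding F_def
          by (intro DERIV_diff *) (use h in auto)
      qed
      obtain s where s: "0 < s" "s < h"
        and Fs: "F h - F 0 = (h - 0) * (D (x + s *\<^sub>R u + h *\<^sub>R v) u - D (x + s *\<^sub>R u + 0 *\<^sub>R v) u)"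
        using MVT2[OF h(1) F] by blast
      have H: "((\<lambda>t. D (x + s *\<^sub>R u + t *\<^sub>R v) u) has_real_derivative
          D2 (x + s *\<^sub>R u + t *\<^sub>R v) u v) (at t)" if t: "0 \<le> t" "t \<le> h" for t
      proof -
        have p: "x + s *\<^sub>R u + t *\<^sub>R v \<in> S" using inS[OF _ _ t] s h by auto
        show ?thesis by (rule has_real_derivative_along_line[OF D2[OF p]])
      qed
      obtain t where t: "0 < t" "t < h"
        and Ht: "D (x + s *\<^sub>R u + h *\<^sub>R v) u - D (x + s *\<^sub>R u + 0 *\<^sub>R v) u
             = (h - 0) * D2 (x + s *\<^sub>R u + t *\<^sub>R v) u v"
        using MVT2[OF h(1) H] by blast
      have "F h - F 0 = h\<^sup>2 * D2 (x + s *\<^sub>R u + t *\<^sub>R v) u v"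
        unfolding Fs Ht by (simp add: power2_eq_square)
      then have "(f (x + h *\<^sub>R u + h *\<^sub>R v) - f (x + h *\<^sub>R u) - f (x + h *\<^sub>R v) + f x) / h\<^sup>2
          = D2 (x + s *\<^sub>R u + t *\<^sub>R v) u v"
        using h by (simp add: F_def field_simps)
      moreover have "dist (x + s *\<^sub>R u + t *\<^sub>R v) x < e1"
        using near[of s h t] s t h e by auto
      ultimately show "\<bar>(f (x + h *\<^sub>R u + h *\<^sub>R v) - f (x + h *\<^sub>R u) - f (x + h *\<^sub>R v) + f x) / h\<^sup>2 - D2 x u v\<bar> < d"
        using e1 by simp
    qed
  qed
  show ?thesis
  proof (rule ccontr)
    assume ne: "D2 x u v \<noteq> D2 x v u"
    define d where "d = \<bar>D2 x u v - D2 x v u\<bar> / 2"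
    have "d > 0" using ne by (simp add: d_def)
    obtain h1 where h1: "h1 > 0" "\<And>h. 0 < h \<Longrightarrow> h < h1 \<Longrightarrow>
     \<bar>(f (x + h *\<^sub>R u + h *\<^sub>R v) - f (x + h *\<^sub>R u) - f (x + h *\<^sub>R v) + f x) / h\<^sup>2 - D2 x u v\<bar> < d"
      using main[of u v, rule_format, OF \<open>d > 0\<close>] by auto
    obtain h2 where h2: "h2 > 0" "\<And>h. 0 < h \<Longrightarrow> h < h2 \<Longrightarrow>
     \<bar>(f (x + h *\<^sub>R v + h *\<^sub>R u) - f (x + h *\<^sub>R v) - f (x + h *\<^sub>R u) + f x) / h\<^sup>2 - D2 x v u\<bar> < d"
      using main[of v u, rule_format, OF \<open>d > 0\<close>] by auto
    define h where "h = min h1 h2 / 2"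
    have h: "0 < h" "h < h1" "h < h2" using h1 h2 by (auto simp: h_def)
    define q where "q = (f (x + h *\<^sub>R u + h *\<^sub>R v) - f (x + h *\<^sub>R u) - f (x + h *\<^sub>R v) + f x) / h\<^sup>2"
    have "(f (x + h *\<^sub>R v + h *\<^sub>R u) - f (x + h *\<^sub>R v) - f (x + h *\<^sub>R u) + f x) / h\<^sup>2 = q"
      by (simp add: q_def algebra_simps)
    then have "\<bar>q - D2 x u v\<bar> < d" "\<bar>q - D2 x v u\<bar> < d"
      using h1(2)[OF h(1,2)] h2(2)[OF h(1,3)] unfolding q_def by metis+
    moreover have "\<bar>D2 x u v - D2 x v u\<bar> = 2 * d" by (simp add: d_def)
    ultimately show False by linarith
  qed
qed

lemma smooth_on_second_derivative:
  fixes f :: "'a::euclidean_space \<Rightarrow> 'b::euclidean_space"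
  assumes f: "smooth_on f S" and S: "open S" "x \<in> S"
  defines "D2 \<equiv> \<lambda>p w. frechet_derivative (\<lambda>q. frechet_derivative f (at q) w) (at p)"
  shows "((\<lambda>p. frechet_derivative f (at p) w) has_derivative D2 x w) (at x)"
    and "D2 x u v = D2 x v u"
proof -
  have C2: "Ck_on (Suc (Suc 0)) f S" using f unfolding smooth_on_def by blast
  have D: "(f has_derivative frechet_derivative f (at p)) (at p)" if "p \<in> S" for p
    using Ck_on_SucD(1)[OF C2 that] .
  have D2: "((\<lambda>p. frechet_derivative f (at p) w) has_derivative D2 p w) (at p)" if "p \<in> S" for p w
    using Ck_on_SucD(1)[OF Ck_on_SucD(2)[OF C2] that] unfolding D2_def .
  have cont: "continuous_on S (\<lambda>p. D2 p w w')" for w w'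
    using Ck_on_SucD(2)[OF Ck_on_SucD(2)[OF C2]] unfolding D2_def by simp
  show "((\<lambda>p. frechet_derivative f (at p) w) has_derivative D2 x w) (at x)" by (rule D2) fact
  have "D2 x u v \<bullet> b = D2 x v u \<bullet> b" for b
  proof (rule second_derivative_symmetric_real[of S x "\<lambda>p. f p \<bullet> b" "\<lambda>p w. frechet_derivative f (at p) w \<bullet> b"
          "\<lambda>p w w'. D2 p w w' \<bullet> b"])
    show "((\<lambda>p. f p \<bullet> b) has_derivative (\<lambda>w. frechet_derivative f (at p) w \<bullet> b)) (at p)" if "p \<in> S" for p
      by (intro has_derivative_inner_left D that)
    show "((\<lambda>p. frechet_derivative f (at p) w \<bullet> b) has_derivative (\<lambda>w'. D2 p w w' \<bullet> b)) (at p)" if "p \<in> S" for p w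
      by (intro has_derivative_inner_left D2 that)
    show "continuous_on S (\<lambda>p. D2 p w w' \<bullet> b)" for w w'
      by (intro continuous_on_inner cont continuous_on_const)
  qed (fact S)+
  then show "D2 x u v = D2 x v u" by (blast intro: euclidean_eqI)
qed

text \<open>If the bound fails, tilting the difference of f and G gives an F with
  \<open>F c < F d\<close>. At the least point where F reaches \<open>F d\<close>, the left slope
  bound forces F to be larger just before, contradicting minimality. Left slopes suffice, so corners
  of f are harmless.\<close>

lemma le_of_left_slope_bound:
  fixes f G :: "real \<Rightarrow> real"
  assumes cd: "c \<le> d" and f: "continuous_on {c..d} f" and G: "continuous_on {c..d} G"
    and slope: "\<And>t \<eta>. c < t \<Longrightarrow> t \<le> d \<Longrightarrow> 0 < \<eta> \<Longrightarrow>
      \<forall>\<^sub>F s in at t within {c..t}. f t - f s \<le> G t - G s + (t - s) * \<eta>"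
  shows "f d - f c \<le> G d - G c"
proof (rule ccontr)
  assume neg: "\<not> ?thesis"
  then have "c < d" using cd by (cases "c = d") auto
  define \<eta> where "\<eta> = (f d - f c - (G d - G c)) / (2 * (d - c))"
  have \<eta>: "\<eta> > 0" using neg \<open>c < d\<close> by (simp add: \<eta>_def)
  \<comment> \<open>The mean slope of f - G is \<eta> * 2 and its left slopes are locally at most
    \<eta>; the tilt by \<eta> * 3/2 lies strictly between the two.\<close>
  define F where "F t = f t - G t - 2 * \<eta> * t * (3/4)" for t
  have contF: "continuous_on {c..d} F" unfolding F_def by (intro continuous_intros f G)
  have "2 * (\<eta> * (d - c)) = f d - f c - (G d - G c)" using \<open>c < d\<close> by (simp add: \<eta>_def field_simps)
  moreover have "\<eta> * (d - c) > 0" using \<eta> \<open>c < d\<close> by simp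
  ultimately have Fcd: "F c < F d" unfolding F_def by (simp add: algebra_simps)
  define S where "S = {t \<in> {c..d}. F d \<le> F t}"
  have "S = {c..d} \<inter> F -` {F d..}" by (auto simp: S_def)
  then have "closed S" using continuous_closed_preimage[OF contF] by simp
  moreover have "bounded S" using bounded_closed_interval[of c d] by (rule bounded_subset) (auto simp: S_def)
  ultimately have "compact S" by (simp add: compact_eq_bounded_closed)
  moreover have "d \<in> S" using cd by (auto simp: S_def)
  ultimately obtain t where t: "t \<in> S" "\<And>s. s \<in> S \<Longrightarrow> t \<le> s"
    using compact_attains_inf[of S] by blast
  have tcd: "c \<le> t" "t \<le> d" "F d \<le> F t" using t by (auto simp: S_def)
  then have "c < t" using Fcd by (cases "c = t") auto
  have "\<forall>\<^sub>F s in at t within {c..t}. f t - f s \<le> G t - G s + (t - s) * \<eta>"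
    by (rule slope) (use \<open>c < t\<close> tcd \<eta> in auto)
  then obtain r where r: "r > 0" "\<And>s. s \<in> {c..t} \<Longrightarrow> s \<noteq> t \<Longrightarrow> dist s t < r \<Longrightarrow> f t - f s \<le> G t - G s + (t - s) * \<eta>"
    unfolding eventually_at by blast
  define s where "s = max c (t - r/2)"
  have s: "c \<le> s" "s < t" "dist s t < r" using \<open>c < t\<close> r(1) by (auto simp: s_def dist_real_def)
  have "f t - f s \<le> G t - G s + (t - s) * \<eta>" using r(2)[of s] s by auto
  moreover have "(t - s) * \<eta> > 0" using s \<eta> by simp
  ultimately have "F t < F s" unfolding F_def by (simp add: algebra_simps)
  then have "s \<in> S" using tcd s by (auto simp: S_def)
  then show False using t(2)[of s] s by auto
qed

section \<open>Finsler norms\<close>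

context
  fixes N :: "'e::euclidean_space \<Rightarrow> real"
  assumes N: "finsler_norm N"
begin

lemma finsler_nonneg: "0 \<le> N x"
  and finsler_triangle: "N (x + y) \<le> N x + N y"
  and finsler_scale: "0 \<le> c \<Longrightarrow> N (c *\<^sub>R x) = c * N x"
  and finsler_eq_0_D: "N x = 0 \<Longrightarrow> x = 0"
  using N unfolding finsler_norm_def by blast+

lemma finsler_zero: "N 0 = 0"
  using finsler_scale[of 0 0] by simp

lemma finsler_pos: "x \<noteq> 0 \<Longrightarrow> 0 < N x"
  using finsler_nonneg[of x] finsler_eq_0_D[of x] by linarith

lemma finsler_sum: "N (\<Sum>i\<in>I. f i) \<le> (\<Sum>i\<in>I. N (f i))"
proof (induction I rule: infinite_finite_induct)
  case (insert i I)
  then show ?case using finsler_triangle[of "f i" "sum f I"] by simp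
qed (simp_all add: finsler_zero)

lemma convex_on_finsler: "convex_on UNIV N"
proof (rule convex_onI)
  fix t :: real and x y assume t: "0 < t" "t < 1"
  show "N ((1 - t) *\<^sub>R x + t *\<^sub>R y) \<le> (1 - t) * N x + t * N y"
    using finsler_triangle[of "(1 - t) *\<^sub>R x" "t *\<^sub>R y"] t by (simp add: finsler_scale)
qed simp

lemma continuous_on_finsler: "continuous_on S N"
  using convex_on_continuous[OF open_UNIV convex_on_finsler] continuous_on_subset by blast

lemma tendsto_finsler: "(f \<longlongrightarrow> x) F \<Longrightarrow> ((\<lambda>i. N (f i)) \<longlongrightarrow> N x) F"
  using continuous_on_finsler[of UNIV] continuous_on_eq_continuous_at[OF open_UNIV]
  by (blast intro: isCont_tendsto_compose)

lemma finsler_upper_bound: obtains C where "0 < C" "\<And>x. N x \<le> C * norm x"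
proof -
  have "compact (N ` sphere 0 1)"
    by (intro compact_continuous_image continuous_on_finsler compact_sphere)
  then obtain B where B: "\<And>x. norm x = 1 \<Longrightarrow> \<bar>N x\<bar> \<le> B"
    using compact_imp_bounded bounded_iff by (metis image_eqI mem_sphere_0 real_norm_def)
  have "N x \<le> (\<bar>B\<bar> + 1) * norm x" for x
  proof (cases "x = 0")
    case False
    have "N (x /\<^sub>R norm x) \<le> \<bar>B\<bar> + 1" using B[of "x /\<^sub>R norm x"] False by (simp add: sgn_div_norm[symmetric] norm_sgn)
    then show ?thesis using False by (simp add: finsler_scale field_simps)
  qed (simp add: finsler_zero)
  then show thesis using that[of "\<bar>B\<bar> + 1"] by (simp add: add_nonneg_pos)
qed

lemma finsler_lower_bound: obtains c where "0 < c" "\<And>x. c * norm x \<le> N x"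
proof -
  obtain b :: 'e where b: "b \<in> Basis" using nonempty_Basis by blast
  then have "sphere (0::'e) 1 \<noteq> {}" by (auto intro!: exI[of _ b])
  then obtain u where u: "norm u = 1" "\<And>y. norm y = 1 \<Longrightarrow> N u \<le> N y"
    using continuous_attains_inf[OF compact_sphere _ continuous_on_finsler, of 0 1] by auto
  have "N u * norm x \<le> N x" for x
  proof (cases "x = 0")
    case False
    have "N u \<le> N (x /\<^sub>R norm x)" using u(2)[of "x /\<^sub>R norm x"] False by simp
    then show ?thesis using False by (simp add: finsler_scale field_simps)
  qed (simp add: finsler_zero)
  moreover have "0 < N u" using u by (intro finsler_pos) auto
  ultimately show thesis using that by blast
qed

lemma compact_finsler_ball: "compact {x. N x \<le> r}"
proof -
  obtain c where c: "0 < c" "\<And>x. c * norm x \<le> N x" by (rule finsler_lower_bound) blast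
  have "norm x \<le> r / c" if "N x \<le> r" for x
    using c(2)[of x] that c(1) by (simp add: field_simps)
  then have "bounded {x. N x \<le> r}" unfolding bounded_iff by blast
  moreover have "closed {x. N x \<le> r}"
    by (intro closed_Collect_le continuous_on_finsler continuous_on_const)
  ultimately show ?thesis by (simp add: compact_eq_bounded_closed)
qed

lemma open_finsler_ball: "open {x. N x < r}"
  by (intro open_Collect_less continuous_on_finsler continuous_on_const)

lemma linear_le_finslerI:
  assumes "linear \<phi>" "\<And>v. N v = 1 \<Longrightarrow> \<phi> v \<le> 1"
  shows "\<phi> v \<le> N v"
proof (cases "v = 0")
  case True
  then show ?thesis using linear_0[OF assms(1)] finsler_zero by simp
next
  case False
  then have p: "N v > 0" by (rule finsler_pos)
  then have "\<phi> (v /\<^sub>R N v) \<le> 1" by (intro assms(2)) (simp add: finsler_scale)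
  then show ?thesis using p by (simp add: linear_scale[OF assms(1)] field_simps)
qed

text \<open>A real supremum bounds its values only when they are bounded above; here this follows
  from compactness of the unit ball.\<close>

lemma unit_functional_le:
  assumes "unit_functional N \<phi>"
  shows "\<phi> v \<le> N v"
proof (rule linear_le_finslerI)
  show lin: "linear \<phi>" using assms unfolding unit_functional_def by simp
  have "bdd_above (\<phi> ` {v. N v \<le> 1})"
    by (intro bounded_imp_bdd_above compact_imp_bounded compact_continuous_image compact_finsler_ball
        linear_continuous_on) (use lin in \<open>simp add: linear_conv_bounded_linear\<close>)
  then have "bdd_above (\<phi> ` {v. N v = 1})" by (rule bdd_above_mono) auto
  then show "\<phi> v \<le> 1" if "N v = 1" for v
    using cSUP_upper[of v "{v. N v = 1}" \<phi>] that assms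
    unfolding unit_functional_def functional_norm_def by simp
qed

lemma unit_functionalI:
  assumes "linear \<phi>" "\<And>v. \<phi> v \<le> N v" "x \<noteq> 0" "\<phi> x = N x"
  shows "unit_functional N \<phi>"
proof -
  have p: "N x > 0" by (rule finsler_pos) fact
  have "(SUP v\<in>{v. N v = 1}. \<phi> v) = 1"
  proof (rule cSup_eq_maximum)
    have "N (x /\<^sub>R N x) = 1" "\<phi> (x /\<^sub>R N x) = 1"
      using p assms by (simp_all add: finsler_scale linear_scale[OF assms(1)])
    then show "1 \<in> \<phi> ` {v. N v = 1}" by (metis (mono_tags) image_eqI mem_Collect_eq)
    show "y \<le> 1" if "y \<in> \<phi> ` {v. N v = 1}" for y using that assms(2) by (metis (mono_tags) imageE mem_Collect_eq)
  qed
  then show ?thesis using assms(1) by (simp add: unit_functional_def functional_norm_def)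
qed

text \<open>Hahn-Banach in finite dimension: a hyperplane separating x from the open ball of radius
  \<open>N x\<close>, rescaled so that its value at x is \<open>N x\<close>.\<close>

lemma norming_functional:
  assumes "x \<noteq> 0"
  obtains \<phi> where "unit_functional N \<phi>" "\<phi> x = N x"
proof -
  have Nx: "N x > 0" by (rule finsler_pos) fact
  have "convex {y. N y < N x}"
  proof (rule convexI, simp)
    fix y z and u v :: real
    assume *: "N y < N x" "N z < N x" "0 \<le> u" "0 \<le> v" "u + v = 1"
    have "N (u *\<^sub>R y + v *\<^sub>R z) \<le> u * N y + v * N z"
      using finsler_triangle[of "u *\<^sub>R y" "v *\<^sub>R z"] * by (simp add: finsler_scale)
    also have "\<dots> < N x" by (rule convex_bound_lt) (use * in auto)
    finally show "N (u *\<^sub>R y + v *\<^sub>R z) < N x" .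
  qed
  moreover have "0 \<in> {y. N y < N x}" using Nx finsler_zero by simp
  ultimately obtain a b where ab: "a \<noteq> 0" "\<And>y. N y < N x \<Longrightarrow> a \<bullet> y \<le> b" "b \<le> a \<bullet> x"
    using separating_hyperplane_sets[of "{y. N y < N x}" "{x}"] by auto
  obtain C where C: "0 < C" "\<And>x. N x \<le> C * norm x" by (rule finsler_upper_bound) blast
  have ax: "0 < a \<bullet> x"
  proof -
    \<comment> \<open>The multiple of a that still lies in the ball. It has positive product with a,
      which makes \<open>a \<bullet> x\<close> positive.\<close>
    define d where "d = N x / (2 * C * norm a)"
    have d: "d > 0" using Nx C ab(1) by (simp add: d_def)
    have "N (d *\<^sub>R a) \<le> C * (d * norm a)" using C(2)[of "d *\<^sub>R a"] d by simp
    also have "\<dots> = N x / 2" using C ab(1) by (simp add: d_def field_simps)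
    finally have "a \<bullet> (d *\<^sub>R a) \<le> a \<bullet> x" using ab(2)[of "d *\<^sub>R a"] ab(3) Nx by simp
    moreover have "a \<bullet> (d *\<^sub>R a) > 0" using d ab(1) by simp
    ultimately show ?thesis by linarith
  qed
  define \<phi> where "\<phi> y = (a \<bullet> y) * N x / (a \<bullet> x)" for y
  have lin: "linear \<phi>" by (rule linearI) (simp_all add: \<phi>_def inner_add_right add_divide_distrib distrib_right)
  have "\<phi> y \<le> N y" for y
  proof (rule linear_le_finslerI[OF lin])
    fix v assume v: "N v = 1"
    \<comment> \<open>The vector \<open>N x *\<^sub>R v\<close> is on the boundary of the open ball,
      so the separating inequality is carried to it from inside along its ray.\<close>
    have "(\<lambda>t. a \<bullet> (t *\<^sub>R v)) \<midarrow>N x\<rightarrow> a \<bullet> (N x *\<^sub>R v)" by (intro tendsto_intros)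
    then have "((\<lambda>t. a \<bullet> (t *\<^sub>R v)) \<longlongrightarrow> a \<bullet> (N x *\<^sub>R v)) (at_left (N x))"
      by (rule filterlim_mono) (auto simp: at_le)
    moreover have "\<forall>\<^sub>F t in at_left (N x). a \<bullet> (t *\<^sub>R v) \<le> a \<bullet> x"
      using eventually_at_left_real[OF Nx]
    proof eventually_elim
      case (elim t)
      then have "N (t *\<^sub>R v) < N x" using v by (simp add: finsler_scale)
      then show ?case using ab(2)[of "t *\<^sub>R v"] ab(3) by linarith
    qed
    ultimately have "a \<bullet> (N x *\<^sub>R v) \<le> a \<bullet> x"
      by (rule tendsto_upperbound) simp
    then show "\<phi> v \<le> 1" using ax by (simp add: \<phi>_def field_simps)
  qed
  moreover have "\<phi> x = N x" using ax by (simp add: \<phi>_def)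
  ultimately show thesis using that unit_functionalI[OF lin _ assms] by blast
qed

text \<open>Mean ergodic argument: the iterates of D applied to \<open>x + (D z - z)\<close> have
  norm at most that of this vector, and the first n of them sum telescopically to n x plus the
  bounded vector \<open>(D ^^ n) z - z\<close>. Dividing by n leaves \<open>N x\<close>.\<close>

lemma finsler_contraction_fixpoint:
  assumes lin: "linear D" and contr: "\<And>z. N (D z) \<le> N z" and Dx: "D x = x"
  shows "N x \<le> N (x + (D z - z))"
proof -
  obtain c where c: "0 < c" "\<And>x. c * norm x \<le> N x" by (rule finsler_lower_bound) blast
  obtain C where C: "0 < C" "\<And>x. N x \<le> C * norm x" by (rule finsler_upper_bound) blast
  \<comment> \<open>Bounds \<open>N (z - (D ^^ n) z)\<close> for all n. As \<open>N\<close> is not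
    symmetric, the sign change passes through the Euclidean norm, at the cost of c and C.\<close>
  define M where "M = N z + C * (N z / c)"
  have pow: "N ((D ^^ n) y) \<le> N y" for n y
    by (induction n) (use contr order_trans in auto)
  have fixn: "(D ^^ n) x = x" for n by (induction n) (auto simp: Dx)
  have linn: "linear (D ^^ n)" for n 
  proof (induction n)
    case (Suc n)
    then show ?case using linear_compose[OF Suc lin] by (simp add: o_def)
  qed (simp add: linear_id flip: id_def)
  have bound: "real n * N x \<le> real n * N (x + (D z - z)) + M" for n
  proof -
    have "(\<Sum>k<n. (D ^^ k) (x + (D z - z))) = real n *\<^sub>R x + ((D ^^ n) z - z)"
    proof (induction n)
      case (Suc n)
      have "(D ^^ n) (x + (D z - z)) = x + ((D ^^ Suc n) z - (D ^^ n) z)"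
        by (simp add: linear_add[OF linn] linear_diff[OF linn] fixn funpow_swap1)
      moreover have "(\<Sum>k<Suc n. (D ^^ k) (x + (D z - z)))
          = real n *\<^sub>R x + ((D ^^ n) z - z) + (D ^^ n) (x + (D z - z))"
        by (simp only: sum.lessThan_Suc Suc)
      ultimately show ?case by (simp only:) (simp add: algebra_simps)
    qed simp
    then have "N (real n *\<^sub>R x + ((D ^^ n) z - z)) \<le> (\<Sum>k<n. N ((D ^^ k) (x + (D z - z))))"
      using finsler_sum[of "\<lambda>k. (D ^^ k) (x + (D z - z))" "{..<n}"] by simp
    also have "\<dots> \<le> (\<Sum>k<n. N (x + (D z - z)))" by (intro sum_mono pow)
    finally have 1: "N (real n *\<^sub>R x + ((D ^^ n) z - z)) \<le> real n * N (x + (D z - z))" by simp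
    have "norm ((D ^^ n) z) \<le> N z / c"
      using c(2)[of "(D ^^ n) z"] pow[of n z] c(1) by (simp add: field_simps)
    then have "N (- (D ^^ n) z) \<le> C * (N z / c)"
      using C(2)[of "- (D ^^ n) z"] C(1) by (smt (verit) mult_left_mono norm_minus_cancel)
    then have "N (z - (D ^^ n) z) \<le> M"
      using finsler_triangle[of z "- (D ^^ n) z"] by (simp add: M_def)
    moreover have "N (real n *\<^sub>R x) \<le> N (real n *\<^sub>R x + ((D ^^ n) z - z)) + N (z - (D ^^ n) z)"
      using finsler_triangle[of "real n *\<^sub>R x + ((D ^^ n) z - z)" "z - (D ^^ n) z"] by simp
    ultimately show ?thesis using 1 by (simp add: finsler_scale)
  qed
  show ?thesis
  proof (rule ccontr)
    assume "\<not> ?thesis"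
    then have d: "0 < N x - N (x + (D z - z))" by simp
    obtain n where "M < real n * (N x - N (x + (D z - z)))"
      using reals_Archimedean3[OF d] by blast
    then show False using bound[of n] by (simp add: algebra_simps)
  qed
qed

end

section \<open>Charts and differentiable maps into a manifold\<close>

context smooth_manifold
begin

lemma openin_chart_dom: "c \<in> A \<Longrightarrow> openin T (chart_dom c)"
  and open_chart_image: "c \<in> A \<Longrightarrow> open (chart_map c ` chart_dom c)"
  using charts unfolding is_chart_def by blast+

lemma chart_dom_topspace: "c \<in> A \<Longrightarrow> chart_dom c \<subseteq> topspace T"
  by (intro openin_subset openin_chart_dom)

lemma chart_at: "g \<in> topspace T \<Longrightarrow> \<exists>c\<in>A. g \<in> chart_dom c"
  using cover by blast

lemma inj_on_chart: "c \<in> A \<Longrightarrow> inj_on (chart_map c) (chart_dom c)"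
  using charts[of c] chart_dom_topspace[of c]
  unfolding is_chart_def homeomorphic_eq_everything_map by (simp add: Int_absorb1)

lemma chart_inv_chart_map: "c \<in> A \<Longrightarrow> g \<in> chart_dom c \<Longrightarrow> chart_inv c (chart_map c g) = g"
  unfolding chart_inv_def by (rule inv_into_f_f[OF inj_on_chart])

lemma open_chart_map_image:
  assumes c: "c \<in> A" and U: "openin T U" "U \<subseteq> chart_dom c"
  shows "open (chart_map c ` U)"
proof -
  have "open_map (subtopology T (chart_dom c)) (top_of_set (chart_map c ` chart_dom c)) (chart_map c)"
    using charts[OF c] unfolding is_chart_def homeomorphic_eq_everything_map by simp
  moreover have "openin (subtopology T (chart_dom c)) U"
    using U by (simp add: openin_open_subtopology openin_chart_dom c)
  ultimately have "openin (top_of_set (chart_map c ` chart_dom c)) (chart_map c ` U)"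
    unfolding open_map_def by blast
  then show ?thesis using open_chart_image[OF c] openin_open_trans by blast
qed

lemma openin_chart_preimage:
  assumes c: "c \<in> A" and S: "open S"
  shows "openin T {p \<in> chart_dom c. chart_map c p \<in> S}"
proof -
  have "continuous_map (subtopology T (chart_dom c)) euclidean (chart_map c)"
    using charts[OF c] unfolding is_chart_def homeomorphic_eq_everything_map
    by (simp add: continuous_map_in_subtopology)
  then have "openin (subtopology T (chart_dom c)) {p \<in> topspace (subtopology T (chart_dom c)). chart_map c p \<in> S}"
    using S by (intro openin_continuous_map_preimage) auto
  moreover have "{p \<in> topspace (subtopology T (chart_dom c)). chart_map c p \<in> S} = {p \<in> chart_dom c. chart_map c p \<in> S}"
    using chart_dom_topspace[OF c] by auto
  ultimately show ?thesis using openin_trans_full openin_chart_dom[OF c] by metis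
qed

lemma limitin_chart:
  assumes c: "c \<in> A" and g: "g \<in> chart_dom c"
  shows "limitin T u g F \<longleftrightarrow>
    (\<forall>\<^sub>F i in F. u i \<in> chart_dom c) \<and> ((\<lambda>i. chart_map c (u i)) \<longlongrightarrow> chart_map c g) F"
proof (intro iffI conjI)
  assume L: "limitin T u g F"
  show "\<forall>\<^sub>F i in F. u i \<in> chart_dom c" using limitinD[OF L openin_chart_dom[OF c] g] .
  show "((\<lambda>i. chart_map c (u i)) \<longlongrightarrow> chart_map c g) F"
  proof (rule topological_tendstoI)
    fix S assume S: "open S" "chart_map c g \<in> S"
    have "\<forall>\<^sub>F i in F. u i \<in> {p \<in> chart_dom c. chart_map c p \<in> S}"
      using S g by (intro limitinD[OF L] openin_chart_preimage c) auto
    then show "\<forall>\<^sub>F i in F. chart_map c (u i) \<in> S" by eventually_elim simp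
  qed
next
  assume R: "(\<forall>\<^sub>F i in F. u i \<in> chart_dom c) \<and> ((\<lambda>i. chart_map c (u i)) \<longlongrightarrow> chart_map c g) F"
  show "limitin T u g F" unfolding limitin_def
  proof (intro conjI allI impI)
    show "g \<in> topspace T" using chart_dom_topspace c g by blast
    fix U assume U: "openin T U \<and> g \<in> U"
    have "open (chart_map c ` (U \<inter> chart_dom c))"
      using U by (intro open_chart_map_image c openin_Int openin_chart_dom) auto
    then have "\<forall>\<^sub>F i in F. chart_map c (u i) \<in> chart_map c ` (U \<inter> chart_dom c)"
      using R U g by (intro topological_tendstoD[of _ "chart_map c g"]) auto
    moreover have "\<forall>\<^sub>F i in F. u i \<in> chart_dom c" using R by blast
    ultimately show "\<forall>\<^sub>F i in F. u i \<in> U"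
      by eventually_elim (use inj_on_chart[OF c] in \<open>blast dest: inj_onD\<close>)
  qed
qed

lemma limitin_chart_inv:
  assumes c: "c \<in> A" and x: "x \<in> chart_map c ` chart_dom c" and X: "(X \<longlongrightarrow> x) F"
  shows "limitin T (\<lambda>i. chart_inv c (X i)) (chart_inv c x) F"
proof -
  have mem: "chart_inv c y \<in> chart_dom c \<and> chart_map c (chart_inv c y) = y"
    if "y \<in> chart_map c ` chart_dom c" for y
    using that chart_inv_chart_map[OF c] by auto
  have "\<forall>\<^sub>F i in F. X i \<in> chart_map c ` chart_dom c"
    using topological_tendstoD[OF X open_chart_image[OF c] x] .
  then have "\<forall>\<^sub>F i in F. chart_inv c (X i) \<in> chart_dom c"
     and "\<forall>\<^sub>F i in F. X i = chart_map c (chart_inv c (X i))"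
    by (eventually_elim, use mem in auto)+
  then show ?thesis
    using mem[OF x] X by (subst limitin_chart[OF c]) (auto elim: Lim_transform_eventually)
qed

text \<open>
  Outside its domain a chart map is arbitrary, so continuity has to be part of differentiability.
\<close>
definition gderiv ::
  "('g, 'e) chart \<Rightarrow> ('x::real_normed_vector \<Rightarrow> 'g) \<Rightarrow> ('x \<Rightarrow> 'e) \<Rightarrow> 'x \<Rightarrow> 'x set \<Rightarrow> bool" where
  "gderiv c u L x S \<longleftrightarrow> limitin T u (u x) (at x within S) \<and> u x \<in> chart_dom c \<and>
     ((\<lambda>y. chart_map c (u y)) has_derivative L) (at x within S)"

lemma gderivD:
  assumes "gderiv c u L x S"
  shows "limitin T u (u x) (at x within S)" "u x \<in> chart_dom c"
    "((\<lambda>y. chart_map c (u y)) has_derivative L) (at x within S)" "linear L"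
  using assms has_derivative_linear unfolding gderiv_def by auto

lemma gderiv_eventually:
  assumes "gderiv c u L x S" "c \<in> A"
  shows "\<forall>\<^sub>F y in at x within S. u y \<in> chart_dom c"
  using limitinD[OF gderivD(1)[OF assms(1)] openin_chart_dom[OF assms(2)] gderivD(2)[OF assms(1)]] .

lemma gderiv_transform:
  assumes "gderiv c u L x S" "\<forall>\<^sub>F y in at x within S. u y = v y" "u x = v x" "x \<in> S"
  shows "gderiv c v L x S"
proof -
  have "limitin T v (u x) (at x within S)"
    using gderivD(1)[OF assms(1)] by (rule limitin_transform_eventually[OF assms(2)])
  moreover have "((\<lambda>y. chart_map c (v y)) has_derivative L) (at x within S)"
  proof (rule has_derivative_transform_eventually[OF gderivD(3)[OF assms(1)]])
    show "\<forall>\<^sub>F y in at x within S. chart_map c (u y) = chart_map c (v y)"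
      using assms(2) by eventually_elim simp
  qed (use assms(3,4) in simp_all)
  ultimately show ?thesis using assms unfolding gderiv_def by simp
qed

lemma gderiv_const: "g \<in> chart_dom c \<Longrightarrow> c \<in> A \<Longrightarrow> gderiv c (\<lambda>_. g) (\<lambda>_. 0) x S"
  using chart_dom_topspace[of c] unfolding gderiv_def by auto

lemma gderiv_subset: "gderiv c u L x S \<Longrightarrow> S' \<subseteq> S \<Longrightarrow> gderiv c u L x S'"
  unfolding gderiv_def limitin_def
  by (meson at_le filter_leD has_derivative_subset)

lemma gderiv_compose:
  assumes f: "(f has_derivative f') (at x within S)" and u: "gderiv c u L (f x) R"
    and fS: "f ` S \<subseteq> R"
  shows "gderiv c (\<lambda>y. u (f y)) (\<lambda>h. L (f' h)) x S"
proof -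
  have "limitin T (\<lambda>y. u (f y)) (u (f x)) (at x within S)"
    unfolding limitin_def
  proof (intro conjI allI impI)
    show "u (f x) \<in> topspace T" by (rule limitin_topspace[OF gderivD(1)[OF u]])
    fix U assume U: "openin T U \<and> u (f x) \<in> U"
    then have "\<forall>\<^sub>F y in at (f x) within R. u y \<in> U" by (intro limitinD[OF gderivD(1)[OF u]]) simp_all
    \<comment> \<open>Since f y may equal f x for y different from x, the punctured neighbourhood of
      f x is too small; the point itself is added.\<close>
    then have "\<forall>\<^sub>F y in nhds (f x). y \<in> R \<longrightarrow> u y \<in> U"
      using U unfolding eventually_at_filter by (auto elim: eventually_mono)
    moreover have "(f \<longlongrightarrow> f x) (at x within S)"
      using has_derivative_continuous[OF f] by (simp add: continuous_within)
    ultimately have "\<forall>\<^sub>F y in at x within S. f y \<in> R \<longrightarrow> u (f y) \<in> U"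
      by (auto simp: filterlim_iff)
    moreover have "\<forall>\<^sub>F y in at x within S. y \<in> S" by (simp add: eventually_at_filter)
    ultimately show "\<forall>\<^sub>F y in at x within S. u (f y) \<in> U"
      by eventually_elim (use fS in blast)
  qed
  moreover have "((\<lambda>y. chart_map c (u (f y))) has_derivative (\<lambda>h. L (f' h))) (at x within S)"
    by (rule has_derivative_in_compose[OF f has_derivative_subset[OF gderivD(3)[OF u] fS]])
  ultimately show ?thesis using gderivD(2)[OF u] unfolding gderiv_def by simp
qed

lemma gderiv_chart_inv:
  assumes c: "c \<in> A" and x: "x \<in> chart_map c ` chart_dom c"
  shows "gderiv c (chart_inv c) (\<lambda>h. h) x UNIV"
  unfolding gderiv_def
proof (intro conjI)
  show "chart_inv c x \<in> chart_dom c" using x chart_inv_chart_map[OF c] by auto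
  show "limitin T (chart_inv c) (chart_inv c x) (at x)"
    using limitin_chart_inv[OF c x, of "\<lambda>y. y"] by auto
  have "\<forall>\<^sub>F y in at x. y \<in> chart_map c ` chart_dom c"
    using open_chart_image[OF c] x eventually_at_topological by blast
  then have "\<forall>\<^sub>F y in at x. y = chart_map c (chart_inv c y)"
    by eventually_elim (use chart_inv_chart_map[OF c] in auto)
  then show "((\<lambda>y. chart_map c (chart_inv c y)) has_derivative (\<lambda>h. h)) (at x)"
    by (intro has_derivative_transform_eventually[OF has_derivative_ident])
       (use x chart_inv_chart_map[OF c] in auto)
qed

definition (in -) chart_expr where
  "chart_expr c d f = chart_map d \<circ> f \<circ> chart_inv c"

lemma smooth_map_expr:
  assumes f: "smooth_map_on T A S T' A' f" and S: "openin T S"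
    and c: "c \<in> A" and d: "d \<in> A'" "openin T' (chart_dom d)"
  defines "\<Omega> \<equiv> chart_map c ` {p \<in> chart_dom c \<inter> S. f p \<in> chart_dom d}"
  shows "smooth_on (chart_expr c d f) \<Omega>" "open \<Omega>"
proof -
  show "smooth_on (chart_expr c d f) \<Omega>"
    using f c d unfolding smooth_map_on_def \<Omega>_def chart_expr_def by blast
  have "continuous_map (subtopology T S) T' f" using f unfolding smooth_map_on_def by blast
  then have "openin (subtopology T S) {p \<in> topspace (subtopology T S). f p \<in> chart_dom d}"
    by (rule openin_continuous_map_preimage[OF _ d(2)])
  then have "openin T {p \<in> topspace (subtopology T S). f p \<in> chart_dom d}"
    by (rule openin_trans_full) (rule S)
  then have "openin T (chart_dom c \<inter> {p \<in> topspace (subtopology T S). f p \<in> chart_dom d})"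
    by (intro openin_Int openin_chart_dom c)
  moreover have "chart_dom c \<inter> {p \<in> topspace (subtopology T S). f p \<in> chart_dom d}
     = {p \<in> chart_dom c \<inter> S. f p \<in> chart_dom d}"
    using chart_dom_topspace[OF c] by auto
  ultimately show "open \<Omega>" unfolding \<Omega>_def by (intro open_chart_map_image c) auto
qed

lemma chart_expr_chart_map:
  "c \<in> A \<Longrightarrow> p \<in> chart_dom c \<Longrightarrow> chart_expr c d f (chart_map c p) = chart_map d (f p)"
  by (simp add: chart_expr_def chart_inv_chart_map)

end

section \<open>Differentiating products in a Lie group\<close>

locale based_lie_group = lie_group G T A
  for G :: "('g, 'm) monoid_scheme" (structure)
    and T :: "'g topology" and A :: "('g, 'e::euclidean_space) chart set" +
  fixes \<kappa> :: "('g, 'e) chart"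
  assumes identity_chart: "identity_chart G A \<kappa>"
begin

lemma \<kappa>_in_A [simp]: "\<kappa> \<in> A" and one_in_\<kappa> [simp]: "\<one> \<in> chart_dom \<kappa>"
  using identity_chart unfolding identity_chart_def by simp_all

lemma limitin_carrier: "limitin T u g F \<Longrightarrow> g \<in> carrier G"
  using limitin_topspace[of T u g F] topspace_eq_carrier by simp

lemma chart_dom_carrier: "c \<in> A \<Longrightarrow> g \<in> chart_dom c \<Longrightarrow> g \<in> carrier G"
  using chart_dom_topspace[of c] topspace_eq_carrier by auto

lemma limitin_eventually_carrier: "limitin T u g F \<Longrightarrow> \<forall>\<^sub>F i in F. u i \<in> carrier G"
  using limitinD[of T u g F "topspace T"] limitin_topspace[of T u g F] topspace_eq_carrier
  by (metis openin_topspace)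

lemma gderiv_carrier: "gderiv c u L x S \<Longrightarrow> u x \<in> carrier G"
  by (rule limitin_carrier[OF gderivD(1)])

lemma chart_at_carrier: "g \<in> carrier G \<Longrightarrow> \<exists>c\<in>A. g \<in> chart_dom c"
  using chart_at[of g] topspace_eq_carrier by simp

lemma limitin_mult:
  assumes u: "limitin T u g F" and v: "limitin T v h F"
  shows "limitin T (\<lambda>i. u i \<otimes> v i) (g \<otimes> h) F"
  unfolding limitin_def
proof (intro conjI allI impI)
  show "g \<otimes> h \<in> topspace T"
    using limitin_carrier[OF u] limitin_carrier[OF v] topspace_eq_carrier by simp
  fix U assume U: "openin T U \<and> g \<otimes> h \<in> U"
  let ?P = "{p \<in> topspace (prod_topology T T). (\<lambda>(g, h). g \<otimes> h) p \<in> U}"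
  have "continuous_map (prod_topology T T) T (\<lambda>(g, h). g \<otimes> h)"
    using smooth_mult unfolding smooth_map_on_def subtopology_topspace by blast
  then have P: "openin (prod_topology T T) ?P"
    using U by (intro openin_continuous_map_preimage) auto
  have lim: "limitin (prod_topology T T) (\<lambda>i. (u i, v i)) (g, h) F"
    using u v by (simp add: limitin_pairwise o_def)
  have "(g, h) \<in> ?P"
    using U limitin_topspace[OF u] limitin_topspace[OF v] by simp
  from limitinD[OF lim P this] have "\<forall>\<^sub>F i in F. (u i, v i) \<in> ?P" .
  then show "\<forall>\<^sub>F i in F. u i \<otimes> v i \<in> U" by eventually_elim simp
qed

lemma limitin_inv:
  assumes u: "limitin T u g F"
  shows "limitin T (\<lambda>i. inv (u i)) (inv g) F"
  unfolding limitin_def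
proof (intro conjI allI impI)
  show "inv g \<in> topspace T" using limitin_carrier[OF u] topspace_eq_carrier by simp
  fix U assume U: "openin T U \<and> inv g \<in> U"
  have "continuous_map T T (\<lambda>g. inv g)"
    using smooth_inv unfolding smooth_map_on_def subtopology_topspace by blast
  then have "openin T {p \<in> topspace T. inv p \<in> U}"
    using U by (intro openin_continuous_map_preimage) auto
  then have "\<forall>\<^sub>F i in F. u i \<in> {p \<in> topspace T. inv p \<in> U}"
    using U limitin_topspace[OF u] by (intro limitinD[OF u]) auto
  then show "\<forall>\<^sub>F i in F. inv (u i) \<in> U" by eventually_elim simp
qed

text \<open>The multiplication in coordinates. Three charts are allowed because the two factors and
  their product need not lie in a common one.\<close>

definition mulc where
  "mulc c1 c2 c3 = chart_expr (chart_dom c1 \<times> chart_dom c2, map_prod (chart_map c1) (chart_map c2)) c3 (\<lambda>(g, h). g \<otimes> h)"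

definition mulc_dom where
  "mulc_dom c1 c2 c3 = map_prod (chart_map c1) (chart_map c2) `
     {p \<in> chart_dom c1 \<times> chart_dom c2. fst p \<otimes> snd p \<in> chart_dom c3}"

lemma mulc_apply:
  assumes c: "c1 \<in> A" "c2 \<in> A" and g: "g \<in> chart_dom c1" "h \<in> chart_dom c2"
  shows "mulc c1 c2 c3 (chart_map c1 g, chart_map c2 h) = chart_map c3 (g \<otimes> h)"
proof -
  have "inj_on (map_prod (chart_map c1) (chart_map c2)) (chart_dom c1 \<times> chart_dom c2)"
    using inj_on_chart[OF c(1)] inj_on_chart[OF c(2)] by (auto simp: inj_on_def)
  then have "inv_into (chart_dom c1 \<times> chart_dom c2) (map_prod (chart_map c1) (chart_map c2))
      (chart_map c1 g, chart_map c2 h) = (g, h)"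
    using g by (intro inv_into_f_eq) auto
  then show ?thesis unfolding mulc_def chart_expr_def chart_inv_def by simp
qed

lemma smooth_on_mulc:
  assumes c: "c1 \<in> A" "c2 \<in> A" "c3 \<in> A"
  shows "smooth_on (mulc c1 c2 c3) (mulc_dom c1 c2 c3)"
proof -
  let ?c = "(chart_dom c1 \<times> chart_dom c2, map_prod (chart_map c1) (chart_map c2))"
  have "?c \<in> prod_atlas A A" using c unfolding prod_atlas_def by blast
  then have "smooth_on (chart_map c3 \<circ> (\<lambda>(g, h). g \<otimes> h) \<circ> chart_inv ?c)
      (chart_map ?c ` {p \<in> chart_dom ?c \<inter> topspace (prod_topology T T). (\<lambda>(g, h). g \<otimes> h) p \<in> chart_dom c3})"
    using smooth_mult c(3) unfolding smooth_map_on_def by blast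
  moreover have "chart_map ?c ` {p \<in> chart_dom ?c \<inter> topspace (prod_topology T T). (\<lambda>(g, h). g \<otimes> h) p \<in> chart_dom c3}
    = mulc_dom c1 c2 c3"
    using chart_dom_topspace[OF c(1)] chart_dom_topspace[OF c(2)] unfolding mulc_dom_def
    by (intro arg_cong2[where f=image]) (auto simp: case_prod_beta)
  ultimately show ?thesis unfolding mulc_def chart_expr_def by simp
qed

lemma open_mulc_dom:
  assumes c: "c1 \<in> A" "c2 \<in> A" "c3 \<in> A"
  shows "open (mulc_dom c1 c2 c3)"
proof (subst open_subopen, intro ballI)
  fix z assume "z \<in> mulc_dom c1 c2 c3"
  then obtain g h where z: "z = (chart_map c1 g, chart_map c2 h)"
    and gh: "g \<in> chart_dom c1" "h \<in> chart_dom c2" "g \<otimes> h \<in> chart_dom c3"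
    unfolding mulc_dom_def by auto
  let ?P = "{p \<in> topspace (prod_topology T T). (\<lambda>(g, h). g \<otimes> h) p \<in> chart_dom c3}"
  have "continuous_map (prod_topology T T) T (\<lambda>(g, h). g \<otimes> h)"
    using smooth_mult unfolding smooth_map_on_def subtopology_topspace by blast
  then have "openin (prod_topology T T) ?P"
    by (rule openin_continuous_map_preimage[OF _ openin_chart_dom[OF c(3)]])
  moreover have "(g, h) \<in> ?P" using gh chart_dom_topspace[OF c(1)] chart_dom_topspace[OF c(2)] by auto
  ultimately obtain U V where UV: "openin T U" "openin T V" "g \<in> U" "h \<in> V" "U \<times> V \<subseteq> ?P"
    unfolding openin_prod_topology_alt by meson
  let ?U = "chart_map c1 ` (U \<inter> chart_dom c1)" and ?V = "chart_map c2 ` (V \<inter> chart_dom c2)"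
  have "open ?U" "open ?V"
    using UV c by (auto intro!: open_chart_map_image openin_Int openin_chart_dom)
  then have "open (?U \<times> ?V)" by (rule open_Times)
  moreover have "z \<in> ?U \<times> ?V" using z gh UV by auto
  moreover have "?U \<times> ?V \<subseteq> mulc_dom c1 c2 c3"
  proof
    fix w assume "w \<in> ?U \<times> ?V"
    then obtain g' h' where w: "w = map_prod (chart_map c1) (chart_map c2) (g', h')" "g' \<in> U" "h' \<in> V"
        "g' \<in> chart_dom c1" "h' \<in> chart_dom c2" by auto
    then have "(g', h') \<in> ?P" using UV(5) by blast
    then show "w \<in> mulc_dom c1 c2 c3"
      unfolding mulc_dom_def w(1) using w(4,5) by (intro imageI) auto
  qed
  ultimately show "\<exists>W. open W \<and> z \<in> W \<and> W \<subseteq> mulc_dom c1 c2 c3"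
    by (intro exI[of _ "?U \<times> ?V"] conjI)
qed

lemma mulc_domI:
  assumes "g \<in> chart_dom c1" "h \<in> chart_dom c2" "g \<otimes> h \<in> chart_dom c3"
  shows "(chart_map c1 g, chart_map c2 h) \<in> mulc_dom c1 c2 c3"
  unfolding mulc_dom_def using assms by (intro image_eqI[where x="(g, h)"]) auto

definition Dmul where
  "Dmul c1 c2 c3 g h = frechet_derivative (mulc c1 c2 c3) (at (chart_map c1 g, chart_map c2 h))"

lemma has_derivative_mulc:
  assumes "c1 \<in> A" "c2 \<in> A" "c3 \<in> A" "g \<in> chart_dom c1" "h \<in> chart_dom c2" "g \<otimes> h \<in> chart_dom c3"
  shows "(mulc c1 c2 c3 has_derivative Dmul c1 c2 c3 g h) (at (chart_map c1 g, chart_map c2 h))"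
  unfolding Dmul_def
  by (rule smooth_on_has_derivative[OF smooth_on_mulc mulc_domI]) (fact assms)+

lemma linear_Dmul:
  assumes "c1 \<in> A" "c2 \<in> A" "c3 \<in> A" "g \<in> chart_dom c1" "h \<in> chart_dom c2" "g \<otimes> h \<in> chart_dom c3"
  shows "linear (Dmul c1 c2 c3 g h)"
  using has_derivative_mulc[OF assms] by (rule has_derivative_linear)

lemma tendsto_Dmul:
  assumes c: "c1 \<in> A" "c2 \<in> A" "c3 \<in> A" and g: "g \<in> chart_dom c1" "h \<in> chart_dom c2" "g \<otimes> h \<in> chart_dom c3"
    and u: "limitin T u g F" and v: "limitin T v h F" and V: "(V \<longlongrightarrow> w) F"
  shows "((\<lambda>i. Dmul c1 c2 c3 (u i) (v i) (V i)) \<longlongrightarrow> Dmul c1 c2 c3 g h w) F"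
  unfolding Dmul_def
proof (rule smooth_on_tendsto_derivative[OF smooth_on_mulc open_mulc_dom mulc_domI _ V])
  show "((\<lambda>i. (chart_map c1 (u i), chart_map c2 (v i))) \<longlongrightarrow> (chart_map c1 g, chart_map c2 h)) F"
    using u v limitin_chart[OF c(1) g(1)] limitin_chart[OF c(2) g(2)] by (intro tendsto_Pair) blast+
qed (fact c g)+

lemma gderiv_mult:
  assumes c: "c1 \<in> A" "c2 \<in> A" "c3 \<in> A" and x: "x \<in> S"
    and u: "gderiv c1 u L x S" and v: "gderiv c2 v M x S" and uv: "u x \<otimes> v x \<in> chart_dom c3"
  shows "gderiv c3 (\<lambda>y. u y \<otimes> v y) (\<lambda>h. Dmul c1 c2 c3 (u x) (v x) (L h, M h)) x S"
  unfolding gderiv_def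
proof (intro conjI uv)
  show "limitin T (\<lambda>y. u y \<otimes> v y) (u x \<otimes> v x) (at x within S)"
    using gderivD(1)[OF u] gderivD(1)[OF v] by (rule limitin_mult)
  have "((\<lambda>y. (chart_map c1 (u y), chart_map c2 (v y))) has_derivative (\<lambda>h. (L h, M h))) (at x within S)"
    by (intro has_derivative_Pair gderivD(3)[OF u] gderivD(3)[OF v])
  from has_derivative_compose[OF this has_derivative_mulc[OF c gderivD(2)[OF u] gderivD(2)[OF v] uv]]
  show "((\<lambda>y. chart_map c3 (u y \<otimes> v y)) has_derivative (\<lambda>h. Dmul c1 c2 c3 (u x) (v x) (L h, M h))) (at x within S)"
  proof (rule has_derivative_transform_eventually)
    show "\<forall>\<^sub>F y in at x within S. mulc c1 c2 c3 (chart_map c1 (u y), chart_map c2 (v y)) = chart_map c3 (u y \<otimes> v y)"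
      using gderiv_eventually[OF u c(1)] gderiv_eventually[OF v c(2)]
      by eventually_elim (rule mulc_apply[OF c(1,2)])
    show "mulc c1 c2 c3 (chart_map c1 (u x), chart_map c2 (v x)) = chart_map c3 (u x \<otimes> v x)"
      by (rule mulc_apply[OF c(1,2) gderivD(2)[OF u] gderivD(2)[OF v]])
  qed (fact x)
qed

definition Dinv where
  "Dinv c d g = frechet_derivative (chart_expr c d (\<lambda>g. inv g)) (at (chart_map c g))"

lemma invc_smooth:
  assumes c: "c \<in> A" "d \<in> A" and g: "g \<in> chart_dom c" "inv g \<in> chart_dom d"
  obtains \<Omega> where "open \<Omega>" "chart_map c g \<in> \<Omega>" "smooth_on (chart_expr c d (\<lambda>g. inv g)) \<Omega>"
proof (rule that)
  show "chart_map c g \<in> chart_map c ` {p \<in> chart_dom c \<inter> topspace T. inv p \<in> chart_dom d}"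
    using g chart_dom_topspace[OF c(1)] by blast
qed (rule smooth_map_expr[OF smooth_inv openin_topspace c openin_chart_dom[OF c(2)]])+

lemma has_derivative_invc:
  assumes "c \<in> A" "d \<in> A" "g \<in> chart_dom c" "inv g \<in> chart_dom d"
  shows "(chart_expr c d (\<lambda>g. inv g) has_derivative Dinv c d g) (at (chart_map c g))"
  unfolding Dinv_def by (rule invc_smooth[OF assms]) (rule smooth_on_has_derivative)

lemma gderiv_inv:
  assumes c: "c \<in> A" "d \<in> A" and x: "x \<in> S"
    and u: "gderiv c u L x S" and ux: "inv (u x) \<in> chart_dom d"
  shows "gderiv d (\<lambda>y. inv (u y)) (\<lambda>h. Dinv c d (u x) (L h)) x S"
  unfolding gderiv_def
proof (intro conjI ux)
  show "limitin T (\<lambda>y. inv (u y)) (inv (u x)) (at x within S)"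
    using gderivD(1)[OF u] by (rule limitin_inv)
  show "((\<lambda>y. chart_map d (inv (u y))) has_derivative (\<lambda>h. Dinv c d (u x) (L h))) (at x within S)"
  proof (rule has_derivative_transform_eventually)
    show "((\<lambda>y. chart_expr c d (\<lambda>g. inv g) (chart_map c (u y))) has_derivative (\<lambda>h. Dinv c d (u x) (L h))) (at x within S)"
      by (rule has_derivative_compose[OF gderivD(3)[OF u] has_derivative_invc[OF c gderivD(2)[OF u] ux]])
    show "\<forall>\<^sub>F y in at x within S. chart_expr c d (\<lambda>g. inv g) (chart_map c (u y)) = chart_map d (inv (u y))"
      using gderiv_eventually[OF u c(1)] by eventually_elim (rule chart_expr_chart_map[OF c(1)])
    show "chart_expr c d (\<lambda>g. inv g) (chart_map c (u x)) = chart_map d (inv (u x))"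
      by (rule chart_expr_chart_map[OF c(1) gderivD(2)[OF u]])
  qed (fact x)
qed

abbreviation "e \<equiv> chart_map \<kappa> \<one>"

lemma chart_inv_e [simp]: "chart_inv \<kappa> e = \<one>"
  by (simp add: chart_inv_chart_map)

lemma gderiv_\<kappa>_inv: "gderiv \<kappa> (chart_inv \<kappa>) (\<lambda>h. h) e UNIV"
  by (intro gderiv_chart_inv) auto

lemma gderiv_unique:
  assumes "gderiv c u L x UNIV" "gderiv c u M x UNIV"
  shows "L = M"
  using has_derivative_unique[OF gderivD(3)[OF assms(1)] gderivD(3)[OF assms(2)]] .

text \<open>Multiplying by \<one> on either side is the identity map, so both partial derivatives
  are the identity, and linearity adds them.\<close>

lemma Dmul_one: "Dmul \<kappa> \<kappa> \<kappa> \<one> \<one> (h, k) = h + k"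
proof -
  have lin: "linear (Dmul \<kappa> \<kappa> \<kappa> \<one> \<one>)" by (rule linear_Dmul) simp_all
  have ev: "\<forall>\<^sub>F y in at e. chart_inv \<kappa> y \<in> carrier G"
    using gderiv_eventually[OF gderiv_\<kappa>_inv \<kappa>_in_A] by eventually_elim (rule chart_dom_carrier[OF \<kappa>_in_A])
  have c: "gderiv \<kappa> (\<lambda>_. \<one>) (\<lambda>_. 0) e UNIV" by (rule gderiv_const) auto
  have "gderiv \<kappa> (\<lambda>y. chart_inv \<kappa> y \<otimes> \<one>) (\<lambda>h. Dmul \<kappa> \<kappa> \<kappa> \<one> \<one> (h, 0)) e UNIV"
    using gderiv_mult[OF \<kappa>_in_A \<kappa>_in_A \<kappa>_in_A _ gderiv_\<kappa>_inv c] by simp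
  then have "gderiv \<kappa> (chart_inv \<kappa>) (\<lambda>h. Dmul \<kappa> \<kappa> \<kappa> \<one> \<one> (h, 0)) e UNIV"
    by (rule gderiv_transform) (use ev in \<open>auto elim: eventually_mono\<close>)
  from gderiv_unique[OF this gderiv_\<kappa>_inv] have 1: "Dmul \<kappa> \<kappa> \<kappa> \<one> \<one> (h, 0) = h" by metis
  have "gderiv \<kappa> (\<lambda>y. \<one> \<otimes> chart_inv \<kappa> y) (\<lambda>h. Dmul \<kappa> \<kappa> \<kappa> \<one> \<one> (0, h)) e UNIV"
    using gderiv_mult[OF \<kappa>_in_A \<kappa>_in_A \<kappa>_in_A _ c gderiv_\<kappa>_inv] by simp
  then have "gderiv \<kappa> (chart_inv \<kappa>) (\<lambda>h. Dmul \<kappa> \<kappa> \<kappa> \<one> \<one> (0, h)) e UNIV"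
    by (rule gderiv_transform) (use ev in \<open>auto elim: eventually_mono\<close>)
  from gderiv_unique[OF this gderiv_\<kappa>_inv] have 2: "Dmul \<kappa> \<kappa> \<kappa> \<one> \<one> (0, k) = k" by metis
  show ?thesis using linear_add[OF lin, of "(h, 0)" "(0, k)"] 1 2 by simp
qed

lemma gderiv_mult_one:
  assumes "gderiv \<kappa> u L x S" "gderiv \<kappa> v M x S" "u x = \<one>" "v x = \<one>" "x \<in> S"
  shows "gderiv \<kappa> (\<lambda>y. u y \<otimes> v y) (\<lambda>h. L h + M h) x S"
  using gderiv_mult[OF \<kappa>_in_A \<kappa>_in_A \<kappa>_in_A assms(5,1,2)] assms(3,4) by (simp add: Dmul_one)

text \<open>Obtained by differentiating the constant product of an element and its inverse.\<close>

lemma gderiv_inv_one: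
  assumes "gderiv \<kappa> u L x S" "u x = \<one>" "x \<in> S"
  shows "gderiv \<kappa> (\<lambda>y. inv (u y)) (\<lambda>h. - L h) x S"
proof -
  have ev: "\<forall>\<^sub>F y in at e. chart_inv \<kappa> y \<otimes> inv (chart_inv \<kappa> y) = \<one>"
    using gderiv_eventually[OF gderiv_\<kappa>_inv \<kappa>_in_A] by eventually_elim (intro r_inv chart_dom_carrier[OF \<kappa>_in_A])
  have i: "gderiv \<kappa> (\<lambda>y. inv (chart_inv \<kappa> y)) (\<lambda>h. Dinv \<kappa> \<kappa> (chart_inv \<kappa> e) h) e UNIV"
    by (rule gderiv_inv[OF _ _ _ gderiv_\<kappa>_inv]) auto
  have "gderiv \<kappa> (\<lambda>y. chart_inv \<kappa> y \<otimes> inv (chart_inv \<kappa> y)) (\<lambda>h. h + Dinv \<kappa> \<kappa> \<one> h) e UNIV"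
    using gderiv_mult_one[OF gderiv_\<kappa>_inv i] by simp
  then have "gderiv \<kappa> (\<lambda>_. \<one>) (\<lambda>h. h + Dinv \<kappa> \<kappa> \<one> h) e UNIV"
    by (rule gderiv_transform[OF _ ev]) auto
  moreover have "gderiv \<kappa> (\<lambda>_. \<one>) (\<lambda>_. 0) e UNIV" by (rule gderiv_const) auto
  ultimately have "(\<lambda>h. h + Dinv \<kappa> \<kappa> \<one> h) = (\<lambda>_. 0)" by (rule gderiv_unique)
  then have "Dinv \<kappa> \<kappa> \<one> h = - h" for h by (metis minus_unique)
  then show ?thesis using gderiv_inv[OF \<kappa>_in_A \<kappa>_in_A assms(3,1)] assms(2) by simp
qed

end

section \<open>The adjoint representation\<close>

text \<open>V vanishes at x and is differentiable there, so it is O(y - x); a function that is small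
  relative to V is then o(y - x).\<close>

lemma has_derivative_zero_of_bound:
  assumes V: "(V has_derivative V') (at x)" "V x = 0" "r x = 0"
    and r: "\<And>\<eta>. 0 < \<eta> \<Longrightarrow> \<forall>\<^sub>F y in at x. norm (r y) \<le> \<eta> * norm (V y)"
  shows "(r has_derivative (\<lambda>_. 0)) (at x)"
  unfolding has_derivative_at_alt
proof (intro conjI allI impI)
  show "bounded_linear (\<lambda>_. 0)" by (rule bounded_linear_zero)
  fix \<epsilon> :: real assume \<epsilon>: "0 < \<epsilon>"
  interpret V': bounded_linear V' using V(1) by (rule has_derivative_bounded_linear)
  obtain K where K: "0 < K" "\<And>h. norm (V' h) \<le> norm h * K" using V'.pos_bounded by blast
  obtain d1 where d1: "0 < d1" "\<And>y. norm (y - x) < d1 \<Longrightarrow> norm (V y - V' (y - x)) \<le> 1 * norm (y - x)"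
    using V unfolding has_derivative_at_alt by (metis diff_zero zero_less_one)
  have "\<forall>\<^sub>F y in at x. norm (r y) \<le> \<epsilon> / (K + 1) * norm (V y)"
    by (rule r) (use K \<epsilon> in simp)
  then obtain d2 where d2: "0 < d2"
    "\<And>y. y \<noteq> x \<Longrightarrow> dist y x < d2 \<Longrightarrow> norm (r y) \<le> \<epsilon> / (K + 1) * norm (V y)"
    unfolding eventually_at by auto
  have "norm (r y) \<le> \<epsilon> * norm (y - x)" if y: "norm (y - x) < min d1 d2" for y
  proof (cases "y = x")
    case False
    have "norm (V y) \<le> norm (V y - V' (y - x)) + norm (V' (y - x))"
      by (metis diff_add_cancel norm_triangle_ineq)
    also have "\<dots> \<le> 1 * norm (y - x) + norm (y - x) * K"
      using y by (intro add_mono d1 K) simp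
    finally have Vy: "norm (V y) \<le> (K + 1) * norm (y - x)" by (simp add: algebra_simps)
    have "norm (r y) \<le> \<epsilon> / (K + 1) * norm (V y)"
      using d2(2)[OF False] y by (simp add: dist_norm)
    also have "\<dots> \<le> \<epsilon> / (K + 1) * ((K + 1) * norm (y - x))"
      using Vy \<epsilon> K by (intro mult_left_mono) auto
    also have "\<dots> = \<epsilon> * norm (y - x)" using K by simp
    finally show ?thesis .
  qed (use V(3) in simp)
  then show "\<exists>d>0. \<forall>y. norm (y - x) < d \<longrightarrow> norm (r y - r x - 0) \<le> \<epsilon> * norm (y - x)"
    using d1 d2 V(3) by (intro exI[of _ "min d1 d2"]) auto
qed

context based_lie_group
begin

lemma eventually_chart_inv: "\<forall>\<^sub>F y in at e. chart_inv \<kappa> y \<in> chart_dom \<kappa>"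
  by (rule gderiv_eventually[OF gderiv_\<kappa>_inv \<kappa>_in_A])

lemma gderiv_Ad_chart:
  assumes g: "g \<in> carrier G"
  shows "gderiv \<kappa> (\<lambda>y. g \<otimes> chart_inv \<kappa> y \<otimes> inv g) (Ad G \<kappa> g) e UNIV"
proof -
  obtain c where c: "c \<in> A" "g \<in> chart_dom c" using chart_at_carrier[OF g] by blast
  obtain d where d: "d \<in> A" "inv g \<in> chart_dom d" using chart_at_carrier[of "inv g"] g by blast
  have "gderiv c (\<lambda>y. g \<otimes> chart_inv \<kappa> y) (\<lambda>h. Dmul c \<kappa> c g (chart_inv \<kappa> e) (0, h)) e UNIV"
    using c g by (intro gderiv_mult[OF c(1) \<kappa>_in_A c(1) UNIV_I gderiv_const[OF c(2,1)] gderiv_\<kappa>_inv]) simp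
  from gderiv_mult[OF c(1) d(1) \<kappa>_in_A UNIV_I this gderiv_const[OF d(2,1)]]
  obtain M where M: "gderiv \<kappa> (\<lambda>y. g \<otimes> chart_inv \<kappa> y \<otimes> inv g) M e UNIV"
    using g by simp
  have "M = Ad G \<kappa> g"
    using frechet_derivative_at[OF gderivD(3)[OF M]] unfolding Ad_def by auto
  with M show ?thesis by simp
qed

lemma linear_Ad: "g \<in> carrier G \<Longrightarrow> linear (Ad G \<kappa> g)"
  using gderivD(4)[OF gderiv_Ad_chart] .

lemma gderiv_Ad:
  assumes g: "g \<in> carrier G" and u: "gderiv \<kappa> u L x S" "u x = \<one>" "x \<in> S"
  shows "gderiv \<kappa> (\<lambda>y. g \<otimes> u y \<otimes> inv g) (\<lambda>h. Ad G \<kappa> g (L h)) x S"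
proof -
  have "gderiv \<kappa> (\<lambda>y. g \<otimes> chart_inv \<kappa> (chart_map \<kappa> (u y)) \<otimes> inv g) (\<lambda>h. Ad G \<kappa> g (L h)) x S"
    by (rule gderiv_compose[OF gderivD(3)[OF u(1)], where R=UNIV]) (use gderiv_Ad_chart[OF g] u(2) in auto)
  moreover have "\<forall>\<^sub>F y in at x within S. g \<otimes> chart_inv \<kappa> (chart_map \<kappa> (u y)) \<otimes> inv g = g \<otimes> u y \<otimes> inv g"
    using gderiv_eventually[OF u(1) \<kappa>_in_A] by eventually_elim (simp add: chart_inv_chart_map)
  ultimately show ?thesis
    by (rule gderiv_transform) (use u in auto)
qed

lemma Ad_one: "Ad G \<kappa> \<one> v = v"
proof -
  have ev: "\<forall>\<^sub>F y in at e. \<one> \<otimes> chart_inv \<kappa> y \<otimes> inv \<one> = chart_inv \<kappa> y"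
    using eventually_chart_inv by eventually_elim (simp add: chart_dom_carrier[OF \<kappa>_in_A])
  have "gderiv \<kappa> (chart_inv \<kappa>) (Ad G \<kappa> \<one>) e UNIV"
    by (rule gderiv_transform[OF gderiv_Ad_chart[OF one_closed] ev]) simp_all
  from gderiv_unique[OF this gderiv_\<kappa>_inv] show ?thesis by simp
qed

lemma Ad_mult:
  assumes g: "g \<in> carrier G" and h: "h \<in> carrier G"
  shows "Ad G \<kappa> (g \<otimes> h) v = Ad G \<kappa> g (Ad G \<kappa> h v)"
proof -
  have "gderiv \<kappa> (\<lambda>y. g \<otimes> (h \<otimes> chart_inv \<kappa> y \<otimes> inv h) \<otimes> inv g) (\<lambda>v. Ad G \<kappa> g (Ad G \<kappa> h v)) e UNIV"
    using h by (intro gderiv_Ad[OF g gderiv_Ad_chart[OF h]]) auto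
  moreover have "\<forall>\<^sub>F y in at e. g \<otimes> (h \<otimes> chart_inv \<kappa> y \<otimes> inv h) \<otimes> inv g
      = (g \<otimes> h) \<otimes> chart_inv \<kappa> y \<otimes> inv (g \<otimes> h)"
    using eventually_chart_inv
    by eventually_elim (use g h in \<open>simp add: chart_dom_carrier[OF \<kappa>_in_A] m_assoc inv_mult_group\<close>)
  ultimately have "gderiv \<kappa> (\<lambda>y. (g \<otimes> h) \<otimes> chart_inv \<kappa> y \<otimes> inv (g \<otimes> h)) (\<lambda>v. Ad G \<kappa> g (Ad G \<kappa> h v)) e UNIV"
    by (rule gderiv_transform) (use g h in auto)
  from fun_cong[OF gderiv_unique[OF this gderiv_Ad_chart[OF m_closed[OF g h]]], of v] show ?thesis by simp
qed

lemma Ad_inv: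
  assumes "g \<in> carrier G"
  shows "Ad G \<kappa> (inv g) (Ad G \<kappa> g v) = v" "Ad G \<kappa> g (Ad G \<kappa> (inv g) v) = v"
  using Ad_mult[of "inv g" g v] Ad_mult[of g "inv g" v] assms by (simp_all add: Ad_one)

lemma Dmul_Ad:
  assumes g: "g \<in> chart_dom \<kappa>"
  shows "Dmul \<kappa> \<kappa> \<kappa> g \<one> (0, z) = Dmul \<kappa> \<kappa> \<kappa> \<one> g (Ad G \<kappa> g z, 0)"
proof -
  have gc: "g \<in> carrier G" using chart_dom_carrier[OF \<kappa>_in_A g] .
  note c = gderiv_const[OF g \<kappa>_in_A]
  have 1: "gderiv \<kappa> (\<lambda>y. g \<otimes> chart_inv \<kappa> y) (\<lambda>h. Dmul \<kappa> \<kappa> \<kappa> g \<one> (0, h)) e UNIV"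
    using gderiv_mult[OF \<kappa>_in_A \<kappa>_in_A \<kappa>_in_A UNIV_I c gderiv_\<kappa>_inv] g gc by simp
  have "gderiv \<kappa> (\<lambda>y. (g \<otimes> chart_inv \<kappa> y \<otimes> inv g) \<otimes> g) (\<lambda>h. Dmul \<kappa> \<kappa> \<kappa> \<one> g (Ad G \<kappa> g h, 0)) e UNIV"
    using gderiv_mult[OF \<kappa>_in_A \<kappa>_in_A \<kappa>_in_A UNIV_I gderiv_Ad_chart[OF gc] c] g gc by simp
  moreover have "\<forall>\<^sub>F y in at e. (g \<otimes> chart_inv \<kappa> y \<otimes> inv g) \<otimes> g = g \<otimes> chart_inv \<kappa> y"
    using eventually_chart_inv
    by eventually_elim (use gc in \<open>simp add: chart_dom_carrier[OF \<kappa>_in_A] m_assoc\<close>)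
  ultimately have "gderiv \<kappa> (\<lambda>y. g \<otimes> chart_inv \<kappa> y) (\<lambda>h. Dmul \<kappa> \<kappa> \<kappa> \<one> g (Ad G \<kappa> g h, 0)) e UNIV"
    by (rule gderiv_transform) (use gc in auto)
  from fun_cong[OF gderiv_unique[OF 1 this], of z] show ?thesis by simp
qed

text \<open>The derivative of \<open>Ad\<close> at \<open>\<one>\<close>, read off from the second derivative of the multiplication in \<open>\<kappa>\<close>.\<close>
definition ad :: "'e \<Rightarrow> 'e \<Rightarrow> 'e" where
  "ad w z = (let D2 = (\<lambda>v. frechet_derivative (\<lambda>p. frechet_derivative (mulc \<kappa> \<kappa> \<kappa>) (at p) v) (at (e, e)))
     in D2 (0, z) (w, 0) - D2 (z, 0) (0, w))"

lemma e_e_in_mulc_dom: "(e, e) \<in> mulc_dom \<kappa> \<kappa> \<kappa>"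
  by (rule mulc_domI) simp_all

text \<open>Both terms of \<open>ad\<close> are mixed second derivatives of the multiplication.
  Exchanging the order of differentiation in each turns \<open>ad w z\<close> into
  \<open>ad z w\<close> with the terms swapped.\<close>

lemma ad_antisym: "ad w z = - ad z w"
  using smooth_on_second_derivative(2)[OF smooth_on_mulc open_mulc_dom e_e_in_mulc_dom, of "(0, z)" "(w, 0)"]
    smooth_on_second_derivative(2)[OF smooth_on_mulc open_mulc_dom e_e_in_mulc_dom, of "(z, 0)" "(0, w)"]
  unfolding ad_def Let_def by simp

text \<open>
  Differentiating \<open>g h = (g h g\<^sup>-\<^sup>1) g\<close> in \<open>h\<close> determines \<open>Ad g\<close> up to a factor that tends to the
  identity, which suffices to differentiate \<open>Ad\<close> at \<open>\<one>\<close>.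
\<close>
lemma has_derivative_Ad_chart:
  "((\<lambda>y. Ad G \<kappa> (chart_inv \<kappa> y) z) has_derivative (\<lambda>w. ad w z)) (at e)"
proof -
  define D where "D p = frechet_derivative (mulc \<kappa> \<kappa> \<kappa>) (at p)" for p
  have D2: "((\<lambda>p. D p v) has_derivative frechet_derivative (\<lambda>p. D p v) (at (e, e))) (at (e, e))" for v
    unfolding D_def
    by (rule smooth_on_second_derivative(1)[OF smooth_on_mulc open_mulc_dom e_e_in_mulc_dom]) simp_all
  have D_one: "D (e, e) (h, k) = h + k" for h k
    using Dmul_one unfolding Dmul_def D_def by simp
  define a where "a y = Ad G \<kappa> (chart_inv \<kappa> y) z" for y
  \<comment> \<open>A computable substitute for \<open>a y - z\<close>: V y is the image of
    \<open>a y - z\<close> under the derivative of right translation by the point with coordinates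
    y, and that derivative is close to the identity near e.\<close>
  define V where "V y = D (y, e) (0, z) - D (e, y) (z, 0)" for y
  have D_fst: "((\<lambda>y. D (y, e) v) has_derivative (\<lambda>w. frechet_derivative (\<lambda>p. D p v) (at (e, e)) (w, 0))) (at e)" for v
    by (rule has_derivative_compose[where f="\<lambda>y. (y, e)" and g="\<lambda>p. D p v"]) (auto intro!: derivative_eq_intros D2)
  have D_snd: "((\<lambda>y. D (e, y) v) has_derivative (\<lambda>w. frechet_derivative (\<lambda>p. D p v) (at (e, e)) (0, w))) (at e)" for v
    by (rule has_derivative_compose[where f="\<lambda>y. (e, y)" and g="\<lambda>p. D p v"]) (auto intro!: derivative_eq_intros D2)
  have V': "(V has_derivative (\<lambda>w. ad w z)) (at e)"
    unfolding V_def ad_def Let_def D_def[symmetric]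
    by (rule has_derivative_diff[OF D_fst D_snd])
  have V0: "V e = 0" by (simp add: V_def D_one)
  have cont: "((\<lambda>y. D (e, y) v) \<longlongrightarrow> D (e, e) v) (at e)" for v
    using has_derivative_continuous[OF D_snd] by (simp add: continuous_within)
  have lin: "linear (\<lambda>w. D (e, y) (w, 0))" if y: "chart_inv \<kappa> y \<in> chart_dom \<kappa>" "chart_map \<kappa> (chart_inv \<kappa> y) = y" for y
  proof -
    have *: "linear (D (e, y))"
      using linear_Dmul[OF \<kappa>_in_A \<kappa>_in_A \<kappa>_in_A one_in_\<kappa> y(1)] y chart_dom_carrier[OF \<kappa>_in_A y(1)]
      unfolding Dmul_def D_def by simp
    show ?thesis
      using linear_add[OF *, of "(_, 0)" "(_, 0)"] linear_scale[OF *, of _ "(_, 0)"] by (intro linearI) simp_all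
  qed
  have dom: "\<forall>\<^sub>F y in at e. chart_inv \<kappa> y \<in> chart_dom \<kappa> \<and> chart_map \<kappa> (chart_inv \<kappa> y) = y"
    using topological_tendstoD[OF tendsto_ident_at open_chart_image[OF \<kappa>_in_A] imageI[OF one_in_\<kappa>]]
    by eventually_elim (use chart_inv_chart_map[OF \<kappa>_in_A] in auto)
  have ev: "\<forall>\<^sub>F y in at e. norm (a y - z - V y) \<le> \<eta> * norm (V y)" if \<eta>: "0 < \<eta>" for \<eta>
  proof -
    \<comment> \<open>The bound 1/2 absorbs \<open>norm (a y - z)\<close> into twice
      \<open>norm (V y)\<close>; the bound \<eta> / 2 compensates this factor two.\<close>
    define \<mu> where "\<mu> = min (1/2) (\<eta> / 2)"
    have \<mu>: "0 < \<mu>" "\<mu> \<le> 1/2" "\<mu> \<le> \<eta> / 2" using \<eta> by (auto simp: \<mu>_def)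
    have "\<forall>\<^sub>F y in at e. \<forall>w. norm (D (e, y) (w, 0) - w) \<le> \<mu> * norm w"
    proof (rule linear_families_near_id[OF _ _ \<mu>(1)])
      show "\<forall>\<^sub>F y in at e. linear (\<lambda>w. D (e, y) (w, 0))"
        using dom by eventually_elim (use lin in blast)
      show "((\<lambda>y. D (e, y) (b, 0)) \<longlongrightarrow> b) (at e)" for b
        using cont[of "(b, 0)"] by (simp add: D_one)
    qed
    with dom show ?thesis
    proof eventually_elim
      case (elim y)
      have y: "chart_inv \<kappa> y \<in> chart_dom \<kappa>" "chart_map \<kappa> (chart_inv \<kappa> y) = y" using elim(1) by auto
      have eq: "D (y, e) (0, z) = D (e, y) (a y, 0)"
        using Dmul_Ad[OF y(1)] unfolding Dmul_def D_def a_def y(2) by simp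
      have "a y - z - V y = - (D (e, y) (a y - z, 0) - (a y - z))"
        using linear_diff[OF lin[OF y], of "a y" z] unfolding V_def eq by simp
      then have "norm (a y - z - V y) = norm (D (e, y) (a y - z, 0) - (a y - z))"
        by (simp only: norm_minus_cancel)
      then have 1: "norm (a y - z - V y) \<le> \<mu> * norm (a y - z)" using elim(2) by simp
      have "norm (a y - z) \<le> norm (a y - z - V y) + norm (V y)"
        by (metis diff_add_cancel norm_triangle_ineq)
      moreover have "\<mu> * norm (a y - z) \<le> 1/2 * norm (a y - z)"
        using \<mu> by (intro mult_right_mono) auto
      ultimately have "norm (a y - z) \<le> 2 * norm (V y)" using 1 by linarith
      then have "\<mu> * norm (a y - z) \<le> \<eta> / 2 * (2 * norm (V y))" using \<mu> by (intro mult_mono) auto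
      with 1 show ?case by simp
    qed
  qed
  have "((\<lambda>y. a y - z - V y) has_derivative (\<lambda>_. 0)) (at e)"
    by (rule has_derivative_zero_of_bound[OF V' V0 _ ev]) (use V0 in \<open>simp_all add: a_def Ad_one\<close>)
  from has_derivative_add[OF has_derivative_add[OF this V'] has_derivative_const[of z]]
  show ?thesis unfolding a_def by simp
qed

lemma has_derivative_Ad:
  assumes u: "gderiv \<kappa> u L x S" "u x = \<one>" "x \<in> S"
  shows "((\<lambda>y. Ad G \<kappa> (u y) z) has_derivative (\<lambda>h. ad (L h) z)) (at x within S)"
proof (rule has_derivative_transform_eventually)
  have "((\<lambda>y. Ad G \<kappa> (chart_inv \<kappa> y) z) has_derivative (\<lambda>w. ad w z)) (at (chart_map \<kappa> (u x)))"
    using has_derivative_Ad_chart u(2) by simp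
  from has_derivative_compose[OF gderivD(3)[OF u(1)] this]
  show "((\<lambda>y. Ad G \<kappa> (chart_inv \<kappa> (chart_map \<kappa> (u y))) z) has_derivative (\<lambda>h. ad (L h) z)) (at x within S)" .
  show "\<forall>\<^sub>F y in at x within S. Ad G \<kappa> (chart_inv \<kappa> (chart_map \<kappa> (u y))) z = Ad G \<kappa> (u y) z"
    using gderiv_eventually[OF u(1) \<kappa>_in_A] by eventually_elim (simp add: chart_inv_chart_map)
qed (use u in \<open>simp_all add: chart_inv_chart_map\<close>)

text \<open>Continuity at \<one> is transported to g by writing \<open>Ad (u i)\<close> as
  \<open>Ad (u i g\<^sup>-\<^sup>1)\<close> after \<open>Ad g\<close>.\<close>

lemma tendsto_Ad:
  assumes u: "limitin T u g F" and Z: "(Z \<longlongrightarrow> z) F"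
  shows "((\<lambda>i. Ad G \<kappa> (u i) (Z i)) \<longlongrightarrow> Ad G \<kappa> g z) F"
proof (rule tendsto_linear_families[OF _ _ _ Z])
  have g: "g \<in> carrier G" by (rule limitin_carrier[OF u])
  then show "linear (Ad G \<kappa> g)" by (rule linear_Ad)
  have uc: "\<forall>\<^sub>F i in F. u i \<in> carrier G" by (rule limitin_eventually_carrier[OF u])
  then show "\<forall>\<^sub>F i in F. linear (Ad G \<kappa> (u i))" by eventually_elim (rule linear_Ad)
  fix b :: 'e
  have "limitin T (\<lambda>i. u i \<otimes> inv g) (g \<otimes> inv g) F"
    using g topspace_eq_carrier by (intro limitin_mult u) simp
  then have lim: "limitin T (\<lambda>i. u i \<otimes> inv g) \<one> F" using g by simp
  then have "((\<lambda>i. chart_map \<kappa> (u i \<otimes> inv g)) \<longlongrightarrow> e) F"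
    by (simp add: limitin_chart[OF \<kappa>_in_A one_in_\<kappa>])
  moreover have "isCont (\<lambda>y. Ad G \<kappa> (chart_inv \<kappa> y) (Ad G \<kappa> g b)) e"
    using has_derivative_continuous[OF has_derivative_Ad_chart] .
  ultimately have "((\<lambda>i. Ad G \<kappa> (chart_inv \<kappa> (chart_map \<kappa> (u i \<otimes> inv g))) (Ad G \<kappa> g b))
      \<longlongrightarrow> Ad G \<kappa> (chart_inv \<kappa> e) (Ad G \<kappa> g b)) F"
    by (rule isCont_tendsto_compose[rotated])
  then have "((\<lambda>i. Ad G \<kappa> (chart_inv \<kappa> (chart_map \<kappa> (u i \<otimes> inv g))) (Ad G \<kappa> g b)) \<longlongrightarrow> Ad G \<kappa> g b) F"
    by (simp add: Ad_one)
  moreover have "\<forall>\<^sub>F i in F. Ad G \<kappa> (chart_inv \<kappa> (chart_map \<kappa> (u i \<otimes> inv g))) (Ad G \<kappa> g b) = Ad G \<kappa> (u i) b"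
    using uc limitinD[OF lim openin_chart_dom[OF \<kappa>_in_A] one_in_\<kappa>]
  proof eventually_elim
    case (elim i)
    then show ?case using g Ad_mult[of "u i \<otimes> inv g" g b] by (simp add: chart_inv_chart_map m_assoc)
  qed
  ultimately show "((\<lambda>i. Ad G \<kappa> (u i) b) \<longlongrightarrow> Ad G \<kappa> g b) F"
    by (rule Lim_transform_eventually)
qed

end

section \<open>Logarithmic derivatives and paths\<close>

context based_lie_group
begin

text \<open>The logarithmic derivative \<open>u\<^sup>-\<^sup>1 du\<close> at \<open>x\<close> is \<open>L\<close>.\<close>
definition lderiv :: "('x::real_normed_vector \<Rightarrow> 'g) \<Rightarrow> ('x \<Rightarrow> 'e) \<Rightarrow> 'x \<Rightarrow> 'x set \<Rightarrow> bool" where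
  "lderiv u L x S \<longleftrightarrow> limitin T u (u x) (at x within S) \<and> gderiv \<kappa> (\<lambda>y. inv (u x) \<otimes> u y) L x S"

lemma lderivD:
  assumes "lderiv u L x S"
  shows "limitin T u (u x) (at x within S)" "gderiv \<kappa> (\<lambda>y. inv (u x) \<otimes> u y) L x S" "u x \<in> carrier G"
    "linear L" "\<forall>\<^sub>F y in at x within S. u y \<in> carrier G"
  using assms limitin_carrier gderivD(4) limitin_eventually_carrier unfolding lderiv_def by blast+

lemma lderiv_transform:
  assumes u: "lderiv u L x S" and uv: "\<forall>\<^sub>F y in at x within S. u y = v y" "u x = v x" "x \<in> S"
  shows "lderiv v L x S"
  unfolding lderiv_def
proof
  show "limitin T v (v x) (at x within S)"
    using limitin_transform_eventually[OF uv(1) lderivD(1)[OF u]] uv(2) by simp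
  show "gderiv \<kappa> (\<lambda>y. inv (v x) \<otimes> v y) L x S"
  proof (rule gderiv_transform[OF lderivD(2)[OF u]])
    show "\<forall>\<^sub>F y in at x within S. inv (u x) \<otimes> u y = inv (v x) \<otimes> v y"
      using uv(1) by eventually_elim (simp add: uv(2))
  qed (simp_all add: uv)
qed

lemma lderiv_subset: "lderiv u L x S \<Longrightarrow> S' \<subseteq> S \<Longrightarrow> lderiv u L x S'"
  unfolding lderiv_def limitin_def
  by (meson at_le filter_leD gderiv_subset)

lemma lderiv_left_mult:
  assumes u: "lderiv u L x S" and g: "g \<in> carrier G" and x: "x \<in> S"
  shows "lderiv (\<lambda>y. g \<otimes> u y) L x S"
  unfolding lderiv_def
proof
  show "limitin T (\<lambda>y. g \<otimes> u y) (g \<otimes> u x) (at x within S)"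
    using g topspace_eq_carrier by (intro limitin_mult lderivD(1)[OF u]) simp
  show "gderiv \<kappa> (\<lambda>y. inv (g \<otimes> u x) \<otimes> (g \<otimes> u y)) L x S"
  proof (rule gderiv_transform[OF lderivD(2)[OF u]])
    have *: "inv (u x) \<otimes> h = inv (g \<otimes> u x) \<otimes> (g \<otimes> h)" if "h \<in> carrier G" for h
    proof -
      have "inv g \<otimes> (g \<otimes> h) = h" using g that by (simp flip: m_assoc)
      then show ?thesis using that g lderivD(3)[OF u] by (simp add: inv_mult_group m_assoc)
    qed
    show "\<forall>\<^sub>F y in at x within S. inv (u x) \<otimes> u y = inv (g \<otimes> u x) \<otimes> (g \<otimes> u y)"
      using lderivD(5)[OF u] by eventually_elim (rule *)
    show "inv (u x) \<otimes> u x = inv (g \<otimes> u x) \<otimes> (g \<otimes> u x)" by (rule *[OF lderivD(3)[OF u]])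
  qed fact
qed

text \<open>The product rule: the translated product regroups as a conjugate of the translated u
  times the translated v. Both pass through \<one> at x, where derivatives of factors simply
  add.\<close>

lemma lderiv_mult:
  assumes u: "lderiv u L x S" and v: "lderiv v M x S" and x: "x \<in> S"
  shows "lderiv (\<lambda>y. u y \<otimes> v y) (\<lambda>h. Ad G \<kappa> (inv (v x)) (L h) + M h) x S"
  unfolding lderiv_def
proof
  note c = lderivD(3)[OF u] lderivD(3)[OF v]
  show "limitin T (\<lambda>y. u y \<otimes> v y) (u x \<otimes> v x) (at x within S)"
    by (intro limitin_mult lderivD(1)[OF u] lderivD(1)[OF v])
  have 1: "gderiv \<kappa> (\<lambda>y. inv (v x) \<otimes> (inv (u x) \<otimes> u y) \<otimes> inv (inv (v x))) (\<lambda>h. Ad G \<kappa> (inv (v x)) (L h)) x S"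
    using c by (intro gderiv_Ad lderivD(2)[OF u] x) simp_all
  have "gderiv \<kappa> (\<lambda>y. (inv (v x) \<otimes> (inv (u x) \<otimes> u y) \<otimes> inv (inv (v x))) \<otimes> (inv (v x) \<otimes> v y))
     (\<lambda>h. Ad G \<kappa> (inv (v x)) (L h) + M h) x S"
    using c by (intro gderiv_mult_one 1 lderivD(2)[OF v] x) simp_all
  then show "gderiv \<kappa> (\<lambda>y. inv (u x \<otimes> v x) \<otimes> (u y \<otimes> v y)) (\<lambda>h. Ad G \<kappa> (inv (v x)) (L h) + M h) x S"
  proof (rule gderiv_transform)
    have *: "(inv (v x) \<otimes> (inv (u x) \<otimes> g) \<otimes> inv (inv (v x))) \<otimes> (inv (v x) \<otimes> h) = inv (u x \<otimes> v x) \<otimes> (g \<otimes> h)"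
      if "g \<in> carrier G" "h \<in> carrier G" for g h
    proof -
      have "v x \<otimes> (inv (v x) \<otimes> h) = h" using c that by (simp flip: m_assoc)
      then show ?thesis using c that by (simp add: m_assoc inv_mult_group)
    qed
    show "\<forall>\<^sub>F y in at x within S. (inv (v x) \<otimes> (inv (u x) \<otimes> u y) \<otimes> inv (inv (v x))) \<otimes> (inv (v x) \<otimes> v y)
        = inv (u x \<otimes> v x) \<otimes> (u y \<otimes> v y)"
      using lderivD(5)[OF u] lderivD(5)[OF v] by eventually_elim (rule *)
    show "(inv (v x) \<otimes> (inv (u x) \<otimes> u x) \<otimes> inv (inv (v x))) \<otimes> (inv (v x) \<otimes> v x)
        = inv (u x \<otimes> v x) \<otimes> (u x \<otimes> v x)" by (rule *[OF c])
  qed fact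
qed

lemma lderiv_compose:
  assumes f: "(f has_derivative f') (at x within S)" and u: "lderiv u L (f x) R"
    and fS: "f ` S \<subseteq> R"
  shows "lderiv (\<lambda>y. u (f y)) (\<lambda>h. L (f' h)) x S"
proof -
  obtain c where c: "c \<in> A" "u (f x) \<in> chart_dom c" using chart_at_carrier[OF lderivD(3)[OF u]] by blast
  note g = gderiv_compose[OF f lderivD(2)[OF u] fS]
  have "limitin T (\<lambda>y. u (f x) \<otimes> (inv (u (f x)) \<otimes> u (f y))) (u (f x) \<otimes> (inv (u (f x)) \<otimes> u (f x))) (at x within S)"
    using lderivD(3)[OF u] topspace_eq_carrier by (intro limitin_mult gderivD(1)[OF g]) simp
  then have lim: "limitin T (\<lambda>y. u (f x) \<otimes> (inv (u (f x)) \<otimes> u (f y))) (u (f x)) (at x within S)"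
    using lderivD(3)[OF u] by simp
  have "\<forall>\<^sub>F y in at x within S. u (f y) \<in> carrier G"
  proof -
    have "\<forall>\<^sub>F y in nhds (f x). y \<in> R \<longrightarrow> u y \<in> carrier G"
      using lderivD(3,5)[OF u] unfolding eventually_at_filter by (auto elim: eventually_mono)
    moreover have "(f \<longlongrightarrow> f x) (at x within S)"
      using has_derivative_continuous[OF f] by (simp add: continuous_within)
    ultimately have "\<forall>\<^sub>F y in at x within S. f y \<in> R \<longrightarrow> u (f y) \<in> carrier G"
      by (auto simp: filterlim_iff)
    moreover have "\<forall>\<^sub>F y in at x within S. y \<in> S" by (simp add: eventually_at_filter)
    ultimately show ?thesis by eventually_elim (use fS in blast)
  qed
  then have "\<forall>\<^sub>F y in at x within S. u (f x) \<otimes> (inv (u (f x)) \<otimes> u (f y)) = u (f y)"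
    by eventually_elim (use lderivD(3)[OF u] in \<open>simp flip: m_assoc\<close>)
  from limitin_transform_eventually[OF this lim]
  have "limitin T (\<lambda>y. u (f y)) (u (f x)) (at x within S)" .
  with g show ?thesis unfolding lderiv_def by simp
qed

lemma lderiv_imp_gderiv:
  assumes c: "c \<in> A" and u: "lderiv u L x S" and ux: "u x \<in> chart_dom c" and x: "x \<in> S"
  shows "gderiv c u (\<lambda>h. Dmul c \<kappa> c (u x) \<one> (0, L h)) x S"
proof -
  note uc = lderivD(3)[OF u]
  have "gderiv c (\<lambda>y. u x \<otimes> (inv (u x) \<otimes> u y)) (\<lambda>h. Dmul c \<kappa> c (u x) \<one> (0, L h)) x S"
    using gderiv_mult[OF c \<kappa>_in_A c x gderiv_const[OF ux c] lderivD(2)[OF u]] uc ux by simp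
  then show ?thesis
  proof (rule gderiv_transform)
    show "\<forall>\<^sub>F y in at x within S. u x \<otimes> (inv (u x) \<otimes> u y) = u y"
      using lderivD(5)[OF u] by eventually_elim (use uc in \<open>simp flip: m_assoc\<close>)
  qed (use uc x in auto)
qed

lemma gderiv_imp_lderiv:
  assumes c: "c \<in> A" "d \<in> A" and u: "gderiv c u L x S" and ux: "inv (u x) \<in> chart_dom d" and x: "x \<in> S"
  shows "lderiv u (\<lambda>h. Dmul d c \<kappa> (inv (u x)) (u x) (0, L h)) x S"
  unfolding lderiv_def
proof
  show "limitin T u (u x) (at x within S)" by (rule gderivD(1)[OF u])
  show "gderiv \<kappa> (\<lambda>y. inv (u x) \<otimes> u y) (\<lambda>h. Dmul d c \<kappa> (inv (u x)) (u x) (0, L h)) x S"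
    using gderiv_mult[OF c(2,1) \<kappa>_in_A x gderiv_const[OF ux c(2)] u] gderiv_carrier[OF u] by simp
qed

lemma Dmul_scale:
  assumes "c1 \<in> A" "c2 \<in> A" "c3 \<in> A" "g \<in> chart_dom c1" "h \<in> chart_dom c2" "g \<otimes> h \<in> chart_dom c3"
  shows "Dmul c1 c2 c3 g h (0, r *\<^sub>R v) = r *\<^sub>R Dmul c1 c2 c3 g h (0, v)"
  using linear_scale[OF linear_Dmul[OF assms], of r "(0, v)"] by simp

section \<open>Velocities of paths\<close>

abbreviation has_velocity :: "(real \<Rightarrow> 'g) \<Rightarrow> 'e \<Rightarrow> real \<Rightarrow> real set \<Rightarrow> bool" where
  "has_velocity \<gamma> w t S \<equiv> lderiv \<gamma> (\<lambda>h. h *\<^sub>R w) t S"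

lemma has_velocity_vector_derivative:
  "has_velocity \<gamma> w t S \<Longrightarrow> ((\<lambda>s. chart_map \<kappa> (inv (\<gamma> t) \<otimes> \<gamma> s)) has_vector_derivative w) (at t within S)"
  unfolding has_vector_derivative_def by (rule gderivD(3)[OF lderivD(2)])

lemma has_velocity_left_velocity:
  assumes "has_velocity \<gamma> w t {c..d}" "c < t" "t < d"
  shows "left_velocity G \<kappa> \<gamma> t = w"
proof -
  have "at t within {c..d} = at t" using assms(2,3) by (intro at_within_Icc_at)
  then show ?thesis
    using has_velocity_vector_derivative[OF assms(1)] unfolding left_velocity_def
    by (simp add: vector_derivative_at)
qed

lemma continuous_map_Icc_iff_limitin:
  "continuous_map (top_of_set {c..d}) T \<gamma> \<longleftrightarrow> (\<forall>t\<in>{c..d}. limitin T \<gamma> (\<gamma> t) (at t within {c..d::real}))"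
proof
  assume cont: "continuous_map (top_of_set {c..d}) T \<gamma>"
  show "\<forall>t\<in>{c..d}. limitin T \<gamma> (\<gamma> t) (at t within {c..d})"
  proof
    fix t assume t: "t \<in> {c..d}"
    show "limitin T \<gamma> (\<gamma> t) (at t within {c..d})"
      unfolding limitin_def
    proof (intro conjI allI impI)
      show "\<gamma> t \<in> topspace T" using cont t unfolding continuous_map_def by auto
      fix U assume U: "openin T U \<and> \<gamma> t \<in> U"
      have "openin (top_of_set {c..d}) {s \<in> topspace (top_of_set {c..d}). \<gamma> s \<in> U}"
        using cont U by (intro openin_continuous_map_preimage) auto
      then obtain V where V: "open V" "{s \<in> {c..d}. \<gamma> s \<in> U} = {c..d} \<inter> V"
        unfolding openin_open by auto
      then have "t \<in> V" using t U by blast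
      with V(1) have "\<forall>\<^sub>F s in at t within {c..d}. s \<in> V"
        using eventually_nhds unfolding eventually_at_filter by blast
      moreover have "\<forall>\<^sub>F s in at t within {c..d}. s \<in> {c..d}" by (simp add: eventually_at_filter)
      ultimately show "\<forall>\<^sub>F s in at t within {c..d}. \<gamma> s \<in> U"
        by eventually_elim (use V(2) in blast)
    qed
  qed
next
  assume lim: "\<forall>t\<in>{c..d}. limitin T \<gamma> (\<gamma> t) (at t within {c..d})"
  show "continuous_map (top_of_set {c..d}) T \<gamma>"
    unfolding continuous_map_def
  proof (intro conjI allI impI)
    show "\<gamma> \<in> topspace (top_of_set {c..d}) \<rightarrow> topspace T"
      using lim limitin_topspace by fastforce
    fix U assume U: "openin T U"
    show "openin (top_of_set {c..d}) {t \<in> topspace (top_of_set {c..d}). \<gamma> t \<in> U}"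
      unfolding openin_euclidean_subtopology_iff
    proof (intro conjI ballI)
      show "{t \<in> topspace (top_of_set {c..d}). \<gamma> t \<in> U} \<subseteq> {c..d}" by auto
      fix t assume "t \<in> {t \<in> topspace (top_of_set {c..d}). \<gamma> t \<in> U}"
      then have t: "t \<in> {c..d}" "\<gamma> t \<in> U" by auto
      have "\<forall>\<^sub>F s in at t within {c..d}. \<gamma> s \<in> U"
        by (rule limitinD[OF _ U t(2)]) (use lim t in blast)
      then obtain r where "r > 0" "\<forall>s\<in>{c..d}. s \<noteq> t \<and> dist s t < r \<longrightarrow> \<gamma> s \<in> U"
        unfolding eventually_at by blast
      then show "\<exists>r>0. \<forall>s\<in>{c..d}. dist s t < r \<longrightarrow> s \<in> {t \<in> topspace (top_of_set {c..d}). \<gamma> t \<in> U}"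
        using t by (intro exI[of _ r]) auto
    qed
  qed
qed

text \<open>\<open>C1_path\<close> supplies one derivative per chart, with no relation between them.
  The velocity is intrinsic, so the local formulas in charts agree with a single function, which
  inherits their continuity.\<close>

lemma C1_path_velocity:
  assumes C1: "C1_path T A \<gamma> c d" and cd: "c < d"
  obtains W where "continuous_on {c..d} W" "\<And>t. t \<in> {c..d} \<Longrightarrow> has_velocity \<gamma> (W t) t {c..d}"
proof -
  \<comment> \<open>Defined without reference to a chart on the group other than \<kappa>. The
    derivative is taken within the interval, so the end points are included.\<close>
  define W where "W t = vector_derivative (\<lambda>s. chart_map \<kappa> (inv (\<gamma> t) \<otimes> \<gamma> s)) (at t within {c..d})" for t
  have unique: "W t = w" if "has_velocity \<gamma> w t {c..d}" "t \<in> {c..d}" for t w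
    unfolding W_def
    by (rule vector_derivative_within_closed_interval[OF cd that(2) has_velocity_vector_derivative[OF that(1)]])
  have "continuous_map (top_of_set {c..d}) T \<gamma>" using C1 unfolding C1_path_def by blast
  then have lim: "limitin T \<gamma> (\<gamma> t) (at t within {c..d})" if "t \<in> {c..d}" for t
    using that continuous_map_Icc_iff_limitin by blast
  have main: "has_velocity \<gamma> (W t0) t0 {c..d} \<and> (W \<longlongrightarrow> W t0) (at t0 within {c..d})" if t0: "t0 \<in> {c..d}" for t0
  proof -
    have gc: "\<gamma> t0 \<in> carrier G" by (rule limitin_carrier[OF lim[OF t0]])
    obtain \<psi> where \<psi>: "\<psi> \<in> A" "\<gamma> t0 \<in> chart_dom \<psi>" using chart_at_carrier[OF gc] by blast
    obtain \<xi> where \<xi>: "\<xi> \<in> A" "inv (\<gamma> t0) \<in> chart_dom \<xi>" using chart_at_carrier[of "inv (\<gamma> t0)"] gc by blast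
    obtain D where D: "\<And>t. t \<in> {c..d} \<Longrightarrow> \<gamma> t \<in> chart_dom \<psi> \<Longrightarrow>
           ((\<lambda>s. chart_map \<psi> (\<gamma> s)) has_vector_derivative D t) (at t within {c..d})"
        and contD: "continuous_on {t\<in>{c..d}. \<gamma> t \<in> chart_dom \<psi>} D"
      using C1 \<psi>(1) unfolding C1_path_def by blast
    \<comment> \<open>The path translated to \<one> at the fixed time t0. For s near t0 both
      \<open>q s\<close> and its inverse stay in the domain of \<kappa>, so one formula W' with
      fixed charts gives the velocity throughout a neighbourhood.\<close>
    define q where "q s = inv (\<gamma> t0) \<otimes> \<gamma> s" for s
    define q' where "q' s = Dmul \<xi> \<psi> \<kappa> (inv (\<gamma> t0)) (\<gamma> s) (0, D s)" for s
    define W' where "W' s = Dmul \<kappa> \<kappa> \<kappa> (inv (q s)) (q s) (0, q' s)" for s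
    define P where "P s \<longleftrightarrow> s \<in> {c..d} \<and> \<gamma> s \<in> chart_dom \<psi> \<and> q s \<in> chart_dom \<kappa> \<and> inv (q s) \<in> chart_dom \<kappa>" for s
    have vel: "has_velocity \<gamma> (W' s) s {c..d}" if P: "P s" for s
    proof -
      have s: "s \<in> {c..d}" "\<gamma> s \<in> chart_dom \<psi>" "q s \<in> chart_dom \<kappa>" "inv (q s) \<in> chart_dom \<kappa>"
        using P unfolding P_def by auto
      have qs: "q s \<in> carrier G" by (rule chart_dom_carrier[OF \<kappa>_in_A s(3)])
      have "gderiv \<psi> \<gamma> (\<lambda>h. h *\<^sub>R D s) s {c..d}"
        unfolding gderiv_def using lim[OF s(1)] s(2) D[OF s(1,2)] by (simp add: has_vector_derivative_def)
      from gderiv_mult[OF \<xi>(1) \<psi>(1) \<kappa>_in_A s(1) gderiv_const[OF \<xi>(2,1)] this]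
      have "gderiv \<kappa> q (\<lambda>h. Dmul \<xi> \<psi> \<kappa> (inv (\<gamma> t0)) (\<gamma> s) (0, h *\<^sub>R D s)) s {c..d}"
        using s(3) unfolding q_def by simp
      moreover have "Dmul \<xi> \<psi> \<kappa> (inv (\<gamma> t0)) (\<gamma> s) (0, h *\<^sub>R D s) = h *\<^sub>R q' s" for h
        using s(3) unfolding q'_def q_def by (intro Dmul_scale \<xi> \<psi> \<kappa>_in_A s(2))
      ultimately have "gderiv \<kappa> q (\<lambda>h. h *\<^sub>R q' s) s {c..d}" by simp
      from gderiv_imp_lderiv[OF \<kappa>_in_A \<kappa>_in_A this s(4,1)]
      have "lderiv q (\<lambda>h. Dmul \<kappa> \<kappa> \<kappa> (inv (q s)) (q s) (0, h *\<^sub>R q' s)) s {c..d}" .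
      moreover have "Dmul \<kappa> \<kappa> \<kappa> (inv (q s)) (q s) (0, h *\<^sub>R q' s) = h *\<^sub>R W' s" for h
        unfolding W'_def using qs by (intro Dmul_scale \<kappa>_in_A s) simp
      ultimately have "has_velocity q (W' s) s {c..d}" by simp
      from lderiv_left_mult[OF this gc s(1)]
      show "has_velocity \<gamma> (W' s) s {c..d}"
      proof (rule lderiv_transform)
        have *: "\<gamma> t0 \<otimes> q y = \<gamma> y" if "\<gamma> y \<in> carrier G" for y
          using that gc unfolding q_def by (simp flip: m_assoc)
        show "\<forall>\<^sub>F y in at s within {c..d}. \<gamma> t0 \<otimes> q y = \<gamma> y"
          using limitin_eventually_carrier[OF lim[OF s(1)]] by eventually_elim (rule *)
        show "\<gamma> t0 \<otimes> q s = \<gamma> s" by (rule *[OF limitin_carrier[OF lim[OF s(1)]]])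
      qed (rule s)
    qed
    have Pt0: "P t0" using t0 \<psi> gc by (simp add: P_def q_def)
    have limq: "limitin T q \<one> (at t0 within {c..d})"
      using limitin_mult[OF _ lim[OF t0], of "\<lambda>_. inv (\<gamma> t0)" "inv (\<gamma> t0)"] gc topspace_eq_carrier
      by (simp add: q_def[abs_def])
    from limitin_inv[OF this] have limqi: "limitin T (\<lambda>s. inv (q s)) \<one> (at t0 within {c..d})" by simp
    have mem: "\<forall>\<^sub>F s in at t0 within {c..d}. s \<in> {c..d}" by (simp add: eventually_at_filter)
    have ev: "\<forall>\<^sub>F s in at t0 within {c..d}. P s"
      using mem limitinD[OF lim[OF t0] openin_chart_dom[OF \<psi>(1)] \<psi>(2)]
        limitinD[OF limq openin_chart_dom[OF \<kappa>_in_A] one_in_\<kappa>]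
        limitinD[OF limqi openin_chart_dom[OF \<kappa>_in_A] one_in_\<kappa>]
      by eventually_elim (simp add: P_def)
    have Dlim: "(D \<longlongrightarrow> D t0) (at t0 within {c..d})"
    proof -
      have "(D \<longlongrightarrow> D t0) (at t0 within {t\<in>{c..d}. \<gamma> t \<in> chart_dom \<psi>})"
        using contD t0 \<psi>(2) unfolding continuous_on_def by blast
      moreover have "at t0 within {t\<in>{c..d}. \<gamma> t \<in> chart_dom \<psi>} = at t0 within {c..d}"
        unfolding filter_eq_iff eventually_at_filter
        using limitinD[OF lim[OF t0] openin_chart_dom[OF \<psi>(1)] \<psi>(2)] unfolding eventually_at_filter
        by (auto elim: eventually_elim2)
      ultimately show ?thesis by simp
    qed
    have "(q' \<longlongrightarrow> q' t0) (at t0 within {c..d})"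
      unfolding q'_def
      by (rule tendsto_Dmul[OF \<xi>(1) \<psi>(1) \<kappa>_in_A \<xi>(2) \<psi>(2) _ _ lim[OF t0] tendsto_Pair[OF tendsto_const Dlim]])
         (use gc topspace_eq_carrier in auto)
    then have "(W' \<longlongrightarrow> W' t0) (at t0 within {c..d})"
      unfolding W'_def 
    proof (intro tendsto_Dmul tendsto_Pair tendsto_const \<kappa>_in_A)
      show "limitin T (\<lambda>s. inv (q s)) (inv (q t0)) (at t0 within {c..d})"
        "limitin T q (q t0) (at t0 within {c..d})"
        using limq limqi gc by (simp_all add: q_def)
    qed (use Pt0 gc in \<open>simp_all add: q_def\<close>)
    moreover have "\<forall>\<^sub>F s in at t0 within {c..d}. W' s = W s"
      using ev by eventually_elim (use unique[OF vel] P_def in metis)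
    ultimately have "(W \<longlongrightarrow> W' t0) (at t0 within {c..d})"
      by (rule Lim_transform_eventually)
    then show ?thesis using unique[OF vel[OF Pt0] t0] vel[OF Pt0] by simp
  qed
  show thesis
    by (rule that[of W]) (use main in \<open>auto simp: continuous_on_def\<close>)
qed

lemma velocity_C1_path:
  assumes W: "continuous_on {c..d} W" and vel: "\<And>t. t \<in> {c..d} \<Longrightarrow> has_velocity \<gamma> (W t) t {c..d}"
  shows "C1_path T A \<gamma> c d"
  unfolding C1_path_def
proof (intro conjI ballI)
  have lim: "limitin T \<gamma> (\<gamma> t) (at t within {c..d})" if "t \<in> {c..d}" for t
    by (rule lderivD(1)[OF vel[OF that]])
  then show "continuous_map (top_of_set {c..d}) T \<gamma>" using continuous_map_Icc_iff_limitin by blast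
  fix \<psi> assume \<psi>: "\<psi> \<in> A"
  define D where "D t = Dmul \<psi> \<kappa> \<psi> (\<gamma> t) \<one> (0, W t)" for t
  have "((\<lambda>s. chart_map \<psi> (\<gamma> s)) has_vector_derivative D t) (at t within {c..d})"
    if t: "t \<in> {c..d}" "\<gamma> t \<in> chart_dom \<psi>" for t
  proof -
    have "Dmul \<psi> \<kappa> \<psi> (\<gamma> t) \<one> (0, h *\<^sub>R W t) = h *\<^sub>R D t" for h
      unfolding D_def using t chart_dom_carrier[OF \<psi> t(2)] by (intro Dmul_scale \<psi> \<kappa>_in_A) auto
    then show ?thesis
      using gderivD(3)[OF lderiv_imp_gderiv[OF \<psi> vel[OF t(1)] t(2,1)]]
      unfolding has_vector_derivative_def by simp
  qed
  moreover have "continuous_on {t\<in>{c..d}. \<gamma> t \<in> chart_dom \<psi>} D"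
    unfolding continuous_on_def
  proof
    fix t assume "t \<in> {t\<in>{c..d}. \<gamma> t \<in> chart_dom \<psi>}"
    then have t: "t \<in> {c..d}" "\<gamma> t \<in> chart_dom \<psi>" by auto
    have "(W \<longlongrightarrow> W t) (at t within {c..d})" using W t(1) unfolding continuous_on_def by blast
    then have "(D \<longlongrightarrow> D t) (at t within {c..d})"
      unfolding D_def using \<psi> t chart_dom_carrier[OF \<psi> t(2)] lim[OF t(1)] topspace_eq_carrier
      by (intro tendsto_Dmul tendsto_Pair tendsto_const) simp_all
    then show "(D \<longlongrightarrow> D t) (at t within {t\<in>{c..d}. \<gamma> t \<in> chart_dom \<psi>})"
      by (rule tendsto_within_subset) auto
  qed
  ultimately show "\<exists>D. (\<forall>t\<in>{c..d}. \<gamma> t \<in> chart_dom \<psi> \<longrightarrow>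
           ((\<lambda>s. chart_map \<psi> (\<gamma> s)) has_vector_derivative D t) (at t within {c..d})) \<and>
        continuous_on {t\<in>{c..d}. \<gamma> t \<in> chart_dom \<psi>} D" by blast
qed

text \<open>Within a single chart the coordinates have zero derivative; connectedness of the
  interval propagates local constancy.\<close>

lemma zero_velocity_const:
  assumes vel: "\<And>t. t \<in> {c..d} \<Longrightarrow> has_velocity \<gamma> 0 t {c..d}" and cd: "c \<le> d"
  shows "\<gamma> c = \<gamma> d"
proof (rule connected_local_const)
  show "connected {c..d}" by (rule connected_Icc)
  show "\<forall>t\<in>{c..d}. \<forall>\<^sub>F s in at t within {c..d}. \<gamma> t = \<gamma> s"
  proof
    fix t assume t: "t \<in> {c..d}"
    obtain \<psi> where \<psi>: "\<psi> \<in> A" "\<gamma> t \<in> chart_dom \<psi>" using chart_at_carrier[OF lderivD(3)[OF vel[OF t]]] by blast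
    have "\<forall>\<^sub>F s in at t within {c..d}. \<gamma> s \<in> chart_dom \<psi>"
      by (rule limitinD[OF lderivD(1)[OF vel[OF t]] openin_chart_dom[OF \<psi>(1)] \<psi>(2)])
    then obtain r where r: "r > 0" "\<forall>s\<in>{c..d}. s \<noteq> t \<and> dist s t < r \<longrightarrow> \<gamma> s \<in> chart_dom \<psi>"
      unfolding eventually_at by blast
    \<comment> \<open>A convex neighbourhood of t in the interval on which the path stays in the
      chart.\<close>
    define I where "I = {c..d} \<inter> ball t r"
    have dom: "\<gamma> s \<in> chart_dom \<psi>" if "s \<in> I" for s
      using that r \<psi> by (cases "s = t") (auto simp: I_def dist_commute)
    have "convex I" unfolding I_def by (intro convex_Int convex_ball) simp
    moreover have "((\<lambda>s. chart_map \<psi> (\<gamma> s)) has_derivative (\<lambda>h. 0)) (at s within I)" if s: "s \<in> I" for s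
    proof -
      have sI: "s \<in> {c..d}" using s by (simp add: I_def)
      have "Dmul \<psi> \<kappa> \<psi> (\<gamma> s) \<one> (0, 0 *\<^sub>R 0) = 0 *\<^sub>R Dmul \<psi> \<kappa> \<psi> (\<gamma> s) \<one> (0, 0)"
        using dom[OF s] chart_dom_carrier[OF \<psi>(1) dom[OF s]] by (intro Dmul_scale \<psi> \<kappa>_in_A) auto
      then have "((\<lambda>s. chart_map \<psi> (\<gamma> s)) has_derivative (\<lambda>h. 0)) (at s within {c..d})"
        using gderivD(3)[OF lderiv_imp_gderiv[OF \<psi>(1) vel[OF sI] dom[OF s] sI]] by simp
      then show ?thesis by (rule has_derivative_subset) (auto simp: I_def)
    qed
    ultimately have const: "\<exists>k. \<forall>s\<in>I. chart_map \<psi> (\<gamma> s) = k" by (rule has_derivative_zero_constant)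
    have tI: "t \<in> I" using t r by (simp add: I_def)
    have eq: "\<gamma> t = \<gamma> s" if "s \<in> I" for s
      using const that tI inj_onD[OF inj_on_chart[OF \<psi>(1)] _ dom[OF tI] dom[OF that]] by auto
    show "\<forall>\<^sub>F s in at t within {c..d}. \<gamma> t = \<gamma> s"
      unfolding eventually_at using r(1) eq by (intro exI[of _ r]) (auto simp: I_def dist_commute)
  qed
qed (use cd in auto)

end

lemma C1_path_subinterval:
  assumes C1: "C1_path T A \<gamma> a b" and cd: "a \<le> c" "d \<le> b"
  shows "C1_path T A \<gamma> c d"
  unfolding C1_path_def
proof (intro conjI ballI)
  have sub: "{c..d} \<subseteq> {a..b}" using cd by auto
  show "continuous_map (top_of_set {c..d}) T \<gamma>"
    using C1 sub continuous_map_from_subtopology_mono unfolding C1_path_def by blast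
  fix \<psi> assume "\<psi> \<in> A"
  then obtain D where D: "\<forall>t\<in>{a..b}. \<gamma> t \<in> chart_dom \<psi> \<longrightarrow>
           ((\<lambda>s. chart_map \<psi> (\<gamma> s)) has_vector_derivative D t) (at t within {a..b})"
       "continuous_on {t\<in>{a..b}. \<gamma> t \<in> chart_dom \<psi>} D"
    using C1 unfolding C1_path_def by blast
  have "continuous_on {t\<in>{c..d}. \<gamma> t \<in> chart_dom \<psi>} D"
    by (rule continuous_on_subset[OF D(2)]) (use sub in auto)
  moreover have "((\<lambda>s. chart_map \<psi> (\<gamma> s)) has_vector_derivative D t) (at t within {c..d})"
    if "t \<in> {c..d}" "\<gamma> t \<in> chart_dom \<psi>" for t
    by (rule has_vector_derivative_within_subset[OF _ sub]) (use D(1) sub that in blast)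
  ultimately show "\<exists>D. (\<forall>t\<in>{c..d}. \<gamma> t \<in> chart_dom \<psi> \<longrightarrow>
           ((\<lambda>s. chart_map \<psi> (\<gamma> s)) has_vector_derivative D t) (at t within {c..d})) \<and>
        continuous_on {t\<in>{c..d}. \<gamma> t \<in> chart_dom \<psi>} D"
    by blast
qed

text \<open>Removes the break points from later arguments: a property of subintervals that holds on
  \<open>C1\<close> pieces and survives concatenation holds on all of them. Degenerate intervals
  form their own case because a one-point interval does not determine a derivative.\<close>

lemma piecewise_C1_induct [consumes 4, case_names C1 join point]:
  assumes \<gamma>: "piecewise_C1_path T A \<gamma> a b" "a \<le> t0" "t0 \<le> t1" "t1 \<le> b"
    and C1: "\<And>c d. a \<le> c \<Longrightarrow> c < d \<Longrightarrow> d \<le> b \<Longrightarrow> C1_path T A \<gamma> c d \<Longrightarrow> P c d"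
    and join: "\<And>c m d. c \<le> m \<Longrightarrow> m \<le> d \<Longrightarrow> P c m \<Longrightarrow> P m d \<Longrightarrow> P c d"
    and point: "\<And>c. a \<le> c \<Longrightarrow> c \<le> b \<Longrightarrow> P c c"
  shows "P t0 t1"
proof -
  obtain n \<tau> where \<tau>: "\<tau> 0 = a" "\<tau> n = b"
    and seg: "\<And>i. i < n \<Longrightarrow> \<tau> i < \<tau> (Suc i) \<and> C1_path T A \<gamma> (\<tau> i) (\<tau> (Suc i))"
    using \<gamma>(1) unfolding piecewise_C1_path_def by blast
  have mono: "\<tau> i \<le> \<tau> n" if "i \<le> n" for i
    using that by (induction rule: inc_induct) (use seg in \<open>force intro: order_trans less_imp_le\<close>)+
  have "P s t" if "m \<le> n" "a \<le> s" "s \<le> t" "t \<le> \<tau> m" for m s t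
    using that
  proof (induction m arbitrary: s t)
    case 0
    then have "s = a" "t = a" using \<tau> by auto
    moreover have "a \<le> b" using \<gamma>(2-4) by linarith
    ultimately show ?case using point by simp
  next
    case (Suc m)
    have m: "\<tau> m < \<tau> (Suc m)" "C1_path T A \<gamma> (\<tau> m) (\<tau> (Suc m))" using seg[of m] Suc.prems by auto
    have b: "\<tau> (Suc m) \<le> b" using mono[OF Suc.prems(1)] \<tau>(2) by simp
    have piece: "P s t" if "a \<le> s" "\<tau> m \<le> s" "s \<le> t" "t \<le> \<tau> (Suc m)" for s t
    proof (cases "s = t")
      case True
      then show ?thesis using point[of s] that b by simp
    next
      case False
      then show ?thesis
        using that b by (intro C1 C1_path_subinterval[OF m(2)]) auto
    qed
    consider "t \<le> \<tau> m" | "\<tau> m \<le> s" | "s \<le> \<tau> m" "\<tau> m \<le> t" by linarith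
    then show ?case
    proof cases
      case 1
      then show ?thesis using Suc by simp
    next
      case 2
      then show ?thesis using piece Suc.prems by simp
    next
      case 3
      have "P s (\<tau> m)" using Suc 3 by simp
      moreover have "P (\<tau> m) t" using piece[of "\<tau> m" t] 3 Suc.prems by simp
      ultimately show ?thesis using join 3 by blast
    qed
  qed
  then show ?thesis using \<gamma>(2-4) \<tau>(2) by blast
qed

section \<open>Length and the first variation\<close>

text \<open>For a nonnegative function gauge integrability is absolute integrability, which makes
  the Lebesgue criterion available.\<close>

lemma AE_eq_0_of_integral_eq_0:
  fixes f :: "real \<Rightarrow> real"
  assumes f: "f integrable_on {a..b}" "\<And>t. 0 \<le> f t" and 0: "integral {a..b} f = 0"
  shows "AE t\<in>{a..b} in lborel. f t = 0"
proof -
  have abs: "f absolutely_integrable_on {a..b}"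
    by (rule nonnegative_absolutely_integrable_1[OF f(1)]) (rule f(2))
  then have si: "set_integrable lebesgue {a..b} f" .
  have "(LINT t:{a..b}|lebesgue. f t) = integral {a..b} f"
    by (rule set_lebesgue_integral_eq_integral(2)[OF si])
  then have "integral\<^sup>L lebesgue (\<lambda>t. indicator {a..b} t *\<^sub>R f t) = 0"
    using 0 unfolding set_lebesgue_integral_def by simp
  then have "AE t in lebesgue. indicator {a..b} t *\<^sub>R f t = 0"
    using si f(2) unfolding set_integrable_def
    by (subst (asm) integral_nonneg_eq_0_iff_AE) (auto simp: indicator_def)
  then have "AE t in lebesgue. t \<in> {a..b} \<longrightarrow> f t = 0"
    by eventually_elim (auto simp: indicator_def)
  then show ?thesis by (simp add: AE_completion_iff)
qed

lemma piecewise_C1_transfer: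
  assumes \<gamma>: "piecewise_C1_path T A \<gamma> a b" and cont: "continuous_map (top_of_set {a..b}) T \<delta>"
    and C1: "\<And>c d. a \<le> c \<Longrightarrow> c < d \<Longrightarrow> d \<le> b \<Longrightarrow> C1_path T A \<gamma> c d \<Longrightarrow> C1_path T A \<delta> c d"
  shows "piecewise_C1_path T A \<delta> a b"
proof -
  obtain n \<tau> where \<tau>: "\<tau> 0 = a" "\<tau> n = b"
    and seg: "\<And>i. i < n \<Longrightarrow> \<tau> i < \<tau> (Suc i) \<and> C1_path T A \<gamma> (\<tau> i) (\<tau> (Suc i))"
    using \<gamma>(1) unfolding piecewise_C1_path_def by blast
  have le_n: "\<tau> i \<le> \<tau> n" if "i \<le> n" for i
    using that by (induction rule: inc_induct) (use seg in \<open>force intro: order_trans less_imp_le\<close>)+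
  have ge_0: "\<tau> 0 \<le> \<tau> i" if "i \<le> n" for i
    using that
  proof (induction i)
    case (Suc i)
    then show ?case using seg[of i] by simp
  qed simp
  have "\<tau> i < \<tau> (Suc i) \<and> C1_path T A \<delta> (\<tau> i) (\<tau> (Suc i))" if "i < n" for i
    using C1[of "\<tau> i" "\<tau> (Suc i)"] seg[OF that] le_n[of "Suc i"] ge_0[of i] \<tau> that by simp
  then show ?thesis using \<tau> cont unfolding piecewise_C1_path_def by blast
qed

context based_lie_group
begin

text \<open>\<open>left_velocity\<close> is a two-sided derivative and may differ from the one-sided
  W at c and d, which does not affect the integral. The map h stands for \<open>N\<close>, for the
  identity and for the error terms of the first variation.\<close>

lemma C1_path_left_velocity:
  assumes vel: "\<And>t. t \<in> {c..d} \<Longrightarrow> has_velocity \<gamma> (W t) t {c..d}" and W: "continuous_on {c..d} W"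
    and h: "continuous_on UNIV (h :: 'e \<Rightarrow> 'f::euclidean_space)"
  shows "((\<lambda>t. h (left_velocity G \<kappa> \<gamma> t)) has_integral integral {c..d} (\<lambda>t. h (W t))) {c..d}"
proof (rule has_integral_spike_finite[where S="{c, d}"])
  have "continuous_on {c..d} (\<lambda>t. h (W t))"
    using continuous_on_compose2[OF h W] by simp
  then show "((\<lambda>t. h (W t)) has_integral integral {c..d} (\<lambda>t. h (W t))) {c..d}"
    using integrable_continuous_real by blast
  show "h (left_velocity G \<kappa> \<gamma> t) = h (W t)" if "t \<in> {c..d} - {c, d}" for t
    using has_velocity_left_velocity[OF vel, of t] that by simp
qed simp

lemma left_velocity_integrable:
  assumes \<gamma>: "piecewise_C1_path T A \<gamma> a b" "a \<le> t0" "t0 \<le> t1" "t1 \<le> b"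
    and h: "continuous_on UNIV (h :: 'e \<Rightarrow> 'f::euclidean_space)"
  shows "(\<lambda>t. h (left_velocity G \<kappa> \<gamma> t)) integrable_on {t0..t1}"
  using \<gamma>
proof (induction t0 t1 rule: piecewise_C1_induct)
  case (C1 c d)
  obtain W where "continuous_on {c..d} W" "\<And>t. t \<in> {c..d} \<Longrightarrow> has_velocity \<gamma> (W t) t {c..d}"
    using C1_path_velocity[OF C1(4,2)] by blast
  from has_integral_integrable[OF C1_path_left_velocity[OF this(2,1) h]] show ?case .
next
  case (join c m d)
  show ?case by (rule Henstock_Kurzweil_Integration.integrable_combine[OF join])
next
  case (point c)
  have "(\<lambda>t. h (left_velocity G \<kappa> \<gamma> t)) integrable_on cbox c c" by (rule integrable_on_refl)
  then show ?case by simp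
qed

end

locale finsler_lie_group = based_lie_group G T A \<kappa>
  for G :: "('g, 'm) monoid_scheme" (structure)
    and T :: "'g topology" and A :: "('g, 'e::euclidean_space) chart set" and \<kappa> +
  fixes N :: "'e \<Rightarrow> real"
  assumes finsler: "finsler_norm N" and Ad_inv_N: "Ad_invariant G \<kappa> N"
begin

lemma N_Ad: "g \<in> carrier G \<Longrightarrow> N (Ad G \<kappa> g v) = N v"
  using Ad_inv_N unfolding Ad_invariant_def by blast

lemma len_integrable:
  assumes "piecewise_C1_path T A \<gamma> a b" "a \<le> t0" "t0 \<le> t1" "t1 \<le> b"
  shows "(\<lambda>t. N (left_velocity G \<kappa> \<gamma> t)) integrable_on {t0..t1}"
  by (rule left_velocity_integrable[OF assms continuous_on_finsler[OF finsler]])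

lemma path_len_nonneg: "0 \<le> path_len G \<kappa> N \<gamma> a b"
proof (cases "(\<lambda>t. N (left_velocity G \<kappa> \<gamma> t)) integrable_on {a..b}")
  case True
  then show ?thesis
    unfolding path_len_def by (intro Henstock_Kurzweil_Integration.integral_nonneg finsler_nonneg[OF finsler])
qed (simp add: path_len_def not_integrable_integral)

lemma path_len_combine:
  assumes \<gamma>: "piecewise_C1_path T A \<gamma> a b" "a \<le> t0" "t0 \<le> t1" "t1 \<le> t2" "t2 \<le> b"
  shows "path_len G \<kappa> N \<gamma> t0 t1 + path_len G \<kappa> N \<gamma> t1 t2 = path_len G \<kappa> N \<gamma> t0 t2"
  unfolding path_len_def
  using \<gamma> by (intro Henstock_Kurzweil_Integration.integral_combine len_integrable[OF \<gamma>(1)]) auto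

lemma path_len_velocity:
  assumes "\<And>t. t \<in> {c..d} \<Longrightarrow> has_velocity \<gamma> (W t) t {c..d}" "continuous_on {c..d} W"
  shows "path_len G \<kappa> N \<gamma> c d = integral {c..d} (\<lambda>t. N (W t))"
  unfolding path_len_def
  using C1_path_left_velocity[OF assms continuous_on_finsler[OF finsler]] by (rule integral_unique)

end

section \<open>Logarithmic derivatives of curves given in the chart at the identity\<close>

context based_lie_group
begin

text \<open>The left logarithmic derivative of \<open>chart_inv \<kappa>\<close> at \<open>p\<close>.\<close>
definition dlog :: "'e \<Rightarrow> 'e \<Rightarrow> 'e" where
  "dlog p v = Dmul \<kappa> \<kappa> \<kappa> (inv (chart_inv \<kappa> p)) (chart_inv \<kappa> p) (0, v)"

definition near_one :: "'e \<Rightarrow> bool" where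
  "near_one p \<longleftrightarrow> p \<in> chart_map \<kappa> ` chart_dom \<kappa> \<and> inv (chart_inv \<kappa> p) \<in> chart_dom \<kappa>"

lemma near_oneD:
  assumes "near_one p"
  shows "chart_inv \<kappa> p \<in> chart_dom \<kappa>" "inv (chart_inv \<kappa> p) \<in> chart_dom \<kappa>"
    "chart_inv \<kappa> p \<in> carrier G" "chart_map \<kappa> (chart_inv \<kappa> p) = p" "p \<in> chart_map \<kappa> ` chart_dom \<kappa>"
  using assms chart_inv_chart_map[OF \<kappa>_in_A] chart_dom_carrier[OF \<kappa>_in_A] unfolding near_one_def by auto

lemma limitin_chart_inv_one: "limitin T (chart_inv \<kappa>) \<one> (nhds e)"
  using limitin_chart_inv[OF \<kappa>_in_A _ filterlim_ident, of e] by simp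

lemma eventually_near_one: "\<forall>\<^sub>F p in nhds e. near_one p"
proof -
  have "\<forall>\<^sub>F p in nhds e. p \<in> chart_map \<kappa> ` chart_dom \<kappa>"
    using open_chart_image[OF \<kappa>_in_A] by (intro eventually_nhds_in_open) auto
  moreover have "limitin T (\<lambda>p. inv (chart_inv \<kappa> p)) \<one> (nhds e)"
    using limitin_inv[OF limitin_chart_inv_one] by simp
  then have "\<forall>\<^sub>F p in nhds e. inv (chart_inv \<kappa> p) \<in> chart_dom \<kappa>"
    using limitinD openin_chart_dom[OF \<kappa>_in_A] one_in_\<kappa> by metis
  ultimately show ?thesis by eventually_elim (simp add: near_one_def)
qed

lemma linear_dlog:
  assumes p: "near_one p"
  shows "linear (dlog p)"
proof -
  note q = near_oneD[OF p]
  have *: "linear (Dmul \<kappa> \<kappa> \<kappa> (inv (chart_inv \<kappa> p)) (chart_inv \<kappa> p))"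
    using q by (intro linear_Dmul \<kappa>_in_A) auto
  show ?thesis
  proof (rule linearI)
    show "dlog p (v + w) = dlog p v + dlog p w" for v w
      using linear_add[OF *, of "(0, v)" "(0, w)"] by (simp add: dlog_def)
    show "dlog p (r *\<^sub>R v) = r *\<^sub>R dlog p v" for r v
      using linear_scale[OF *, of r "(0, v)"] by (simp add: dlog_def)
  qed
qed

lemma lderiv_chart_curve:
  assumes u: "gderiv \<kappa> u L x S" and p: "near_one (chart_map \<kappa> (u x))" and x: "x \<in> S"
  shows "lderiv u (\<lambda>h. dlog (chart_map \<kappa> (u x)) (L h)) x S"
proof -
  have eq: "chart_inv \<kappa> (chart_map \<kappa> (u x)) = u x"
    by (rule chart_inv_chart_map[OF \<kappa>_in_A gderivD(2)[OF u]])
  show ?thesis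
    using gderiv_imp_lderiv[OF \<kappa>_in_A \<kappa>_in_A u _ x] near_oneD(2)[OF p] unfolding dlog_def eq by simp
qed

lemma tendsto_dlog:
  assumes p: "near_one p" and X: "(X \<longlongrightarrow> p) F" and V: "(V \<longlongrightarrow> v) F"
  shows "((\<lambda>i. dlog (X i) (V i)) \<longlongrightarrow> dlog p v) F"
proof -
  note q = near_oneD[OF p]
  have 1: "limitin T (\<lambda>i. chart_inv \<kappa> (X i)) (chart_inv \<kappa> p) F"
    by (rule limitin_chart_inv[OF \<kappa>_in_A q(5) X])
  show ?thesis
    unfolding dlog_def
    by (rule tendsto_Dmul[OF \<kappa>_in_A \<kappa>_in_A \<kappa>_in_A q(2,1) _ limitin_inv[OF 1] 1 tendsto_Pair[OF tendsto_const V]])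
       (use q in simp)
qed

lemma near_one_e: "near_one e"
  unfolding near_one_def by simp

lemma dlog_e: "dlog e v = v"
  by (simp add: dlog_def Dmul_one)

text \<open>Applying \<open>Ad\<close> of the point turns the left logarithmic derivative into the
  right one. It is the identity at e and depends continuously on p, and its deviation from the
  identity is the error of the first variation.\<close>

lemma eventually_right_dlog_near_id:
  assumes \<eta>: "0 < \<eta>"
  shows "\<forall>\<^sub>F p in nhds e. \<forall>v. norm (Ad G \<kappa> (chart_inv \<kappa> p) (dlog p v) - v) \<le> \<eta> * norm v"
proof (rule linear_families_near_id[OF _ _ \<eta>])
  show "\<forall>\<^sub>F p in nhds e. linear (\<lambda>v. Ad G \<kappa> (chart_inv \<kappa> p) (dlog p v))"
    using eventually_near_one
  proof eventually_elim
    case (elim p)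
    show ?case
      using linear_compose[OF linear_dlog[OF elim] linear_Ad[OF near_oneD(3)[OF elim]]] by (simp add: o_def)
  qed
  fix b :: 'e
  have "((\<lambda>p. dlog p b) \<longlongrightarrow> dlog e b) (nhds e)"
    by (rule tendsto_dlog[OF near_one_e]) (auto simp: filterlim_ident)
  from tendsto_Ad[OF limitin_chart_inv_one this]
  show "((\<lambda>p. Ad G \<kappa> (chart_inv \<kappa> p) (dlog p b)) \<longlongrightarrow> b) (nhds e)"
    by (simp add: Ad_one dlog_e)
qed

end

context finsler_lie_group
begin

text \<open>
  First variation: \<open>\<gamma>\<close> is multiplied by a small closed curve whose velocity is \<open>\<epsilon>\<close> times the deviation
  of the velocity of \<open>\<gamma>\<close> from its mean.
\<close>
lemma short_path_len_le:
  assumes \<gamma>: "piecewise_C1_path T A \<gamma> a b" and ab: "a < b" and short: "short_path G T A \<kappa> N \<gamma> a b"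
  shows "path_len G \<kappa> N \<gamma> a b \<le> N (integral {a..b} (left_velocity G \<kappa> \<gamma>))"
proof -
  define w where "w = left_velocity G \<kappa> \<gamma>"
  define x where "x = integral {a..b} w"
  define m where "m = x /\<^sub>R (b - a)"
  define L where "L = path_len G \<kappa> N \<gamma> a b"
  have w_int: "w integrable_on {s..t}" if "a \<le> s" "s \<le> t" "t \<le> b" for s t
    unfolding w_def using left_velocity_integrable[OF \<gamma> that, of "\<lambda>v. v"] by simp
  have mw_int: "(\<lambda>s. m - w s) integrable_on {s..t}" if "a \<le> s" "s \<le> t" "t \<le> b" for s t
    by (intro integrable_diff integrable_const_ivl w_int that)
  \<comment> \<open>Vanishes at both ends because m is the mean of w; a multiple of it added to e
    gives the coordinates of the closed curve.\<close>
  define cc where "cc t = integral {a..t} (\<lambda>s. m - w s)" for t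
  have cc_a: "cc a = 0" by (simp add: cc_def)
  have "cc b = integral {a..b} (\<lambda>s. m) - integral {a..b} w"
    unfolding cc_def using ab by (intro integral_diff integrable_const_ivl w_int) auto
  then have cc_b: "cc b = 0" using ab by (simp add: m_def x_def)
  have cc_cont: "continuous_on {a..b} cc"
    unfolding cc_def using ab by (intro indefinite_integral_continuous_1 mw_int) auto
  obtain Kc where Kc: "0 < Kc" "\<And>t. t \<in> {a..b} \<Longrightarrow> norm (cc t) \<le> Kc"
    using compact_imp_bounded[OF compact_continuous_image[OF cc_cont compact_Icc]]
    unfolding bounded_pos by (meson imageI)
  obtain C where C: "0 < C" "\<And>x. N x \<le> C * norm x" by (rule finsler_upper_bound[OF finsler]) blast
  define K where "K = integral {a..b} (\<lambda>t. norm (m - w t))"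
  have "continuous_on UNIV (\<lambda>v. norm (m - v))" by (intro continuous_intros)
  from left_velocity_integrable[OF \<gamma> _ _ _ this, of a b]
  have K_int: "(\<lambda>t. norm (m - w t)) integrable_on {a..b}" using ab by (simp add: w_def)
  have Ncont: "continuous_on UNIV N" by (rule continuous_on_finsler[OF finsler])
  have cc_deriv: "(cc has_vector_derivative m - W t) (at t within {c..d})"
    if cd: "a \<le> c" "c < d" "d \<le> b" and W: "continuous_on {c..d} W"
      and vel: "\<And>t. t \<in> {c..d} \<Longrightarrow> has_velocity \<gamma> (W t) t {c..d}" and t: "t \<in> {c..d}" for c d W t
  proof -
    have "((\<lambda>u. integral {c..u} (\<lambda>s. m - W s)) has_vector_derivative m - W t) (at t within {c..d})"
      by (intro integral_has_vector_derivative continuous_intros W t)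
    then have "((\<lambda>u. cc c + integral {c..u} (\<lambda>s. m - W s)) has_vector_derivative m - W t) (at t within {c..d})"
      by (auto intro!: derivative_eq_intros)
    then show ?thesis
    proof (rule has_vector_derivative_transform[rotated 2])
      fix u assume u: "u \<in> {c..d}"
      have "integral {a..c} (\<lambda>s. m - w s) + integral {c..u} (\<lambda>s. m - w s) = integral {a..u} (\<lambda>s. m - w s)"
        using u cd by (intro Henstock_Kurzweil_Integration.integral_combine mw_int) auto
      moreover have "integral {c..u} (\<lambda>s. m - w s) = integral {c..u} (\<lambda>s. m - W s)"
      proof (rule integral_spike[of "{c, d}"])
        show "m - W s = m - w s" if "s \<in> {c..u} - {c, d}" for s
          using has_velocity_left_velocity[OF vel, of s] that u unfolding w_def by simp
      qed simp
      ultimately show "cc u = cc c + integral {c..u} (\<lambda>s. m - W s)" by (simp add: cc_def)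
    qed (rule t)
  qed
  have main: "L \<le> N x + C * \<eta> * K" if \<eta>: "0 < \<eta>" for \<eta>
  proof -
    have "\<forall>\<^sub>F p in nhds e. near_one p \<and>
        (\<forall>v. norm (Ad G \<kappa> (chart_inv \<kappa> p) (dlog p v) - v) \<le> \<eta> * norm v)"
      by (rule eventually_conj[OF eventually_near_one eventually_right_dlog_near_id[OF \<eta>]])
    then obtain r where r: "0 < r"
      "\<And>p. dist p e < r \<Longrightarrow> near_one p"
      "\<And>p v. dist p e < r \<Longrightarrow> norm (Ad G \<kappa> (chart_inv \<kappa> p) (dlog p v) - v) \<le> \<eta> * norm v"
      unfolding eventually_nhds_metric by blast
    \<comment> \<open>Keeps all points \<open>e + \<epsilon> *\<^sub>R cc t\<close> within distance
      r of e, where the estimates hold; \<epsilon> \<le> 1 makes 1 - \<epsilon> a legitimate factor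
      for positive homogeneity.\<close>
    define \<epsilon> where "\<epsilon> = min 1 (r / (2 * Kc))"
    have \<epsilon>: "0 < \<epsilon>" "\<epsilon> \<le> 1" using r Kc by (auto simp: \<epsilon>_def)
    have "\<epsilon> * Kc \<le> r / (2 * Kc) * Kc" unfolding \<epsilon>_def using Kc by (intro mult_right_mono) auto
    then have \<epsilon>K: "\<epsilon> * Kc < r" using Kc r by simp
    define p where "p t = e + \<epsilon> *\<^sub>R cc t" for t
    define u where "u t = chart_inv \<kappa> (p t)" for t
    define \<delta> where "\<delta> t = \<gamma> t \<otimes> u t" for t
    have dist_p: "dist (p t) e < r" if "t \<in> {a..b}" for t
    proof -
      have "dist (p t) e = \<epsilon> * norm (cc t)" using \<epsilon> by (simp add: p_def dist_norm)
      also have "\<dots> \<le> \<epsilon> * Kc" using Kc(2)[OF that] \<epsilon> by (intro mult_left_mono) auto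
      finally show ?thesis using \<epsilon>K by simp
    qed
    note near = r(2)[OF dist_p]
    have p_cont: "continuous_on {a..b} p" unfolding p_def by (intro continuous_intros cc_cont)
    have u_lim: "limitin T u (u t) (at t within {a..b})" if "t \<in> {a..b}" for t
      unfolding u_def
      by (rule limitin_chart_inv[OF \<kappa>_in_A near_oneD(5)[OF near[OF that]]])
         (use p_cont that in \<open>auto simp: continuous_on_def\<close>)
    \<comment> \<open>A bound for the speed of \<delta> as a function of the velocity of \<gamma>.
      Its integral involves only the length of \<gamma>, \<open>N x\<close> and K.\<close>
    define h where "h v = (1 - \<epsilon>) * N v + \<epsilon> * N m + \<epsilon> * (C * \<eta> * norm (m - v))" for v
    have h_cont: "continuous_on UNIV h"
      unfolding h_def by (intro continuous_intros Ncont)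
    have piece: "C1_path T A \<delta> c d \<and> path_len G \<kappa> N \<delta> c d \<le> integral {c..d} (\<lambda>t. h (w t))
        \<and> (\<lambda>t. N (left_velocity G \<kappa> \<delta> t)) integrable_on {c..d}"
      if cd: "a \<le> c" "c < d" "d \<le> b" and C1: "C1_path T A \<gamma> c d" for c d
    proof -
      obtain W where W: "continuous_on {c..d} W" "\<And>t. t \<in> {c..d} \<Longrightarrow> has_velocity \<gamma> (W t) t {c..d}"
        using C1_path_velocity[OF C1 cd(2)] by blast
      have sub: "{c..d} \<subseteq> {a..b}" using cd by auto
      define V where "V t = Ad G \<kappa> (inv (u t)) (W t) + dlog (p t) (\<epsilon> *\<^sub>R (m - W t))" for t
      have vel: "has_velocity \<delta> (V t) t {c..d}" if t: "t \<in> {c..d}" for t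
      proof -
        have tab: "t \<in> {a..b}" using t sub by blast
        have p': "(p has_derivative (\<lambda>h. h *\<^sub>R (\<epsilon> *\<^sub>R (m - W t)))) (at t within {c..d})"
          unfolding p_def using cc_deriv[OF cd W t]
          by (auto intro!: derivative_eq_intros simp: has_vector_derivative_def mult.commute)
        have "gderiv \<kappa> u (\<lambda>h. h *\<^sub>R (\<epsilon> *\<^sub>R (m - W t))) t {c..d}"
          unfolding u_def
          by (rule gderiv_compose[OF p' gderiv_chart_inv[OF \<kappa>_in_A near_oneD(5)[OF near[OF tab]]]]) simp
        moreover have pt: "chart_map \<kappa> (u t) = p t" unfolding u_def by (rule near_oneD(4)[OF near[OF tab]])
        ultimately have "lderiv u (\<lambda>h. dlog (p t) (h *\<^sub>R (\<epsilon> *\<^sub>R (m - W t)))) t {c..d}"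
          using lderiv_chart_curve[of u _ t "{c..d}"] near[OF tab] t by simp
        then have "has_velocity u (dlog (p t) (\<epsilon> *\<^sub>R (m - W t))) t {c..d}"
          by (simp only: linear_scale[OF linear_dlog[OF near[OF tab]]])
        from lderiv_mult[OF W(2)[OF t] this t]
        have "lderiv \<delta> (\<lambda>h. Ad G \<kappa> (inv (u t)) (h *\<^sub>R W t) + h *\<^sub>R dlog (p t) (\<epsilon> *\<^sub>R (m - W t))) t {c..d}"
          unfolding \<delta>_def .
        moreover have "linear (Ad G \<kappa> (inv (u t)))"
          using near_oneD(3)[OF near[OF tab]] by (intro linear_Ad) (simp add: u_def)
        ultimately show ?thesis
          by (simp add: V_def linear_scale scaleR_add_right)
      qed
      have V_cont: "continuous_on {c..d} V"
        unfolding continuous_on_def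
      proof
        fix t assume t: "t \<in> {c..d}"
        then have tab: "t \<in> {a..b}" using sub by blast
        have Wt: "(W \<longlongrightarrow> W t) (at t within {c..d})" using W(1) t by (auto simp: continuous_on_def)
        have "(p \<longlongrightarrow> p t) (at t within {a..b})" using p_cont tab by (auto simp: continuous_on_def)
        then have pt: "(p \<longlongrightarrow> p t) (at t within {c..d})" using sub by (rule tendsto_within_subset)
        have ut: "limitin T u (u t) (at t within {c..d})"
          unfolding u_def by (rule limitin_chart_inv[OF \<kappa>_in_A near_oneD(5)[OF near[OF tab]] pt])
        show "(V \<longlongrightarrow> V t) (at t within {c..d})"
          unfolding V_def
          by (intro tendsto_add tendsto_Ad limitin_inv ut Wt tendsto_dlog near[OF tab] pt tendsto_intros)
      qed
      have NV: "N (V t) \<le> h (W t)" if t: "t \<in> {c..d}" for t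
      proof -
        have tab: "t \<in> {a..b}" using t sub by blast
        have uc: "u t \<in> carrier G" unfolding u_def by (rule near_oneD(3)[OF near[OF tab]])
        define z where "z = m - W t"
        define y where "y = Ad G \<kappa> (u t) (dlog (p t) z)"
        \<comment> \<open>Conjugating by \<open>u t\<close> leaves \<open>N\<close> unchanged and
          frees W t from its \<open>Ad\<close> factor, so that the perturbation becomes
          additive.\<close>
        have "N (V t) = N (Ad G \<kappa> (u t) (V t))" using N_Ad[OF uc] by simp
        also have "Ad G \<kappa> (u t) (V t) = W t + \<epsilon> *\<^sub>R y"
          using uc by (simp add: V_def y_def z_def linear_add[OF linear_Ad] linear_scale[OF linear_Ad] Ad_inv
              linear_scale[OF linear_dlog[OF near[OF tab]]])
        also have "\<dots> = ((1 - \<epsilon>) *\<^sub>R W t + \<epsilon> *\<^sub>R m) + \<epsilon> *\<^sub>R (y - z)"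
          by (simp add: z_def algebra_simps)
        also have "N \<dots> \<le> (N ((1 - \<epsilon>) *\<^sub>R W t) + N (\<epsilon> *\<^sub>R m)) + N (\<epsilon> *\<^sub>R (y - z))"
          by (intro order_trans[OF finsler_triangle[OF finsler]] add_mono finsler_triangle[OF finsler] order_refl)
        also have "\<dots> = (1 - \<epsilon>) * N (W t) + \<epsilon> * N m + \<epsilon> * N (y - z)"
          using \<epsilon> by (simp add: finsler_scale[OF finsler])
        also have "N (y - z) \<le> C * (\<eta> * norm z)"
          using C(2)[of "y - z"] r(3)[OF dist_p[OF tab], of z] C(1)
          unfolding y_def u_def by (meson less_imp_le mult_left_mono order_trans)
        finally show ?thesis using \<epsilon> unfolding h_def z_def by (simp add: mult_left_mono mult.assoc)
      qed
      have "path_len G \<kappa> N \<delta> c d = integral {c..d} (\<lambda>t. N (V t))"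
        by (rule path_len_velocity[OF vel V_cont])
      also have "\<dots> \<le> integral {c..d} (\<lambda>t. h (W t))"
      proof (rule integral_le)
        show "(\<lambda>t. N (V t)) integrable_on {c..d}"
          by (intro integrable_continuous_real continuous_on_compose2[OF Ncont V_cont]) simp
        show "(\<lambda>t. h (W t)) integrable_on {c..d}"
          by (intro integrable_continuous_real continuous_on_compose2[OF h_cont W(1)]) simp
      qed (rule NV)
      also have "\<dots> = integral {c..d} (\<lambda>t. h (w t))"
        unfolding w_def by (rule integral_unique[OF C1_path_left_velocity[OF W(2,1) h_cont], symmetric])
      finally show ?thesis
        using velocity_C1_path[OF V_cont vel]
          has_integral_integrable[OF C1_path_left_velocity[OF vel V_cont Ncont]] by blast
    qed
    have \<delta>: "piecewise_C1_path T A \<delta> a b"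
    proof (rule piecewise_C1_transfer[OF \<gamma>])
      have "continuous_map (top_of_set {a..b}) T \<gamma>" using \<gamma> unfolding piecewise_C1_path_def by blast
      then have "\<forall>t\<in>{a..b}. limitin T \<gamma> (\<gamma> t) (at t within {a..b})"
        by (simp only: continuous_map_Icc_iff_limitin)
      then show "continuous_map (top_of_set {a..b}) T \<delta>"
        unfolding continuous_map_Icc_iff_limitin \<delta>_def
        by (intro ballI limitin_mult u_lim) auto
    qed (use piece in blast)
    have carrier: "\<gamma> a \<in> carrier G" "\<gamma> b \<in> carrier G"
    proof -
      have "continuous_map (top_of_set {a..b}) T \<gamma>" using \<gamma> unfolding piecewise_C1_path_def by blast
      then show "\<gamma> a \<in> carrier G" "\<gamma> b \<in> carrier G"
        using ab topspace_eq_carrier unfolding continuous_map_def by auto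
    qed
    have "\<delta> a = \<gamma> a" "\<delta> b = \<gamma> b"
      using carrier by (simp_all add: \<delta>_def u_def p_def cc_a cc_b)
    then have "L \<le> path_len G \<kappa> N \<delta> a b"
      using short \<delta> ab unfolding short_path_def L_def by (meson less_imp_le)
    also have "path_len G \<kappa> N \<delta> a b \<le> integral {a..b} (\<lambda>t. h (w t))"
    proof -
      have h_int: "(\<lambda>t. h (w t)) integrable_on {s..t}" if "a \<le> s" "s \<le> t" "t \<le> b" for s t
        unfolding w_def by (rule left_velocity_integrable[OF \<gamma> that h_cont])
      have "a \<le> s \<and> t \<le> b \<longrightarrow> path_len G \<kappa> N \<delta> s t \<le> integral {s..t} (\<lambda>t. h (w t))"
        if "a \<le> s" "s \<le> t" "t \<le> b" for s t
        using \<gamma> that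
      proof (induction s t rule: piecewise_C1_induct)
        case (C1 c d)
        then show ?case using piece by blast
      next
        case (join c k d)
        show ?case
        proof
          assume cd: "a \<le> c \<and> d \<le> b"
          have "path_len G \<kappa> N \<delta> c d = path_len G \<kappa> N \<delta> c k + path_len G \<kappa> N \<delta> k d"
            using path_len_combine[OF \<delta>, of c k d] cd join by simp
          also have "\<dots> \<le> integral {c..k} (\<lambda>t. h (w t)) + integral {k..d} (\<lambda>t. h (w t))"
            using join cd by (intro add_mono) auto
          also have "\<dots> = integral {c..d} (\<lambda>t. h (w t))"
            using cd join by (intro Henstock_Kurzweil_Integration.integral_combine h_int) auto
          finally show "path_len G \<kappa> N \<delta> c d \<le> integral {c..d} (\<lambda>t. h (w t))" .
        qed
      next
        case (point c)
        then show ?case by (simp add: path_len_def)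
      qed
      then show ?thesis using ab by simp
    qed
    also have "integral {a..b} (\<lambda>t. h (w t)) = (1 - \<epsilon>) * L + \<epsilon> * N x + \<epsilon> * (C * \<eta> * K)"
    proof -
      have 1: "((\<lambda>t. N (w t)) has_integral L) {a..b}"
        unfolding L_def path_len_def w_def using ab by (intro integrable_integral len_integrable[OF \<gamma>]) auto
      have 2: "((\<lambda>t. norm (m - w t)) has_integral K) {a..b}"
        unfolding K_def by (intro integrable_integral K_int)
      have 3: "((\<lambda>t. \<epsilon> * N m) has_integral (b - a) * (\<epsilon> * N m)) {a..b}"
        using has_integral_const_real[of "\<epsilon> * N m" a b] ab by simp
      have "((\<lambda>t. h (w t)) has_integral (1 - \<epsilon>) * L + (b - a) * (\<epsilon> * N m) + \<epsilon> * (C * \<eta> * K)) {a..b}"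
        unfolding h_def by (intro has_integral_add has_integral_mult_right 1 2 3)
      moreover have "(b - a) * N m = N x"
        using finsler_scale[OF finsler, of "b - a" m] ab by (simp add: m_def)
      ultimately show ?thesis by (simp add: integral_unique algebra_simps)
    qed
    \<comment> \<open>The term (1 - \<epsilon>) * L cancels and \<epsilon> divides out, so there is
      no limit in \<epsilon>: for each \<eta> one admissible \<epsilon> is enough, and only \<eta>
      tends to zero.\<close>
    finally have "\<epsilon> * L \<le> \<epsilon> * (N x + C * \<eta> * K)" by (simp add: algebra_simps)
    then show ?thesis using \<epsilon> by simp
  qed
  have "L \<le> N x + z" if z: "0 < z" for z
  proof -
    have "0 \<le> K" unfolding K_def by (intro Henstock_Kurzweil_Integration.integral_nonneg K_int) simp
    then have pos: "0 < C * (K + 1)" using C by simp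
    have "L \<le> N x + C * (z / (C * (K + 1))) * K" using z pos by (intro main) simp
    also have "C * (z / (C * (K + 1))) * K = z * (K / (K + 1))" using C by simp
    also have "\<dots> \<le> z * 1" using z \<open>0 \<le> K\<close> by (intro mult_left_mono) auto
    finally show ?thesis by simp
  qed
  then have "L \<le> N x" by (rule field_le_epsilon)
  then show ?thesis unfolding L_def x_def w_def .
qed

lemma short_path_norming:
  assumes \<gamma>: "piecewise_C1_path T A \<gamma> a b" and ab: "a \<le> b" and short: "short_path G T A \<kappa> N \<gamma> a b"
  obtains \<phi> where "unit_functional N \<phi>"
    "AE t\<in>{a..b} in lborel. \<phi> (left_velocity G \<kappa> \<gamma> t) = N (left_velocity G \<kappa> \<gamma> t)"
proof -
  let ?w = "left_velocity G \<kappa> \<gamma>"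
  define x where "x = integral {a..b} ?w"
  obtain \<phi> where \<phi>: "unit_functional N \<phi>" "\<phi> x = N x"
  proof (cases "x = 0")
    \<comment> \<open>Every unit functional vanishes at x = 0, so any one of them will do, and some
      exists because the space is not trivial.\<close>
    case True
    obtain y :: 'e where "y \<noteq> 0" using nonempty_Basis nonzero_Basis by blast
    from norming_functional[OF finsler this] obtain \<phi> where \<phi>: "unit_functional N \<phi>" by blast
    then have "\<phi> x = N x"
      using True finsler_zero[OF finsler] linear_0 unfolding unit_functional_def by fastforce
    then show thesis using that \<phi> by blast
  next
    case False
    then show thesis using norming_functional[OF finsler] that by blast
  qed
  have lin: "linear \<phi>" using \<phi> unfolding unit_functional_def by blast
  then have bl: "bounded_linear \<phi>" by (simp add: linear_conv_bounded_linear)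
  have len: "path_len G \<kappa> N \<gamma> a b \<le> N x"
  proof (cases "a = b")
    case True
    then show ?thesis by (simp add: path_len_def finsler_nonneg[OF finsler])
  next
    case False
    then show ?thesis using short_path_len_le[OF \<gamma> _ short] ab unfolding x_def by simp
  qed
  have w: "(?w has_integral x) {a..b}"
    unfolding x_def using left_velocity_integrable[OF \<gamma> order_refl ab order_refl, of "\<lambda>v. v"]
    by (intro integrable_integral) auto
  have 1: "((\<lambda>t. \<phi> (?w t)) has_integral N x) {a..b}"
    using has_integral_linear[OF w bl] \<phi>(2) by (simp add: o_def)
  have 2: "((\<lambda>t. N (?w t)) has_integral path_len G \<kappa> N \<gamma> a b) {a..b}"
    unfolding path_len_def using ab by (intro integrable_integral len_integrable[OF \<gamma>]) auto
  have I: "((\<lambda>t. N (?w t) - \<phi> (?w t)) has_integral path_len G \<kappa> N \<gamma> a b - N x) {a..b}"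
    by (rule has_integral_diff[OF 2 1])
  have nonneg: "0 \<le> N v - \<phi> v" for v using unit_functional_le[OF finsler \<phi>(1)] by simp
  have "0 \<le> path_len G \<kappa> N \<gamma> a b - N x"
    by (rule has_integral_nonneg[OF I]) (rule nonneg)
  then have "integral {a..b} (\<lambda>t. N (?w t) - \<phi> (?w t)) = 0"
    using len integral_unique[OF I] by simp
  then have "AE t\<in>{a..b} in lborel. N (?w t) - \<phi> (?w t) = 0"
    by (rule AE_eq_0_of_integral_eq_0[OF has_integral_integrable[OF I] nonneg])
  then have "AE t\<in>{a..b} in lborel. \<phi> (?w t) = N (?w t)"
    by eventually_elim auto
  then show thesis using that \<phi>(1) by blast
qed

end

section \<open>One-parameter subgroups and the exponential map\<close>

lemma frechet_derivative_cong_open: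
  assumes "open S" "x \<in> S" "\<And>y. y \<in> S \<Longrightarrow> f y = g y"
  shows "frechet_derivative f (at x) = frechet_derivative g (at x)"
    and "f differentiable (at x) \<longleftrightarrow> g differentiable (at x)"
proof -
  have "(f has_derivative D) (at x) \<longleftrightarrow> (g has_derivative D) (at x)" for D
  proof
    show "(f has_derivative D) (at x) \<Longrightarrow> (g has_derivative D) (at x)"
      by (erule has_derivative_transform_within_open[OF _ assms(1,2)]) (rule assms(3))
    show "(g has_derivative D) (at x) \<Longrightarrow> (f has_derivative D) (at x)"
      by (erule has_derivative_transform_within_open[OF _ assms(1,2)]) (rule assms(3)[symmetric])
  qed
  then show "frechet_derivative f (at x) = frechet_derivative g (at x)"
    and "f differentiable (at x) \<longleftrightarrow> g differentiable (at x)"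
    unfolding frechet_derivative_def differentiable_def by simp_all
qed

lemma Ck_on_cong_open:
  assumes "open S" "\<And>y. y \<in> S \<Longrightarrow> f y = g y"
  shows "Ck_on k f S \<longleftrightarrow> Ck_on k g S"
  using assms(2)
proof (induction k arbitrary: f g)
  case 0
  then show ?case using continuous_on_cong[of S S f g] by simp
next
  case (Suc k)
  have "Ck_on k (\<lambda>x. frechet_derivative f (at x) v) S \<longleftrightarrow> Ck_on k (\<lambda>x. frechet_derivative g (at x) v) S" for v
  proof (rule Suc.IH)
    fix y assume "y \<in> S"
    from frechet_derivative_cong_open(1)[of S y f g, OF assms(1) this Suc.prems]
    show "frechet_derivative f (at y) v = frechet_derivative g (at y) v" by simp
  qed
  moreover have "f differentiable (at x) \<longleftrightarrow> g differentiable (at x)" if "x \<in> S" for x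
    by (rule frechet_derivative_cong_open(2)[of S x f g, OF assms(1) that Suc.prems])
  ultimately show ?case by simp
qed

text \<open>Reparametrising a one-parameter subgroup must preserve its smoothness, which is part of
  \<open>one_parameter_subgroup\<close>.\<close>

lemma Ck_on_scale:
  fixes f :: "real \<Rightarrow> 'b::real_normed_vector"
  assumes "open S" "Ck_on k f S"
  shows "Ck_on k (\<lambda>t. f (c * t)) {t. c * t \<in> S}"
  using assms(2)
proof (induction k arbitrary: f)
  case 0
  then show ?case by (auto intro!: continuous_on_compose2[of S f] continuous_intros)
next
  case (Suc k)
  have op: "open {t. c * t \<in> S}"
    using open_vimage[OF assms(1), of "\<lambda>t. c * t"] by (simp add: vimage_def continuous_intros)
  have D: "((\<lambda>t. f (c * t)) has_derivative (\<lambda>v. frechet_derivative f (at (c * t)) (c * v))) (at t)"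
    if "t \<in> {t. c * t \<in> S}" for t
  proof (rule has_derivative_compose[where f="\<lambda>t. c * t" and g=f])
    show "((\<lambda>t. c * t) has_derivative (\<lambda>v. c * v)) (at t)" by (auto intro!: derivative_eq_intros)
    show "(f has_derivative frechet_derivative f (at (c * t))) (at (c * t))"
      using Ck_on_SucD(1)[OF Suc.prems] that by simp
  qed
  have "Ck_on k (\<lambda>t. frechet_derivative (\<lambda>t. f (c * t)) (at t) v) {t. c * t \<in> S}" for v
  proof -
    have "Ck_on k (\<lambda>t. frechet_derivative f (at (c * t)) (c * v)) {t. c * t \<in> S}"
      by (rule Suc.IH[OF Ck_on_SucD(2)[OF Suc.prems]])
    then show ?thesis
      by (rule Ck_on_cong_open[OF op, THEN iffD1, rotated]) (simp add: frechet_derivative_at[OF D, symmetric])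
  qed
  then show ?case using D unfolding Ck_on.simps differentiable_def by blast
qed

context based_lie_group
begin

abbreviation "OPS \<equiv> one_parameter_subgroup G T A \<kappa>"

lemma lderiv_unique:
  assumes "lderiv u L x UNIV" "lderiv u M x UNIV"
  shows "L = M"
  by (rule gderiv_unique[OF lderivD(2)[OF assms(1)] lderivD(2)[OF assms(2)]])

lemma has_velocity_unique:
  assumes "has_velocity \<gamma> v t {c..d}" "has_velocity \<gamma> w t {c..d}" "c < d" "t \<in> {c..d}"
  shows "v = w"
  using vector_derivative_within_closed_interval[OF assms(3,4) has_velocity_vector_derivative[OF assms(1)]]
    vector_derivative_within_closed_interval[OF assms(3,4) has_velocity_vector_derivative[OF assms(2)]]
  by simp

lemma OPS_limitin:
  assumes "OPS v \<theta>"
  shows "limitin T \<theta> (\<theta> t) (at t)"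
proof -
  have "continuous_map euclidean T \<theta>"
    using assms unfolding one_parameter_subgroup_def smooth_map_on_def by simp
  then have "continuous_map (top_of_set {t-1..t+1}) T \<theta>" by (rule continuous_map_from_subtopology)
  then have "limitin T \<theta> (\<theta> t) (at t within {t-1..t+1})"
    unfolding continuous_map_Icc_iff_limitin by simp
  then show ?thesis by (simp add: at_within_Icc_at)
qed

lemma OPS_props:
  assumes "OPS v \<theta>"
  shows "\<theta> t \<in> carrier G" "\<theta> 0 = \<one>" "\<theta> (s + t) = \<theta> s \<otimes> \<theta> t" "inv (\<theta> t) = \<theta> (- t)"
proof -
  have c: "\<theta> t \<in> carrier G" for t by (rule limitin_carrier[OF OPS_limitin[OF assms]])
  then show "\<theta> t \<in> carrier G" .
  have add: "\<theta> (s + t) = \<theta> s \<otimes> \<theta> t" for s t using assms unfolding one_parameter_subgroup_def by blast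
  then show "\<theta> (s + t) = \<theta> s \<otimes> \<theta> t" .
  show z: "\<theta> 0 = \<one>" using add[of 0 0] c[of 0] by (simp add: l_cancel_one)
  show "inv (\<theta> t) = \<theta> (- t)" using add[of t "- t"] add[of "- t" t] z c by (intro inv_equality) simp_all
qed

lemma OPS_gderiv_0:
  assumes "OPS v \<theta>"
  shows "gderiv \<kappa> \<theta> (\<lambda>h. h *\<^sub>R v) 0 UNIV"
  using assms OPS_limitin[OF assms, of 0] OPS_props(2)[OF assms]
  unfolding gderiv_def one_parameter_subgroup_def has_vector_derivative_def by simp

lemma OPS_velocity:
  assumes "OPS v \<theta>"
  shows "has_velocity \<theta> v t UNIV"
  unfolding lderiv_def
proof
  show "limitin T \<theta> (\<theta> t) (at t)" by (rule OPS_limitin[OF assms])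
  have "gderiv \<kappa> (\<lambda>s. \<theta> (s - t)) (\<lambda>h. h *\<^sub>R v) t UNIV"
    by (rule gderiv_compose[of "\<lambda>s. s - t" "\<lambda>h. h" t UNIV _ _ _ UNIV])
       (use OPS_gderiv_0[OF assms] in \<open>auto intro!: derivative_eq_intros\<close>)
  moreover have "\<theta> (s - t) = inv (\<theta> t) \<otimes> \<theta> s" for s
    using OPS_props(3)[OF assms, of "- t" s] OPS_props(4)[OF assms, of t] by simp
  ultimately show "gderiv \<kappa> (\<lambda>y. inv (\<theta> t) \<otimes> \<theta> y) (\<lambda>h. h *\<^sub>R v) t UNIV" by simp
qed

text \<open>Elements of a one-parameter subgroup commute, so conjugation by one of them fixes the
  curve and hence its velocity at 0.\<close>

lemma OPS_Ad:
  assumes "OPS v \<theta>"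
  shows "Ad G \<kappa> (\<theta> t) v = v"
proof -
  note p = OPS_props[OF assms]
  have "gderiv \<kappa> (\<lambda>s. \<theta> t \<otimes> \<theta> s \<otimes> inv (\<theta> t)) (\<lambda>h. Ad G \<kappa> (\<theta> t) (h *\<^sub>R v)) 0 UNIV"
    by (rule gderiv_Ad[OF p(1) OPS_gderiv_0[OF assms] p(2)]) simp
  moreover have "\<theta> t \<otimes> \<theta> s \<otimes> inv (\<theta> t) = \<theta> s" for s
    unfolding p(4) p(3)[symmetric] by simp
  ultimately have "gderiv \<kappa> \<theta> (\<lambda>h. Ad G \<kappa> (\<theta> t) (h *\<^sub>R v)) 0 UNIV" by simp
  from fun_cong[OF gderiv_unique[OF this OPS_gderiv_0[OF assms]], of 1] show ?thesis by simp
qed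

text \<open>The quotient of two such subgroups has zero velocity: by the product rule its velocity
  is \<open>Ad\<close> of an element of \<theta>' applied to v, minus v, and that difference
  vanishes.\<close>

lemma OPS_unique:
  assumes 1: "OPS v \<theta>" and 2: "OPS v \<theta>'"
  shows "\<theta> = \<theta>'"
proof
  fix t
  define \<alpha> where "\<alpha> s = \<theta> s \<otimes> \<theta>' (- s)" for s
  note p = OPS_props[OF 1] and p' = OPS_props[OF 2]
  have vel: "has_velocity \<alpha> 0 s UNIV" for s
  proof -
    have "lderiv (\<lambda>s. \<theta>' (- s)) (\<lambda>h. (- h) *\<^sub>R v) s UNIV"
      by (rule lderiv_compose[where R=UNIV, OF _ OPS_velocity[OF 2]]) (auto intro!: derivative_eq_intros)
    from lderiv_mult[OF OPS_velocity[OF 1] this]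
    have "lderiv \<alpha> (\<lambda>h. Ad G \<kappa> (inv (\<theta>' (- s))) (h *\<^sub>R v) + (- h) *\<^sub>R v) s UNIV"
      unfolding \<alpha>_def by simp
    moreover have "Ad G \<kappa> (inv (\<theta>' (- s))) (h *\<^sub>R v) = h *\<^sub>R v" for h
      using OPS_Ad[OF 2] p' by (simp add: linear_scale[OF linear_Ad])
    ultimately show ?thesis by simp
  qed
  have "\<alpha> 0 = \<alpha> t"
  proof (cases "0 \<le> t")
    case True
    then show ?thesis by (intro zero_velocity_const lderiv_subset[OF vel]) auto
  next
    case False
    then have "\<alpha> t = \<alpha> 0" by (intro zero_velocity_const lderiv_subset[OF vel]) auto
    then show ?thesis by simp
  qed
  then have "\<theta> t \<otimes> inv (\<theta>' t) = \<one>" using p p' by (simp add: \<alpha>_def)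
  then show "\<theta> t = \<theta>' t" using p(1) p'(1) by (metis inv_closed inv_equality inv_inv)
qed

lemma OPS_scale:
  assumes "OPS v \<theta>"
  shows "OPS (c *\<^sub>R v) (\<lambda>t. \<theta> (c * t))"
  unfolding one_parameter_subgroup_def
proof (intro conjI allI)
  have sm: "smooth_map_on euclidean euclidean_atlas UNIV T A \<theta>"
    using assms unfolding one_parameter_subgroup_def by blast
  then have cont: "continuous_map euclidean T \<theta>" unfolding smooth_map_on_def by simp
  show "smooth_map_on euclidean euclidean_atlas UNIV T A (\<lambda>t. \<theta> (c * t))"
    unfolding smooth_map_on_def
  proof (intro conjI ballI)
    have "continuous_map euclidean euclidean (\<lambda>t::real. c * t)" by (simp add: continuous_intros)
    from continuous_map_compose[OF this cont]
    show "continuous_map (subtopology euclidean UNIV) T (\<lambda>t. \<theta> (c * t))" by (simp add: o_def)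
    fix k d assume k: "k \<in> (euclidean_atlas :: (real, real) chart set)" and d: "d \<in> A"
    have k': "k = (UNIV, id)" using k by (simp add: euclidean_atlas_def)
    let ?S = "{t. \<theta> t \<in> chart_dom d}"
    have "smooth_on (chart_map d \<circ> \<theta> \<circ> chart_inv k) (chart_map k ` {p \<in> chart_dom k \<inter> UNIV. \<theta> p \<in> chart_dom d})"
      using sm k d unfolding smooth_map_on_def by blast
    then have S: "smooth_on (\<lambda>t. chart_map d (\<theta> t)) ?S"
      by (simp add: k' chart_inv_def o_def)
    have "openin euclidean {t \<in> topspace euclidean. \<theta> t \<in> chart_dom d}"
      by (rule openin_continuous_map_preimage[OF cont openin_chart_dom[OF d]])
    then have "open ?S" by simp
    then have "smooth_on (\<lambda>t. chart_map d (\<theta> (c * t))) {t. c * t \<in> ?S}"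
      using S Ck_on_scale[of ?S _ "\<lambda>t. chart_map d (\<theta> t)" c] unfolding smooth_on_def by blast
    then show "smooth_on (chart_map d \<circ> (\<lambda>t. \<theta> (c * t)) \<circ> chart_inv k)
       (chart_map k ` {p \<in> chart_dom k \<inter> UNIV. \<theta> (c * p) \<in> chart_dom d})"
      by (simp add: k' chart_inv_def o_def)
  qed
  show "\<theta> (c * (s + t)) = \<theta> (c * s) \<otimes> \<theta> (c * t)" for s t
    using OPS_props(3)[OF assms] by (simp add: distrib_left)
  have "gderiv \<kappa> (\<lambda>t. \<theta> (c * t)) (\<lambda>h. (c * h) *\<^sub>R v) 0 UNIV"
    by (rule gderiv_compose[of "\<lambda>t. c * t" "\<lambda>h. c * h" 0 UNIV _ _ _ UNIV])
       (use OPS_gderiv_0[OF assms] in \<open>auto intro!: derivative_eq_intros\<close>)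
  from gderivD(3)[OF this]
  show "((\<lambda>t. chart_map \<kappa> (\<theta> (c * t))) has_vector_derivative c *\<^sub>R v) (at 0)"
    by (simp add: has_vector_derivative_def mult.commute)
qed

end

section \<open>The exponential map and its left-trivialised differential\<close>

locale exp_lie_group = finsler_lie_group G T A \<kappa> N
  for G :: "('g, 'm) monoid_scheme" (structure)
    and T :: "'g topology" and A :: "('g, 'e::euclidean_space) chart set" and \<kappa> and N +
  fixes R :: real
  assumes radius: "exp_diffeo_radius G T A \<kappa> N R"
begin

abbreviation "E \<equiv> lie_exp G T A \<kappa>"
abbreviation "B \<equiv> {v. N v < R}"
abbreviation "Log \<equiv> inv_into B E"

lemma R_pos: "0 < R"
  and diffeo: "diffeomorphism_on euclidean euclidean_atlas B T A E"
  using radius unfolding exp_diffeo_radius_def by auto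

lemma inj_E: "inj_on E B"
  and open_EB: "openin T (E ` B)"
  and E_smooth: "smooth_map_on euclidean euclidean_atlas B T A E"
  and Log_smooth: "smooth_map_on T A (E ` B) euclidean euclidean_atlas Log"
  using diffeo unfolding diffeomorphism_on_def by auto

lemma open_B: "open B"
  by (rule open_finsler_ball[OF finsler])

lemma zero_in_B: "0 \<in> B"
  using R_pos finsler_zero[OF finsler] by simp

lemma Log_E: "v \<in> B \<Longrightarrow> Log (E v) = v"
  by (rule inv_into_f_f[OF inj_E])

text \<open>
  If \<open>v\<close> generates no one-parameter subgroup then neither does \<open>c v\<close> for \<open>c \<noteq> 0\<close>, and the definite
  descriptions in \<open>E v\<close> and \<open>E (v / 2)\<close> range over the same empty predicate. So injectivity of \<open>E\<close>
  near \<open>0\<close> replaces the existence theorem for differential equations.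
\<close>
lemma OPS_exists: "\<exists>\<theta>. OPS v \<theta>"
proof -
  have small: "\<exists>\<theta>. OPS v \<theta>" if v: "v \<in> B" "v \<noteq> 0" for v
  proof (rule ccontr)
    assume no: "\<nexists>\<theta>. OPS v \<theta>"
    have no2: "\<nexists>\<theta>. OPS ((1/2) *\<^sub>R v) \<theta>"
    proof
      assume "\<exists>\<theta>. OPS ((1/2) *\<^sub>R v) \<theta>"
      then obtain \<theta> where "OPS ((1/2) *\<^sub>R v) \<theta>" by blast
      from OPS_scale[OF this, of 2] show False using no by auto
    qed
    have "OPS v = (\<lambda>_. False)" "OPS ((1/2) *\<^sub>R v) = (\<lambda>_. False)" using no no2 by auto
    then have "E v = E ((1/2) *\<^sub>R v)" unfolding lie_exp_def by simp
    moreover have "(1/2) *\<^sub>R v \<in> B"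
      using v finsler_nonneg[OF finsler, of v] by (simp add: finsler_scale[OF finsler])
    ultimately have "v = (1/2) *\<^sub>R v" using inj_onD[OF inj_E] v by blast
    from arg_cong[OF this, of norm] show False using v by simp
  qed
  \<comment> \<open>A nonzero vector is rescaled into the ball; if v = 0, any nonzero w serves and
    the factor 0 recovers v.\<close>
  obtain w :: 'e where w: "w \<noteq> 0" "v = 0 \<or> w = v"
    by (cases "v = 0") (use nonempty_Basis nonzero_Basis in blast)+
  have Nw: "N w > 0" by (rule finsler_pos[OF finsler w(1)])
  define r where "r = R / (2 * N w)"
  have r: "r > 0" using R_pos Nw by (simp add: r_def)
  have "N (r *\<^sub>R w) = R / 2" using r Nw by (simp add: finsler_scale[OF finsler]) (simp add: r_def)
  then have "r *\<^sub>R w \<in> B" using R_pos by simp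
  then obtain \<theta> where \<theta>: "OPS (r *\<^sub>R w) \<theta>" using small w r by fastforce
  have "v = (if v = 0 then 0 else 1 / r) *\<^sub>R (r *\<^sub>R w)" using w r by auto
  then show ?thesis using OPS_scale[OF \<theta>] by metis
qed

text \<open>Existence and uniqueness make the definite description in \<open>lie_exp\<close>
  meaningful, and rescaling the parameter identifies E on the line through v.\<close>

lemma OPS_E: "OPS v (\<lambda>s. E (s *\<^sub>R v))"
proof -
  obtain \<theta> where \<theta>: "OPS v \<theta>" using OPS_exists by blast
  have "E (s *\<^sub>R v) = \<theta> s" for s
  proof -
    have "(THE \<theta>'. OPS (s *\<^sub>R v) \<theta>') = (\<lambda>t. \<theta> (s * t))"
      by (rule the_equality[where P="OPS (s *\<^sub>R v)"]) (intro OPS_scale \<theta> OPS_unique[OF _ OPS_scale[OF \<theta>]])+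
    then show ?thesis unfolding lie_exp_def by simp
  qed
  then show ?thesis using \<theta> by simp
qed

lemma E_carrier: "E v \<in> carrier G"
  using OPS_props(1)[OF OPS_E[of v], of 1] by simp

lemma E_zero: "E 0 = \<one>"
  using OPS_props(2)[OF OPS_E[of 0]] by simp

lemma E_add: "E ((s + t) *\<^sub>R v) = E (s *\<^sub>R v) \<otimes> E (t *\<^sub>R v)"
  by (rule OPS_props(3)[OF OPS_E])

lemma limitin_E:
  assumes X: "(X \<longlongrightarrow> x) F" and x: "x \<in> B"
  shows "limitin T (\<lambda>i. E (X i)) (E x) F"
  unfolding limitin_def
proof (intro conjI allI impI)
  show "E x \<in> topspace T" using E_carrier topspace_eq_carrier by simp
  fix U assume U: "openin T U \<and> E x \<in> U"
  have "continuous_map (top_of_set B) T E" using E_smooth unfolding smooth_map_on_def by blast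
  then have "openin (top_of_set B) {v \<in> topspace (top_of_set B). E v \<in> U}"
    using U by (intro openin_continuous_map_preimage) auto
  then have "open {v \<in> B. E v \<in> U}" using openin_open_trans[OF _ open_B] by simp
  then have "\<forall>\<^sub>F i in F. X i \<in> {v \<in> B. E v \<in> U}"
    using X U x by (intro topological_tendstoD[of X x]) auto
  then show "\<forall>\<^sub>F i in F. E (X i) \<in> U" by eventually_elim simp
qed

lemma limitin_Log:
  assumes u: "limitin T u g F" and g: "g \<in> E ` B"
  shows "((\<lambda>i. Log (u i)) \<longlongrightarrow> Log g) F"
proof (rule topological_tendstoI)
  fix U :: "'e set" assume U: "open U" "Log g \<in> U"
  have "continuous_map (subtopology T (E ` B)) euclidean Log"
    using Log_smooth unfolding smooth_map_on_def by blast
  then have "openin (subtopology T (E ` B)) {h \<in> topspace (subtopology T (E ` B)). Log h \<in> U}"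
    using U by (intro openin_continuous_map_preimage) auto
  then have "openin T {h \<in> topspace (subtopology T (E ` B)). Log h \<in> U}"
    by (rule openin_trans_full) (rule open_EB)
  moreover have "g \<in> {h \<in> topspace (subtopology T (E ` B)). Log h \<in> U}"
    using g U openin_subset[OF open_EB] by auto
  ultimately have "\<forall>\<^sub>F i in F. u i \<in> {h \<in> topspace (subtopology T (E ` B)). Log h \<in> U}"
    using limitinD[OF u] by blast
  then show "\<forall>\<^sub>F i in F. Log (u i) \<in> U" by eventually_elim simp
qed

lemma E_chart:
  assumes c: "c \<in> A"
  shows "smooth_on (\<lambda>v. chart_map c (E v)) {v \<in> B. E v \<in> chart_dom c}"
    and "open {v \<in> B. E v \<in> chart_dom c}"
proof -
  have "(UNIV, id) \<in> (euclidean_atlas :: ('e, 'e) chart set)" by (simp add: euclidean_atlas_def)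
  then have "smooth_on (chart_map c \<circ> E \<circ> chart_inv (UNIV, id))
      (chart_map (UNIV, id) ` {p \<in> chart_dom (UNIV, id) \<inter> B. E p \<in> chart_dom c})"
    using E_smooth c unfolding smooth_map_on_def by blast
  then show "smooth_on (\<lambda>v. chart_map c (E v)) {v \<in> B. E v \<in> chart_dom c}"
    by (simp add: chart_inv_def o_def)
  have "continuous_map (top_of_set B) T E" using E_smooth unfolding smooth_map_on_def by blast
  then have "openin (top_of_set B) {v \<in> topspace (top_of_set B). E v \<in> chart_dom c}"
    by (rule openin_continuous_map_preimage[OF _ openin_chart_dom[OF c]])
  then show "open {v \<in> B. E v \<in> chart_dom c}" using openin_open_trans[OF _ open_B] by simp
qed

lemma gderiv_E:
  assumes c: "c \<in> A" and v: "v \<in> B" "E v \<in> chart_dom c"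
  shows "gderiv c E (frechet_derivative (\<lambda>v. chart_map c (E v)) (at v)) v UNIV"
  unfolding gderiv_def
  using limitin_E[OF tendsto_ident_at v(1)] v smooth_on_has_derivative[OF E_chart(1)[OF c]] by simp

text \<open>The differential of E at v followed by left translation back to \<one>. Choice is
  harmless: at points of \<open>B\<close> the logarithmic derivative exists and is unique.\<close>

definition dE :: "'e \<Rightarrow> 'e \<Rightarrow> 'e" where
  "dE v = (SOME L. lderiv E L v UNIV)"

lemma lderiv_E:
  assumes v: "v \<in> B"
  shows "lderiv E (dE v) v UNIV"
proof -
  obtain c where c: "c \<in> A" "E v \<in> chart_dom c" using chart_at_carrier[OF E_carrier] by blast
  obtain d where d: "d \<in> A" "inv (E v) \<in> chart_dom d"
    using chart_at_carrier[of "inv (E v)"] E_carrier by blast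
  have "\<exists>L. lderiv E L v UNIV"
    using gderiv_imp_lderiv[OF c(1) d(1) gderiv_E[OF c(1) v c(2)] d(2)] by blast
  then show ?thesis unfolding dE_def by (rule someI_ex)
qed

lemma linear_dE: "v \<in> B \<Longrightarrow> linear (dE v)"
  by (rule lderivD(4)[OF lderiv_E])

lemma lderiv_E_scale:
  assumes "s *\<^sub>R x \<in> B"
  shows "lderiv (\<lambda>y. E (s *\<^sub>R y)) (\<lambda>z. s *\<^sub>R dE (s *\<^sub>R x) z) x UNIV"
proof -
  have "lderiv (\<lambda>y. E (s *\<^sub>R y)) (\<lambda>z. dE (s *\<^sub>R x) (s *\<^sub>R z)) x UNIV"
    by (rule lderiv_compose[where f="\<lambda>y. s *\<^sub>R y" and R=UNIV, OF _ lderiv_E[OF assms]])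
       (auto intro!: derivative_eq_intros)
  then show ?thesis by (simp add: linear_scale[OF linear_dE[OF assms]])
qed

text \<open>The curve of multiples of x is sent to a one-parameter subgroup, whose velocity is x at
  all times, including s = 0.\<close>

lemma dE_radial:
  assumes "s *\<^sub>R x \<in> B"
  shows "dE (s *\<^sub>R x) x = x"
proof -
  have "lderiv (\<lambda>t. E (t *\<^sub>R x)) (\<lambda>h. dE (s *\<^sub>R x) (h *\<^sub>R x)) s UNIV"
    by (rule lderiv_compose[where f="\<lambda>t. t *\<^sub>R x" and R=UNIV, OF _ lderiv_E[OF assms]])
       (auto intro!: derivative_eq_intros)
  from fun_cong[OF lderiv_unique[OF this OPS_velocity[OF OPS_E]], of 1] show ?thesis by simp
qed

lemma dE_cocycle:
  assumes B: "s *\<^sub>R x \<in> B" "t *\<^sub>R x \<in> B" "(s + t) *\<^sub>R x \<in> B"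
  shows "(s + t) *\<^sub>R dE ((s + t) *\<^sub>R x) z
     = Ad G \<kappa> (inv (E (t *\<^sub>R x))) (s *\<^sub>R dE (s *\<^sub>R x) z) + t *\<^sub>R dE (t *\<^sub>R x) z"
proof -
  have "lderiv (\<lambda>y. E (s *\<^sub>R y) \<otimes> E (t *\<^sub>R y))
      (\<lambda>z. Ad G \<kappa> (inv (E (t *\<^sub>R x))) (s *\<^sub>R dE (s *\<^sub>R x) z) + t *\<^sub>R dE (t *\<^sub>R x) z) x UNIV"
    by (rule lderiv_mult[OF lderiv_E_scale[OF B(1)] lderiv_E_scale[OF B(2)]]) simp
  then have "lderiv (\<lambda>y. E ((s + t) *\<^sub>R y))
      (\<lambda>z. Ad G \<kappa> (inv (E (t *\<^sub>R x))) (s *\<^sub>R dE (s *\<^sub>R x) z) + t *\<^sub>R dE (t *\<^sub>R x) z) x UNIV"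
    by (simp only: E_add)
  from fun_cong[OF lderiv_unique[OF lderiv_E_scale[OF B(3)] this], of z] show ?thesis .
qed

text \<open>Smoothness of E gives continuity at 0, and the radial identity at s = 0 identifies
  \<open>dE 0\<close> as the identity without a power series.\<close>

lemma tendsto_dE:
  assumes X: "(X \<longlongrightarrow> 0) F"
  shows "((\<lambda>i. dE (X i) z) \<longlongrightarrow> z) F"
proof -
  define S where "S = {v \<in> B. E v \<in> chart_dom \<kappa>}"
  define D where "D v = frechet_derivative (\<lambda>v. chart_map \<kappa> (E v)) (at v)" for v
  have S: "open S" "smooth_on (\<lambda>v. chart_map \<kappa> (E v)) S"
    using E_chart[OF \<kappa>_in_A] unfolding S_def by auto
  have 0: "0 \<in> S" using zero_in_B E_zero by (simp add: S_def)
  have eq: "dE v z = dlog (chart_map \<kappa> (E v)) (D v z)" if v: "v \<in> S" "near_one (chart_map \<kappa> (E v))" for v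
  proof -
    have "gderiv \<kappa> E (D v) v UNIV" unfolding D_def by (rule gderiv_E) (use v in \<open>auto simp: S_def\<close>)
    from lderiv_chart_curve[OF this v(2)]
    have "lderiv E (\<lambda>h. dlog (chart_map \<kappa> (E v)) (D v h)) v UNIV" by simp
    from fun_cong[OF lderiv_unique[OF lderiv_E this], of z] v show ?thesis by (simp add: S_def)
  qed
  have "limitin T (\<lambda>i. E (X i)) \<one> F" using limitin_E[OF X zero_in_B] E_zero by simp
  then have lim: "((\<lambda>i. chart_map \<kappa> (E (X i))) \<longlongrightarrow> e) F"
    by (simp add: limitin_chart[OF \<kappa>_in_A one_in_\<kappa>])
  have "((\<lambda>i. D (X i) z) \<longlongrightarrow> D 0 z) F"
    unfolding D_def by (rule smooth_on_tendsto_derivative[OF S(2,1) 0 X tendsto_const])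
  from tendsto_dlog[OF near_one_e lim this]
  have "((\<lambda>i. dlog (chart_map \<kappa> (E (X i))) (D (X i) z)) \<longlongrightarrow> D 0 z) F" by (simp add: dlog_e)
  moreover have "\<forall>\<^sub>F i in F. dlog (chart_map \<kappa> (E (X i))) (D (X i) z) = dE (X i) z"
    using topological_tendstoD[OF X S(1) 0] eventually_compose_filterlim[OF eventually_near_one lim]
    by eventually_elim (use eq in simp)
  ultimately have "((\<lambda>i. dE (X i) z) \<longlongrightarrow> D 0 z) F" by (rule Lim_transform_eventually)
  moreover have "D 0 z = z"
    using eq[OF 0] near_one_e E_zero dE_radial[of 0 z] zero_in_B by (simp add: dlog_e)
  ultimately show ?thesis by simp
qed

lemma scale_in_B: "x \<in> B \<Longrightarrow> 0 \<le> s \<Longrightarrow> s \<le> 1 \<Longrightarrow> s *\<^sub>R x \<in> B"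
  using mult_right_mono[of s 1 "N x"] finsler_nonneg[OF finsler, of x]
  by (simp add: finsler_scale[OF finsler])

text \<open>\<open>W k\<close> is the cocycle sampled at k / n. Each step applies the same
  \<open>Ad\<close> and adds the same increment, a discrete form of the integral of
  \<open>Ad (exp (s x))\<^sup>-\<^sup>1 z\<close> over s from 0 to 1, which represents
  \<open>dE x z\<close>.\<close>

lemma dE_steps:
  fixes z :: 'e
  assumes x: "x \<in> B" and n: "0 < n"
  defines "W \<equiv> \<lambda>k. (real k / real n) *\<^sub>R dE ((real k / real n) *\<^sub>R x) z"
  shows "k < n \<Longrightarrow> W (Suc k) = Ad G \<kappa> (inv (E ((1 / real n) *\<^sub>R x))) (W k) + W 1"
    and "W n = dE x z" and "W 0 = 0"
    and "W 1 = (1 / real n) *\<^sub>R dE ((1 / real n) *\<^sub>R x) z"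
proof -
  show "W (Suc k) = Ad G \<kappa> (inv (E ((1 / real n) *\<^sub>R x))) (W k) + W 1" if k: "k < n"
  proof -
    have eq: "real (Suc k) / real n = real k / real n + 1 / real n" by (simp add: add_divide_distrib)
    have "(real k / real n) *\<^sub>R x \<in> B" "(1 / real n) *\<^sub>R x \<in> B" "(real k / real n + 1 / real n) *\<^sub>R x \<in> B"
      using k n scale_in_B[OF x, of "real k / real n"] scale_in_B[OF x, of "1 / real n"]
        scale_in_B[OF x, of "real k / real n + 1 / real n"]
      by (simp_all flip: add_divide_distrib)
    from dE_cocycle[OF this, of z] show ?thesis unfolding W_def eq by simp
  qed
qed (use n in \<open>simp_all add: W_def\<close>)

lemma dE_limit:
  "(\<lambda>n. dE ((1 / real (Suc n)) *\<^sub>R x) z) \<longlonglongrightarrow> z"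
proof (rule tendsto_dE)
  have "(\<lambda>n. (1 / real (Suc n)) *\<^sub>R x) \<longlonglongrightarrow> 0 *\<^sub>R x"
    by (intro tendsto_scaleR lim_1_over_n[THEN LIMSEQ_Suc] tendsto_const)
  then show "(\<lambda>n. (1 / real (Suc n)) *\<^sub>R x) \<longlonglongrightarrow> 0" by simp
qed

text \<open>By invariance of \<open>N\<close> under \<open>Ad\<close>, n equal steps add at most n
  times the norm of the first. This bounds \<open>N (dE x z)\<close> by the value at x / n, which
  tends to \<open>N z\<close>.\<close>

lemma N_dE_le:
  assumes x: "x \<in> B"
  shows "N (dE x z) \<le> N z"
proof -
  have "N (dE x z) \<le> N (dE ((1 / real (Suc m)) *\<^sub>R x) z)" for m
  proof -
    define n where "n = Suc m"
    have n: "0 < n" by (simp add: n_def)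
    define W where "W k = (real k / real n) *\<^sub>R dE ((real k / real n) *\<^sub>R x) z" for k
    note W = dE_steps[where z=z, OF x n, folded W_def]
    have "k \<le> n \<Longrightarrow> N (W k) \<le> real k * N (W 1)" for k
    proof (induction k)
      case 0
      show ?case using W(3) finsler_zero[OF finsler] by simp
    next
      case (Suc k)
      have "N (W (Suc k)) \<le> N (Ad G \<kappa> (inv (E ((1 / real n) *\<^sub>R x))) (W k)) + N (W 1)"
        using W(1)[of k] Suc.prems finsler_triangle[OF finsler] by simp
      also have "N (Ad G \<kappa> (inv (E ((1 / real n) *\<^sub>R x))) (W k)) = N (W k)"
        by (rule N_Ad) (simp add: E_carrier)
      finally show ?case using Suc by (simp add: algebra_simps)
    qed
    from this[of n] have "N (dE x z) \<le> real n * N (W 1)" using W(2) by simp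
    also have "\<dots> = N (dE ((1 / real n) *\<^sub>R x) z)"
      using n W(4) by (simp add: finsler_scale[OF finsler])
    finally show ?thesis unfolding n_def .
  qed
  then show ?thesis
    by (intro tendsto_lowerbound[OF tendsto_finsler[OF finsler dE_limit[of x z]] always_eventually] allI) simp_all
qed

text \<open>The same n steps, now with equality: an invariant functional takes the same value at x
  as at x / n.\<close>

lemma functional_dE:
  assumes x: "x \<in> B" and \<phi>: "linear \<phi>"
    and inv: "\<And>s z. 0 \<le> s \<Longrightarrow> s \<le> 1 \<Longrightarrow> \<phi> (Ad G \<kappa> (inv (E (s *\<^sub>R x))) z) = (\<phi> z :: real)"
  shows "\<phi> (dE x z) = \<phi> z"
proof -
  have step: "\<phi> (dE x z) = \<phi> (dE ((1 / real (Suc m)) *\<^sub>R x) z)" for m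
  proof -
    define n where "n = Suc m"
    have n: "0 < n" by (simp add: n_def)
    define W where "W k = (real k / real n) *\<^sub>R dE ((real k / real n) *\<^sub>R x) z" for k
    note W = dE_steps[where z=z, OF x n, folded W_def]
    have "k \<le> n \<Longrightarrow> \<phi> (W k) = real k * \<phi> (W 1)" for k
    proof (induction k)
      case 0
      show ?case using W(3) linear_0[OF \<phi>] by simp
    next
      case (Suc k)
      have "\<phi> (W (Suc k)) = \<phi> (Ad G \<kappa> (inv (E ((1 / real n) *\<^sub>R x))) (W k)) + \<phi> (W 1)"
        using W(1)[of k] Suc.prems linear_add[OF \<phi>] by simp
      also have "\<phi> (Ad G \<kappa> (inv (E ((1 / real n) *\<^sub>R x))) (W k)) = \<phi> (W k)"
        by (rule inv) (use n in auto)
      finally show ?case using Suc by (simp add: algebra_simps)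
    qed
    from this[of n] have "\<phi> (dE x z) = real n * \<phi> (W 1)" using W(2) by simp
    also have "\<dots> = \<phi> (dE ((1 / real n) *\<^sub>R x) z)"
      using n W(4) by (simp add: linear_scale[OF \<phi>])
    finally show ?thesis unfolding n_def .
  qed
  have "(\<lambda>n. \<phi> (dE ((1 / real (Suc n)) *\<^sub>R x) z)) \<longlonglongrightarrow> \<phi> z"
    by (rule bounded_linear.tendsto[OF _ dE_limit]) (use \<phi> in \<open>simp add: linear_conv_bounded_linear\<close>)
  then show ?thesis unfolding step[symmetric] by (simp add: LIMSEQ_const_iff)
qed

text \<open>Log is smooth on the open image of the ball, so \<open>Log (\<gamma> s)\<close> has some
  derivative z; the chain rule for E after Log then gives w as the image of z under
  \<open>dE\<close>.\<close>

lemma Log_velocity: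
  assumes vel: "has_velocity \<gamma> w t {c..d}" and cd: "c < d" "t \<in> {c..d}" and \<gamma>: "\<gamma> t \<in> E ` B"
  obtains z where "((\<lambda>s. Log (\<gamma> s)) has_vector_derivative z) (at t within {c..d})" "dE (Log (\<gamma> t)) z = w"
proof -
  obtain k where k: "k \<in> A" "\<gamma> t \<in> chart_dom k" using chart_at_carrier[OF lderivD(3)[OF vel]] by blast
  note g = lderiv_imp_gderiv[OF k(1) vel k(2) cd(2)]
  let ?F = "chart_expr k (UNIV, id) Log"
  have "(UNIV, id) \<in> (euclidean_atlas :: ('e, 'e) chart set)" by (simp add: euclidean_atlas_def)
  from smooth_map_expr[OF Log_smooth open_EB k(1) this]
  have "smooth_on ?F (chart_map k ` {p \<in> chart_dom k \<inter> E ` B. Log p \<in> chart_dom (UNIV, id)})" by simp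
  from smooth_on_has_derivative[OF this, of "chart_map k (\<gamma> t)"]
  have "(?F has_derivative frechet_derivative ?F (at (chart_map k (\<gamma> t)))) (at (chart_map k (\<gamma> t)))"
    using k \<gamma> by simp
  from has_derivative_compose[OF gderivD(3)[OF g] this]
  obtain Z where Z: "((\<lambda>s. ?F (chart_map k (\<gamma> s))) has_derivative Z) (at t within {c..d})" by blast
  have LZ: "((\<lambda>s. Log (\<gamma> s)) has_derivative Z) (at t within {c..d})"
  proof (rule has_derivative_transform_eventually[OF Z])
    show "\<forall>\<^sub>F s in at t within {c..d}. ?F (chart_map k (\<gamma> s)) = Log (\<gamma> s)"
      using gderiv_eventually[OF g k(1)] by eventually_elim (simp add: chart_expr_chart_map[OF k(1)])
    show "?F (chart_map k (\<gamma> t)) = Log (\<gamma> t)" by (simp add: chart_expr_chart_map[OF k])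
  qed (rule cd)
  obtain z where z: "Z = (\<lambda>h. h *\<^sub>R z)"
  proof
    show "Z = (\<lambda>h. h *\<^sub>R Z 1)"
    proof
      show "Z h = h *\<^sub>R Z 1" for h using linear_scale[OF has_derivative_linear[OF Z], of h 1] by simp
    qed
  qed
  have L: "((\<lambda>s. Log (\<gamma> s)) has_derivative (\<lambda>h. h *\<^sub>R z)) (at t within {c..d})" using LZ unfolding z .
  have x: "Log (\<gamma> t) \<in> B" using \<gamma> by (rule inv_into_into)
  have "lderiv (\<lambda>s. E (Log (\<gamma> s))) (\<lambda>h. dE (Log (\<gamma> t)) (h *\<^sub>R z)) t {c..d}"
    by (rule lderiv_compose[OF L lderiv_E[OF x]]) simp
  then have "has_velocity (\<lambda>s. E (Log (\<gamma> s))) (dE (Log (\<gamma> t)) z) t {c..d}"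
    by (simp only: linear_scale[OF linear_dE[OF x]])
  then have "has_velocity \<gamma> (dE (Log (\<gamma> t)) (z)) t {c..d}"
  proof (rule lderiv_transform)
    have "\<forall>\<^sub>F s in at t within {c..d}. \<gamma> s \<in> E ` B" by (rule limitinD[OF lderivD(1)[OF vel] open_EB \<gamma>])
    then show "\<forall>\<^sub>F s in at t within {c..d}. E (Log (\<gamma> s)) = \<gamma> s"
      by eventually_elim (rule f_inv_into_f)
    show "E (Log (\<gamma> t)) = \<gamma> t" by (rule f_inv_into_f[OF \<gamma>])
  qed (rule cd)
  then have "dE (Log (\<gamma> t)) (z) = w" by (rule has_velocity_unique[OF _ vel cd])
  then show thesis using that[of "z"] L by (simp add: has_vector_derivative_def)
qed

text \<open>The curve \<open>E x \<otimes> E (s w)\<close> has velocity w at s = 0 and starts in the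
  open image of the ball; the derivative of its logarithm there is a preimage of w.\<close>

lemma dE_surj:
  assumes x: "x \<in> B"
  obtains z where "dE x z = w"
proof -
  define \<gamma> where "\<gamma> s = E x \<otimes> E (s *\<^sub>R w)" for s :: real
  have vel: "has_velocity \<gamma> w 0 {0..1}"
    unfolding \<gamma>_def
    by (rule lderiv_left_mult[OF lderiv_subset[OF OPS_velocity[OF OPS_E]] E_carrier]) auto
  have \<gamma>0: "\<gamma> 0 = E x" by (simp add: \<gamma>_def E_zero E_carrier)
  have "\<gamma> 0 \<in> E ` B" unfolding \<gamma>0 using x by (rule imageI)
  from Log_velocity[OF vel zero_less_one _ this] obtain z where "dE (Log (\<gamma> 0)) z = w"
    by (metis atLeastAtMost_iff order_refl zero_le_one)
  then show thesis using that by (simp add: \<gamma>0 Log_E[OF x])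
qed

text \<open>
  The cocycle identity for \<open>1 = (1 - s) + s\<close> read in both orders gives
  \<open>(1 - A\<^sub>s) dE\<^sub>x = (1 - A\<^sub>1) (s dE\<^sub>s\<^sub>x)\<close> with \<open>A\<^sub>s = Ad (E (s x))\<^sup>-\<^sup>1\<close>.
\<close>
lemma functional_Ad_E_invariant:
  assumes x: "x \<in> B" and \<phi>: "linear \<phi>" and inv1: "\<And>z. \<phi> (Ad G \<kappa> (inv (E x)) z) = (\<phi> z :: real)"
    and s: "0 \<le> s" "s \<le> 1"
  shows "\<phi> (Ad G \<kappa> (inv (E (s *\<^sub>R x))) w) = \<phi> w"
proof -
  \<comment> \<open>Surjectivity converts a statement about the image of \<open>dE x\<close> into
    one about every w.\<close>
  obtain z where z: "dE x z = w" by (rule dE_surj[OF x])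
  define A where "A s = Ad G \<kappa> (inv (E (s *\<^sub>R x)))" for s
  define W where "W s = s *\<^sub>R dE (s *\<^sub>R x) z" for s
  have lin: "linear (A s)" for s unfolding A_def by (intro linear_Ad inv_closed E_carrier)
  have sB: "s *\<^sub>R x \<in> B" "(1 - s) *\<^sub>R x \<in> B" using s by (intro scale_in_B x; simp)+
  have W1: "W 1 = w" using z by (simp add: W_def)
  have c1: "W 1 = A s (W (1 - s)) + W s"
    using dE_cocycle[OF sB(2,1)] x by (simp add: W_def A_def)
  have c2: "W 1 = A (1 - s) (W s) + W (1 - s)"
    using dE_cocycle[OF sB] x by (simp add: W_def A_def)
  have "A s (A (1 - s) v) = A 1 v" for v
  proof -
    have "inv (E (s *\<^sub>R x)) \<otimes> inv (E ((1 - s) *\<^sub>R x)) = inv (E (((1 - s) + s) *\<^sub>R x))"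
      unfolding E_add by (rule inv_mult_group[symmetric]) (rule E_carrier)+
    then show ?thesis
      unfolding A_def by (subst Ad_mult[symmetric]) (simp_all add: E_carrier)
  qed
  then have "A s (W 1) = A 1 (W s) + A s (W (1 - s))"
    using arg_cong[OF c2, of "A s"] by (simp add: linear_add[OF lin])
  then have "A s w = A 1 (W s) + (w - W s)" using c1 W1 by simp
  then have "\<phi> (A s w) = \<phi> (A 1 (W s)) + (\<phi> w - \<phi> (W s))"
    by (simp add: linear_add[OF \<phi>] linear_diff[OF \<phi>])
  moreover have "\<phi> (A 1 (W s)) = \<phi> (W s)" using inv1 by (simp add: A_def)
  ultimately show ?thesis unfolding A_def by simp
qed

end

section \<open>The Gauss lemma and short paths\<close>

lemma has_vector_derivative_eventually_le:
  assumes "(f has_vector_derivative z) (at x within S)" "0 < \<eta>"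
  shows "\<forall>\<^sub>F y in at x within S. norm (f y - f x - (y - x) *\<^sub>R z) \<le> \<eta> * \<bar>y - x\<bar>"
  using assms unfolding has_vector_derivative_def has_derivative_within_alt2 by simp

lemma AE_zero_continuous_imp_zero:
  fixes f :: "real \<Rightarrow> real"
  assumes f: "continuous_on {c..d} f" "\<And>t. t \<in> {c..d} \<Longrightarrow> 0 \<le> f t" and cd: "c < d"
    and AE: "AE t in lborel. t \<in> {c<..<d} \<longrightarrow> f t = 0" and t: "t \<in> {c..d}"
  shows "f t = 0"
proof -
  obtain S where S: "{t \<in> space lborel. \<not> (t \<in> {c<..<d} \<longrightarrow> f t = 0)} \<subseteq> S"
      "emeasure lborel S = 0" "S \<in> sets lborel"
    using AE_E[OF AE] by blast
  then have "S \<in> null_sets lborel" by (simp add: null_setsI)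
  then have "negligible S" by (simp add: negligible_iff_null_sets null_sets_completionI)
  then have "negligible (S \<union> {c, d})" by (simp add: negligible_Un)
  then have "integral {c..d} f = integral {c..d} (\<lambda>_. 0)"
  proof (rule integral_spike)
    fix x assume x: "x \<in> {c..d} - (S \<union> {c, d})"
    then have "x \<in> {c<..<d}" "x \<notin> S" by auto
    then have "f x = 0" using S(1) by fastforce
    then show "0 = f x" by simp
  qed
  then have "integral {c..d} f = 0" by simp
  then show ?thesis using integral_eq_0_iff[OF f(1) cd f(2)] t by blast
qed

context exp_lie_group
begin

text \<open>The distance from \<open>\<one>\<close>, truncated at a radius \<open>r < R\<close> so that it is continuous everywhere.\<close>
definition radial :: "real \<Rightarrow> 'g \<Rightarrow> real" where
  "radial r g = (if g \<in> E ` B then min r (N (Log g)) else r)"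

lemma radial_le: "radial r g \<le> r"
  by (simp add: radial_def)

lemma E_Log: "g \<in> E ` B \<Longrightarrow> E (Log g) = g"
  by (rule f_inv_into_f)

lemma Log_in_B: "g \<in> E ` B \<Longrightarrow> N (Log g) < R"
  using inv_into_into[of g E B] by simp

lemma not_in_E_ball:
  assumes "g \<in> E ` B" "g \<notin> E ` {v. N v \<le> a}"
  shows "a < N (Log g)"
proof (rule ccontr)
  assume "\<not> a < N (Log g)"
  then have "E (Log g) \<in> E ` {v. N v \<le> a}" by (intro imageI) simp
  then show False using assms by (simp add: E_Log)
qed

text \<open>A closed ball of radius below \<open>R\<close> is compact inside \<open>B\<close>, so
  its image is compact in a Hausdorff space. This prevents points outside the image of
  \<open>B\<close> from approaching the region where the truncated distance is small.\<close>

lemma closedin_E_ball: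
  assumes "a < R"
  shows "closedin T (E ` {v. N v \<le> a})"
proof -
  have "compactin (top_of_set B) {v. N v \<le> a}"
    using compact_finsler_ball[OF finsler, of a] assms by (auto simp: compactin_subtopology)
  moreover have "continuous_map (top_of_set B) T E" using E_smooth unfolding smooth_map_on_def by blast
  ultimately have "compactin T (E ` {v. N v \<le> a})" by (rule image_compactin)
  then show ?thesis by (rule compactin_imp_closedin[OF Hausdorff])
qed

lemma eventually_not_in_E_ball:
  assumes a: "a < R" and u: "limitin T u g F" and g: "g \<notin> E ` {v. N v \<le> a}"
  shows "\<forall>\<^sub>F i in F. u i \<notin> E ` {v. N v \<le> a}"
proof -
  have "\<forall>\<^sub>F i in F. u i \<in> topspace T - E ` {v. N v \<le> a}"
    using g limitin_topspace[OF u] closedin_E_ball[OF a] by (intro limitinD[OF u]) auto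
  then show ?thesis by eventually_elim simp
qed

text \<open>Lower bounds come from closedness of the images of smaller balls; upper bounds come from
  openness of the image of \<open>B\<close> and continuity of Log on it.\<close>

lemma tendsto_radial:
  assumes r: "r < R" and u: "limitin T u g F"
  shows "((\<lambda>i. radial r (u i)) \<longlongrightarrow> radial r g) F"
proof (rule order_tendstoI)
  fix a assume a: "a < radial r g"
  then have ar: "a < r" using radial_le[of r g] by simp
  have "g \<notin> E ` {v. N v \<le> a}"
  proof
    assume "g \<in> E ` {v. N v \<le> a}"
    then obtain v where v: "g = E v" "N v \<le> a" by blast
    then have "v \<in> B" using ar r by simp
    then show False using a v by (simp add: radial_def Log_E)
  qed
  then have "\<forall>\<^sub>F i in F. u i \<notin> E ` {v. N v \<le> a}"
    using ar r by (intro eventually_not_in_E_ball[OF _ u]) simp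
  then show "\<forall>\<^sub>F i in F. a < radial r (u i)"
  proof eventually_elim
    case (elim i)
    show ?case
    proof (cases "u i \<in> E ` B")
      case True
      from not_in_E_ball[OF this elim] show ?thesis using True ar by (simp add: radial_def)
    next
      case False
      then show ?thesis using ar by (simp add: radial_def)
    qed
  qed
next
  fix a assume a: "radial r g < a"
  show "\<forall>\<^sub>F i in F. radial r (u i) < a"
  proof (cases "r < a")
    case True
    have "radial r (u i) < a" for i using radial_le[of r "u i"] True by simp
    then show ?thesis by simp
  next
    case False
    then have g: "g \<in> E ` B" and Ng: "N (Log g) < a"
      using a unfolding radial_def by (auto split: if_splits)
    have "((\<lambda>i. N (Log (u i))) \<longlongrightarrow> N (Log g)) F"
      by (rule tendsto_finsler[OF finsler limitin_Log[OF u g]])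
    then have "\<forall>\<^sub>F i in F. N (Log (u i)) < a" using Ng by (rule order_tendstoD(2))
    moreover have "\<forall>\<^sub>F i in F. u i \<in> E ` B" by (rule limitinD[OF u open_EB g])
    ultimately show ?thesis by eventually_elim (simp add: radial_def)
  qed
qed

text \<open>
  Gauss lemma, as a bound on left slopes: \<open>D = dE x\<close> is nonexpansive and fixes \<open>x\<close>, hence
  \<open>N x \<le> N (x + h (D z - z))\<close>, which compares \<open>N (x - h z)\<close> with \<open>N x - h N (D z)\<close>.
\<close>
lemma radial_le_length:
  assumes r: "0 \<le> r" "r < R" and cd: "c \<le> d"
    and vel: "\<And>t. t \<in> {c..d} \<Longrightarrow> has_velocity \<gamma> (W t) t {c..d}" and W: "continuous_on {c..d} W"
  shows "radial r (\<gamma> d) - radial r (\<gamma> c) \<le> integral {c..d} (\<lambda>t. N (W t))"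
proof -
  define L where "L t = integral {c..t} (\<lambda>t. N (W t))" for t
  have NW: "continuous_on {c..d} (\<lambda>t. N (W t))"
    by (rule continuous_on_compose2[OF continuous_on_finsler[OF finsler, of UNIV] W]) simp
  obtain C where C: "0 < C" "\<And>x. N x \<le> C * norm x" by (rule finsler_upper_bound[OF finsler]) blast
  have "radial r (\<gamma> d) - radial r (\<gamma> c) \<le> L d - L c"
  proof (rule le_of_left_slope_bound[OF cd])
    show "continuous_on {c..d} (\<lambda>t. radial r (\<gamma> t))"
      unfolding continuous_on_def using tendsto_radial[OF r(2)] lderivD(1)[OF vel] by blast
    show "continuous_on {c..d} L"
      unfolding L_def by (intro indefinite_integral_continuous_1 integrable_continuous_real NW)
    fix t \<eta> :: real assume t: "c < t" "t \<le> d" and \<eta>: "0 < \<eta>"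
    have tcd: "t \<in> {c..d}" using t by simp
    have left: "\<forall>\<^sub>F s in at t within {c..t}. s \<in> {c..t}" by (simp add: eventually_at_filter)
    have "(L has_vector_derivative N (W t)) (at t within {c..d})"
      unfolding L_def by (rule integral_has_vector_derivative[OF NW tcd])
    then have "(L has_vector_derivative N (W t)) (at t within {c..t})"
      by (rule has_vector_derivative_within_subset) (use t in auto)
    from has_vector_derivative_eventually_le[OF this, of "\<eta> / 2"]
    have "\<forall>\<^sub>F s in at t within {c..t}. norm (L s - L t - (s - t) *\<^sub>R N (W t)) \<le> \<eta> / 2 * \<bar>s - t\<bar>"
      using \<eta> by simp
    with left have Lst: "\<forall>\<^sub>F s in at t within {c..t}. (t - s) * N (W t) \<le> L t - L s + (t - s) * (\<eta> / 2)"
    proof eventually_elim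
      case (elim s)
      define m where "m = (t - s) * N (W t)"
      define k where "k = (t - s) * (\<eta> / 2)"
      have "\<eta> / 2 * \<bar>s - t\<bar> = k" "(s - t) *\<^sub>R N (W t) = - m"
        using elim(1) by (simp_all add: k_def m_def algebra_simps)
      then have "m \<le> L t - L s + k" using elim(2) by (simp add: abs_le_iff)
      then show ?case by (simp add: m_def k_def)
    qed
    show "\<forall>\<^sub>F s in at t within {c..t}. radial r (\<gamma> t) - radial r (\<gamma> s) \<le> L t - L s + (t - s) * \<eta>"
    \<comment> \<open>Outside the image of the closed ball of radius r the truncated distance is
      locally constant; inside it, Log is differentiable along \<gamma> because r < R.\<close>
    proof (cases "\<gamma> t \<in> E ` {v. N v \<le> r}")
      case False
      have ev: "\<forall>\<^sub>F s in at t within {c..t}. \<gamma> s \<notin> E ` {v. N v \<le> r}"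
        by (rule eventually_not_in_E_ball[OF r(2) lderivD(1)[OF lderiv_subset[OF vel[OF tcd]]] False])
           (use t in auto)
      have far: "radial r g = r" if "g \<notin> E ` {v. N v \<le> r}" for g
      proof (cases "g \<in> E ` B")
        case True
        from not_in_E_ball[OF this that] show ?thesis by (simp add: radial_def)
      qed (simp add: radial_def)
      show ?thesis
        using ev Lst left
      proof eventually_elim
        case (elim s)
        have "0 \<le> (t - s) * N (W t)" using elim finsler_nonneg[OF finsler] by simp
        moreover have "(t - s) * (\<eta> / 2) \<le> (t - s) * \<eta>" using elim \<eta> by (intro mult_left_mono) auto
        ultimately show ?case using far[OF False] far[OF elim(1)] elim(2) by linarith
      qed
    next
      case True
      then obtain x where x: "\<gamma> t = E x" "N x \<le> r" by blast
      have xB: "x \<in> B" using x r by simp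
      have \<gamma>t: "\<gamma> t \<in> E ` B" using x xB by blast
      have Lx: "Log (\<gamma> t) = x" using x Log_E[OF xB] by simp
      have "c < d" using t by simp
      from Log_velocity[OF vel[OF tcd] this tcd \<gamma>t]
      obtain z where z: "((\<lambda>s. Log (\<gamma> s)) has_vector_derivative z) (at t within {c..d})" "dE x z = W t"
        unfolding Lx by blast
      have "((\<lambda>s. Log (\<gamma> s)) has_vector_derivative z) (at t within {c..t})"
        by (rule has_vector_derivative_within_subset[OF z(1)]) (use t in auto)
      \<comment> \<open>C converts the Euclidean remainder into \<open>N\<close>. Half of \<eta> is
        spent here, the other half on the linear approximation of L.\<close>
      from has_vector_derivative_eventually_le[OF this, of "\<eta> / (2 * C)"]
      have "\<forall>\<^sub>F s in at t within {c..t}. norm (Log (\<gamma> s) - x - (s - t) *\<^sub>R z) \<le> \<eta> / (2 * C) * \<bar>s - t\<bar>"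
        using \<eta> C unfolding Lx by simp
      then show ?thesis
        using Lst left
      proof eventually_elim
        case (elim s)
        let ?h = "t - s"
        have h: "0 \<le> ?h" using elim by simp
        define \<rho> where "\<rho> = Log (\<gamma> s) - x - (s - t) *\<^sub>R z"
        have "norm \<rho> \<le> \<eta> / (2 * C) * ?h" using elim(1) h unfolding \<rho>_def by (simp add: abs_minus_commute)
        then have "C * norm \<rho> \<le> C * (\<eta> / (2 * C) * ?h)" using C by (intro mult_left_mono) auto
        moreover have "N (- \<rho>) \<le> C * norm \<rho>" using C(2)[of "- \<rho>"] by simp
        ultimately have \<rho>: "N (- \<rho>) \<le> ?h * (\<eta> / 2)" using C by (simp add: mult.commute)
        have "N x \<le> N (x + (dE x (?h *\<^sub>R z) - ?h *\<^sub>R z))"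
          by (rule finsler_contraction_fixpoint[OF finsler linear_dE[OF xB] N_dE_le[OF xB]])
             (use dE_radial[of 1 x] xB in simp)
        also have "dE x (?h *\<^sub>R z) = ?h *\<^sub>R W t"
          by (simp add: linear_scale[OF linear_dE[OF xB]] z(2))
        also have "x + (?h *\<^sub>R W t - ?h *\<^sub>R z) = Log (\<gamma> s) + (?h *\<^sub>R W t + (- \<rho>))"
          unfolding \<rho>_def by (simp add: algebra_simps)
        also have "N \<dots> \<le> N (Log (\<gamma> s)) + (N (?h *\<^sub>R W t) + N (- \<rho>))"
          by (intro order_trans[OF finsler_triangle[OF finsler]] add_left_mono finsler_triangle[OF finsler])
        also have "N (?h *\<^sub>R W t) = ?h * N (W t)" by (rule finsler_scale[OF finsler h])
        finally have "N x \<le> N (Log (\<gamma> s)) + (?h * N (W t) + N (- \<rho>))" .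
        moreover have "?h * \<eta> = ?h * (\<eta> / 2) + ?h * (\<eta> / 2)" by simp
        ultimately have le: "N x \<le> N (Log (\<gamma> s)) + (L t - L s + ?h * \<eta>)"
          using \<rho> elim(2) by linarith
        have nonneg: "0 \<le> L t - L s + ?h * \<eta>"
        proof -
          have "0 \<le> ?h * N (W t)" using h finsler_nonneg[OF finsler] by simp
          moreover have "?h * (\<eta> / 2) \<le> ?h * \<eta>" using h \<eta> by (intro mult_left_mono) auto
          ultimately show ?thesis using elim(2) by linarith
        qed
        have "radial r (\<gamma> t) = N x" using \<gamma>t Lx x(2) by (simp add: radial_def)
        \<comment> \<open>Truncation at the earlier time is harmless: if the value there is r, then
          \<open>N x \<le> r\<close> and the right side is nonnegative.\<close>
        moreover have "radial r (\<gamma> s) = r \<or> radial r (\<gamma> s) = N (Log (\<gamma> s))"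
          by (auto simp: radial_def min_def)
        ultimately show ?case using le nonneg x(2) by linarith
      qed
    qed
  qed
  then show ?thesis by (simp add: L_def)
qed

lemma radial_diff_le_path_len:
  assumes r: "0 \<le> r" "r < R" and \<delta>: "piecewise_C1_path T A \<delta> a b" "a \<le> s" "s \<le> t" "t \<le> b"
    and g: "g \<in> carrier G"
  shows "radial r (g \<otimes> \<delta> t) - radial r (g \<otimes> \<delta> s) \<le> path_len G \<kappa> N \<delta> s t"
proof -
  have "a \<le> s \<and> t \<le> b \<longrightarrow> radial r (g \<otimes> \<delta> t) - radial r (g \<otimes> \<delta> s) \<le> path_len G \<kappa> N \<delta> s t"
    using \<delta>
  proof (induction s t rule: piecewise_C1_induct)
    case (C1 c d)
    obtain W where W: "continuous_on {c..d} W" "\<And>t. t \<in> {c..d} \<Longrightarrow> has_velocity \<delta> (W t) t {c..d}"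
      using C1_path_velocity[OF C1(4,2)] by blast
    have vel: "has_velocity (\<lambda>t. g \<otimes> \<delta> t) (W t) t {c..d}" if "t \<in> {c..d}" for t
      by (rule lderiv_left_mult[OF W(2)[OF that] g that])
    have "path_len G \<kappa> N \<delta> c d = integral {c..d} (\<lambda>t. N (W t))" by (rule path_len_velocity[OF W(2,1)])
    then show ?case using radial_le_length[OF r less_imp_le[OF C1(2)] vel W(1)] by simp
  next
    case (join c m d)
    then show ?case using path_len_combine[OF \<delta>(1), of c m d] by auto
  next
    case (point c)
    then show ?case by (simp add: path_len_def)
  qed
  then show ?thesis using \<delta> by simp
qed

text \<open>Serves the case of length exactly \<open>R\<close>: beyond the first time at which this
  length is attained, the path must stand still.\<close>

lemma path_len_zero_const:
  assumes \<gamma>: "piecewise_C1_path T A \<gamma> a b" "a \<le> s" "s \<le> t" "t \<le> b" and 0: "path_len G \<kappa> N \<gamma> s t = 0"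
  shows "\<gamma> s = \<gamma> t"
proof -
  have "a \<le> s \<and> t \<le> b \<and> path_len G \<kappa> N \<gamma> s t = 0 \<longrightarrow> \<gamma> s = \<gamma> t"
    using \<gamma>
  proof (induction s t rule: piecewise_C1_induct)
    case (C1 c d)
    obtain W where W: "continuous_on {c..d} W" "\<And>t. t \<in> {c..d} \<Longrightarrow> has_velocity \<gamma> (W t) t {c..d}"
      using C1_path_velocity[OF C1(4,2)] by blast
    have NW: "continuous_on {c..d} (\<lambda>t. N (W t))"
      by (rule continuous_on_compose2[OF continuous_on_finsler[OF finsler, of UNIV] W(1)]) simp
    show ?case
    proof
      assume "a \<le> c \<and> d \<le> b \<and> path_len G \<kappa> N \<gamma> c d = 0"
      then have "integral {c..d} (\<lambda>t. N (W t)) = 0" using path_len_velocity[OF W(2,1)] by simp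
      then have "\<forall>t\<in>{c..d}. N (W t) = 0"
        using integral_eq_0_iff[OF NW C1(2)] finsler_nonneg[OF finsler] by blast
      then have "W t = 0" if "t \<in> {c..d}" for t using finsler_eq_0_D[OF finsler] that by blast
      then show "\<gamma> c = \<gamma> d"
        using W(2) C1(2) by (intro zero_velocity_const) (metis, simp)
    qed
  next
    case (join c m d)
    show ?case
    proof
      assume cd: "a \<le> c \<and> d \<le> b \<and> path_len G \<kappa> N \<gamma> c d = 0"
      then have "path_len G \<kappa> N \<gamma> c m + path_len G \<kappa> N \<gamma> m d = 0"
        using path_len_combine[OF \<gamma>(1), of c m d] join by simp
      then have "path_len G \<kappa> N \<gamma> c m = 0" "path_len G \<kappa> N \<gamma> m d = 0"
        using path_len_nonneg[of \<gamma> c m] path_len_nonneg[of \<gamma> m d] by linarith+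
      then show "\<gamma> c = \<gamma> d" using join cd by auto
    qed
  qed simp
  then show ?thesis using \<gamma> 0 by simp
qed

text \<open>\<open>\<phi>\<close> attains its maximum over the orbit \<open>Ad G w\<close> at \<open>w\<close>.\<close>
lemma norming_ad:
  assumes \<phi>: "unit_functional N \<phi>" and w: "\<phi> w = N w"
  shows "\<phi> (ad w z) = 0"
proof -
  have lin: "linear \<phi>" using \<phi> unfolding unit_functional_def by blast
  have "((\<lambda>y. \<phi> (Ad G \<kappa> (chart_inv \<kappa> y) w)) has_derivative (\<lambda>z. \<phi> (ad z w))) (at e)"
    by (rule bounded_linear.has_derivative[OF _ has_derivative_Ad_chart])
       (use lin in \<open>simp add: linear_conv_bounded_linear\<close>)
  then have "(\<lambda>z. \<phi> (ad z w)) = (\<lambda>z. 0)"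
  proof (rule differential_zero_maxmin[of e "chart_map \<kappa> ` chart_dom \<kappa>", rotated 2])
    have "\<phi> (Ad G \<kappa> (chart_inv \<kappa> y) w) \<le> \<phi> (Ad G \<kappa> (chart_inv \<kappa> e) w)"
      if "y \<in> chart_map \<kappa> ` chart_dom \<kappa>" for y
    proof -
      have "chart_inv \<kappa> y \<in> carrier G"
        using that chart_inv_chart_map[OF \<kappa>_in_A] chart_dom_carrier[OF \<kappa>_in_A] by auto
      then have "\<phi> (Ad G \<kappa> (chart_inv \<kappa> y) w) \<le> N w"
        using unit_functional_le[OF finsler \<phi>, of "Ad G \<kappa> (chart_inv \<kappa> y) w"] N_Ad by simp
      then show ?thesis using w by (simp add: Ad_one)
    qed
    then show "(\<forall>y\<in>chart_map \<kappa> ` chart_dom \<kappa>. \<phi> (Ad G \<kappa> (chart_inv \<kappa> y) w) \<le> \<phi> (Ad G \<kappa> (chart_inv \<kappa> e) w)) \<or>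
      (\<forall>y\<in>chart_map \<kappa> ` chart_dom \<kappa>. \<phi> (Ad G \<kappa> (chart_inv \<kappa> e) w) \<le> \<phi> (Ad G \<kappa> (chart_inv \<kappa> y) w))"
      by blast
  qed (simp_all add: open_chart_image)
  then have "\<phi> (ad z w) = 0" by (rule fun_cong)
  \<comment> \<open>Varying the group element gives the first argument of \<open>ad\<close>;
    antisymmetry moves w there.\<close>
  then show ?thesis using ad_antisym[of w z] linear_neg[OF lin] by simp
qed

text \<open>After translation to \<one> at time t, the derivative is minus \<phi> of
  \<open>ad (W t)\<close> applied to a fixed vector, which vanishes because \<phi> norms W
  t.\<close>

lemma norming_Ad_inv_const:
  assumes \<phi>: "unit_functional N \<phi>" and cd: "c \<le> d"
    and vel: "\<And>t. t \<in> {c..d} \<Longrightarrow> has_velocity \<gamma> (W t) t {c..d}"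
    and norming: "\<And>t. t \<in> {c..d} \<Longrightarrow> \<phi> (W t) = N (W t)"
  shows "\<phi> (Ad G \<kappa> (inv (\<gamma> c)) z) = \<phi> (Ad G \<kappa> (inv (\<gamma> d)) z)"
proof -
  have lin: "linear \<phi>" using \<phi> unfolding unit_functional_def by blast
  then have bl: "bounded_linear \<phi>" by (simp add: linear_conv_bounded_linear)
  have D: "((\<lambda>s. \<phi> (Ad G \<kappa> (inv (\<gamma> s)) z)) has_derivative (\<lambda>h. 0)) (at t within {c..d})"
    if t: "t \<in> {c..d}" for t
  proof -
    have gc: "\<gamma> t \<in> carrier G" by (rule lderivD(3)[OF vel[OF t]])
    define q where "q s = inv (\<gamma> t) \<otimes> \<gamma> s" for s
    define Z where "Z = Ad G \<kappa> (inv (\<gamma> t)) z"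
    have "gderiv \<kappa> q (\<lambda>h. h *\<^sub>R W t) t {c..d}" unfolding q_def by (rule lderivD(2)[OF vel[OF t]])
    from gderiv_inv_one[OF this _ t] have "gderiv \<kappa> (\<lambda>s. inv (q s)) (\<lambda>h. - (h *\<^sub>R W t)) t {c..d}"
      using gc by (simp add: q_def)
    from has_derivative_Ad[OF this _ t, of Z]
    have "((\<lambda>s. Ad G \<kappa> (inv (q s)) Z) has_derivative (\<lambda>h. ad (- (h *\<^sub>R W t)) Z)) (at t within {c..d})"
      using gc by (simp add: q_def)
    from bounded_linear.has_derivative[OF bl this]
    have "((\<lambda>s. \<phi> (Ad G \<kappa> (inv (q s)) Z)) has_derivative (\<lambda>h. \<phi> (ad (- (h *\<^sub>R W t)) Z))) (at t within {c..d})" .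
    moreover have "\<phi> (ad (- (h *\<^sub>R W t)) Z) = 0" for h
    proof -
      have l: "linear (\<lambda>w. ad w Z)" by (rule has_derivative_linear[OF has_derivative_Ad_chart])
      have "ad (- (h *\<^sub>R W t)) Z = - (h *\<^sub>R ad (W t) Z)"
        using linear_neg[OF l] linear_scale[OF l] by simp
      then show ?thesis
        using norming_ad[OF \<phi> norming[OF t]] by (simp add: linear_neg[OF lin] linear_scale[OF lin])
    qed
    ultimately have "((\<lambda>s. \<phi> (Ad G \<kappa> (inv (q s)) Z)) has_derivative (\<lambda>h. 0)) (at t within {c..d})" by simp
    then show ?thesis
    proof (rule has_derivative_transform_eventually)
      have *: "\<phi> (Ad G \<kappa> (inv (q s)) Z) = \<phi> (Ad G \<kappa> (inv (\<gamma> s)) z)" if s: "\<gamma> s \<in> carrier G" for s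
      proof -
        have "inv (q s) \<otimes> inv (\<gamma> t) = inv (\<gamma> s)"
          using s gc by (simp add: q_def inv_mult_group m_assoc)
        then show ?thesis
          unfolding Z_def using s gc by (subst Ad_mult[symmetric]) (simp_all add: q_def)
      qed
      show "\<forall>\<^sub>F s in at t within {c..d}. \<phi> (Ad G \<kappa> (inv (q s)) Z) = \<phi> (Ad G \<kappa> (inv (\<gamma> s)) z)"
        using lderivD(5)[OF vel[OF t]] by eventually_elim (rule *)
      show "\<phi> (Ad G \<kappa> (inv (q t)) Z) = \<phi> (Ad G \<kappa> (inv (\<gamma> t)) z)" by (rule *[OF gc])
    qed (rule t)
  qed
  have "convex {c..d}" by simp
  from has_derivative_zero_constant[OF this D]
  obtain k where "\<forall>t\<in>{c..d}. \<phi> (Ad G \<kappa> (inv (\<gamma> t)) z) = k" by blast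
  then show ?thesis using cd by simp
qed

text \<open>Continuity on a \<open>C1\<close> piece upgrades the equality from almost every time to
  every time, including the end points, as the pointwise derivative arguments require.\<close>

lemma norming_velocity:
  assumes \<phi>: "unit_functional N \<phi>" and cd: "c < d"
    and vel: "\<And>t. t \<in> {c..d} \<Longrightarrow> has_velocity \<gamma> (W t) t {c..d}" and W: "continuous_on {c..d} W"
    and AE: "AE t\<in>{t0..t1} in lborel. \<phi> (left_velocity G \<kappa> \<gamma> t) = N (left_velocity G \<kappa> \<gamma> t)"
    and sub: "t0 \<le> c" "d \<le> t1" and t: "t \<in> {c..d}"
  shows "\<phi> (W t) = N (W t)"
proof -
  have lin: "linear \<phi>" using \<phi> unfolding unit_functional_def by blast
  have "N (W t) - \<phi> (W t) = 0"
  proof (rule AE_zero_continuous_imp_zero[OF _ _ cd _ t])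
    have "continuous_on UNIV \<phi>" using lin by (simp add: linear_continuous_on linear_conv_bounded_linear)
    then show "continuous_on {c..d} (\<lambda>t. N (W t) - \<phi> (W t))"
      using continuous_on_compose2[OF _ W] continuous_on_finsler[OF finsler, of UNIV]
      by (intro continuous_on_diff) blast+
    show "0 \<le> N (W t) - \<phi> (W t)" for t using unit_functional_le[OF finsler \<phi>] by simp
    show "AE t in lborel. t \<in> {c<..<d} \<longrightarrow> N (W t) - \<phi> (W t) = 0"
      using AE
    proof eventually_elim
      case (elim t)
      show ?case
      proof
        assume "t \<in> {c<..<d}"
        then show "N (W t) - \<phi> (W t) = 0"
          using elim sub has_velocity_left_velocity[OF vel, of t] by simp
      qed
    qed
  qed
  then show ?thesis by simp
qed

lemma radial_one: "0 \<le> r \<Longrightarrow> radial r \<one> = 0"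
proof -
  have "\<one> = E 0" by (simp add: E_zero)
  moreover have "Log (E 0) = 0" by (rule Log_E[OF zero_in_B])
  moreover have "E 0 \<in> E ` B" using zero_in_B by (rule imageI)
  ultimately show "0 \<le> r \<Longrightarrow> radial r \<one> = 0" by (simp add: radial_def finsler_zero[OF finsler])
qed

text \<open>Along \<open>\<gamma>\<close> the functional \<open>\<phi>\<close> is \<open>Ad\<close>-invariant, so \<open>\<phi> \<circ> Log\<close> grows at the rate \<open>\<phi> (\<gamma>\<^sup>-\<^sup>1 \<gamma>')\<close>.\<close>
lemma norming_functional_Log:
  assumes \<gamma>: "piecewise_C1_path T A \<gamma> a b" and t0: "a \<le> t0" "t0 \<le> t" "t \<le> b"
    and \<phi>: "unit_functional N \<phi>"
    and AE: "AE t\<in>{t0..t} in lborel. \<phi> (left_velocity G \<kappa> \<gamma> t) = N (left_velocity G \<kappa> \<gamma> t)"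
    and len: "path_len G \<kappa> N \<gamma> t0 t < R"
  shows "inv (\<gamma> t0) \<otimes> \<gamma> t \<in> E ` B" "\<phi> (Log (inv (\<gamma> t0) \<otimes> \<gamma> t)) = path_len G \<kappa> N \<gamma> t0 t"
proof -
  have lin: "linear \<phi>" using \<phi> unfolding unit_functional_def by blast
  have bl: "bounded_linear \<phi>" using lin by (simp add: linear_conv_bounded_linear)
  have "continuous_map (top_of_set {a..b}) T \<gamma>" using \<gamma> unfolding piecewise_C1_path_def by blast
  then have carrier: "\<gamma> s \<in> carrier G" if "a \<le> s" "s \<le> b" for s
    using that topspace_eq_carrier unfolding continuous_map_def by auto
  define g where "g = inv (\<gamma> t0)"
  have g: "g \<in> carrier G" unfolding g_def using carrier[of t0] t0 by simp
  define h where "h s = g \<otimes> \<gamma> s" for s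
  have h0: "h t0 = \<one>" unfolding h_def g_def using carrier[of t0] t0 by simp
  have hB: "h s \<in> E ` B" if s: "t0 \<le> s" "s \<le> t" for s
  proof -
    \<comment> \<open>A truncation radius strictly between the length and \<open>R\<close>: a
      truncated distance below r can only occur inside the image of \<open>B\<close>.\<close>
    define r where "r = (path_len G \<kappa> N \<gamma> t0 t + R) / 2"
    have r: "0 \<le> r" "r < R" "path_len G \<kappa> N \<gamma> t0 t < r"
      using len path_len_nonneg[of \<gamma> t0 t] by (auto simp: r_def)
    have "radial r (h s) - radial r (h t0) \<le> path_len G \<kappa> N \<gamma> t0 s"
      unfolding h_def using s t0 by (intro radial_diff_le_path_len[OF r(1,2) \<gamma> _ _ _ g]) auto
    also have "\<dots> \<le> path_len G \<kappa> N \<gamma> t0 t"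
      using path_len_combine[OF \<gamma>, of t0 s t] path_len_nonneg[of \<gamma> s t] s t0 by simp
    finally have "radial r (h s) < r" using r radial_one h0 by simp
    then show ?thesis by (auto simp: radial_def split: if_splits)
  qed
  have Ad_const: "\<phi> (Ad G \<kappa> (inv (\<gamma> t0)) z) = \<phi> (Ad G \<kappa> (inv (\<gamma> s)) z)" if s: "t0 \<le> s" "s \<le> t" for s z
  proof -
    \<comment> \<open>The induction runs over all subintervals of the domain of \<gamma>, while the
      norming hypothesis is known only on this one; the premise of the implication carries the
      restriction.\<close>
    have "t0 \<le> t0 \<and> s \<le> t \<longrightarrow> \<phi> (Ad G \<kappa> (inv (\<gamma> t0)) z) = \<phi> (Ad G \<kappa> (inv (\<gamma> s)) z)"
      using \<gamma> t0(1) s(1) order_trans[OF s(2) t0(3)]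
    proof (induction t0 s rule: piecewise_C1_induct[where P="\<lambda>c d. t0 \<le> c \<and> d \<le> t \<longrightarrow>
         \<phi> (Ad G \<kappa> (inv (\<gamma> c)) z) = \<phi> (Ad G \<kappa> (inv (\<gamma> d)) z)"])
      case (C1 c d)
      obtain W where W: "continuous_on {c..d} W" "\<And>t. t \<in> {c..d} \<Longrightarrow> has_velocity \<gamma> (W t) t {c..d}"
        using C1_path_velocity[OF C1(4,2)] by blast
      show ?case
      proof
        assume cd: "t0 \<le> c \<and> d \<le> t"
        show "\<phi> (Ad G \<kappa> (inv (\<gamma> c)) z) = \<phi> (Ad G \<kappa> (inv (\<gamma> d)) z)"
          using cd by (intro norming_Ad_inv_const[OF \<phi> less_imp_le[OF C1(2)] W(2)]
              norming_velocity[OF \<phi> C1(2) W(2,1) AE]) auto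
      qed
    next
      case (join c m d)
      then show ?case by auto
    qed simp
    then show ?thesis using s by simp
  qed
  have invariant: "\<phi> (Ad G \<kappa> (inv (h s)) z) = \<phi> z" if s: "t0 \<le> s" "s \<le> t" for s z
  proof -
    have c: "\<gamma> s \<in> carrier G" "\<gamma> t0 \<in> carrier G" using carrier s t0 by auto
    have "inv (h s) = inv (\<gamma> s) \<otimes> \<gamma> t0" unfolding h_def g_def using c by (simp add: inv_mult_group)
    then have "\<phi> (Ad G \<kappa> (inv (h s)) z) = \<phi> (Ad G \<kappa> (inv (\<gamma> s)) (Ad G \<kappa> (\<gamma> t0) z))"
      using c by (simp add: Ad_mult)
    also have "\<dots> = \<phi> (Ad G \<kappa> (inv (\<gamma> t0)) (Ad G \<kappa> (\<gamma> t0) z))" using Ad_const[OF s] by simp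
    also have "\<dots> = \<phi> z" using c by (simp add: Ad_inv)
    finally show ?thesis .
  qed
  have "t0 \<le> t0 \<and> t \<le> t \<longrightarrow> \<phi> (Log (h t)) - \<phi> (Log (h t0)) = path_len G \<kappa> N \<gamma> t0 t"
    using \<gamma> t0
  proof (induction t0 t rule: piecewise_C1_induct[where P="\<lambda>c d. t0 \<le> c \<and> d \<le> t \<longrightarrow>
       \<phi> (Log (h d)) - \<phi> (Log (h c)) = path_len G \<kappa> N \<gamma> c d"])
    case (C1 c d)
    obtain W where W: "continuous_on {c..d} W" "\<And>t. t \<in> {c..d} \<Longrightarrow> has_velocity \<gamma> (W t) t {c..d}"
      using C1_path_velocity[OF C1(4,2)] by blast
    show ?case
    proof
      assume cd: "t0 \<le> c \<and> d \<le> t"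
      have "((\<lambda>s. \<phi> (Log (h s))) has_vector_derivative N (W s)) (at s within {c..d})" if s: "s \<in> {c..d}" for s
      proof -
        have s': "t0 \<le> s" "s \<le> t" using s cd by auto
        note hs = hB[OF s']
        have x: "Log (h s) \<in> B" using Log_in_B[OF hs] by simp
        have "has_velocity h (W s) s {c..d}" unfolding h_def by (rule lderiv_left_mult[OF W(2)[OF s] g s])
        from Log_velocity[OF this C1(2) s hs]
        obtain z where z: "((\<lambda>s. Log (h s)) has_vector_derivative z) (at s within {c..d})" "dE (Log (h s)) z = W s" .
        have inv1: "\<phi> (Ad G \<kappa> (inv (E (Log (h s)))) v) = \<phi> v" for v
          unfolding E_Log[OF hs] by (rule invariant[OF s'])
        \<comment> \<open>Invariance at the single element \<open>E (Log (h s))\<close> spreads to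
          the whole segment below it, and then \<phi> does not see the difference between z and its
          image under \<open>dE\<close>.\<close>
        have "\<phi> (W s) = \<phi> z"
          unfolding z(2)[symmetric]
          by (rule functional_dE[OF x lin]) (rule functional_Ad_E_invariant[OF x lin inv1])
        moreover have "\<phi> (W s) = N (W s)"
          by (rule norming_velocity[OF \<phi> C1(2) W(2,1) AE]) (use cd s in auto)
        ultimately show ?thesis
          using bounded_linear.has_vector_derivative[OF bl z(1)] by simp
      qed
      from fundamental_theorem_of_calculus[OF less_imp_le[OF C1(2)] this]
      show "\<phi> (Log (h d)) - \<phi> (Log (h c)) = path_len G \<kappa> N \<gamma> c d"
        using path_len_velocity[OF W(2,1)] by (simp add: integral_unique)
    qed
  next
    case (join c m d)
    show ?case
    proof
      assume cd: "t0 \<le> c \<and> d \<le> t"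
      then have "path_len G \<kappa> N \<gamma> c m + path_len G \<kappa> N \<gamma> m d = path_len G \<kappa> N \<gamma> c d"
        using join t0 by (intro path_len_combine[OF \<gamma>]) auto
      then show "\<phi> (Log (h d)) - \<phi> (Log (h c)) = path_len G \<kappa> N \<gamma> c d" using join cd by auto
    qed
  next
    case (point c)
    then show ?case by (simp add: path_len_def)
  qed
  moreover have "\<phi> (Log (h t0)) = 0"
    using Log_E[OF zero_in_B] linear_0[OF lin] by (simp add: h0 flip: E_zero)
  ultimately have "\<phi> (Log (h t)) = path_len G \<kappa> N \<gamma> t0 t" by simp
  then show "\<phi> (Log (inv (\<gamma> t0) \<otimes> \<gamma> t)) = path_len G \<kappa> N \<gamma> t0 t" by (simp add: h_def g_def)
  show "inv (\<gamma> t0) \<otimes> \<gamma> t \<in> E ` B" using hB[of t] t0 by (simp add: h_def g_def)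
qed

text \<open>The length of \<gamma> is a value of \<phi> at a logarithm, hence at most its norm, and
  the Gauss lemma bounds that norm by the length of any competitor. At length \<open>R\<close> the
  logarithm of the end point may not exist, and only the truncated distances pass to the
  limit.\<close>

lemma norming_imp_short_path:
  assumes \<gamma>: "piecewise_C1_path T A \<gamma> a b" and t: "a \<le> t0" "t0 \<le> t1" "t1 \<le> b"
    and \<phi>: "unit_functional N \<phi>"
    and AE: "AE t\<in>{t0..t1} in lborel. \<phi> (left_velocity G \<kappa> \<gamma> t) = N (left_velocity G \<kappa> \<gamma> t)"
    and len: "path_len G \<kappa> N \<gamma> t0 t1 \<le> R"
  shows "short_path G T A \<kappa> N \<gamma> t0 t1"
  unfolding short_path_def
proof (intro allI impI, elim conjE)
  fix c d \<delta> assume cd: "c \<le> d" and \<delta>: "piecewise_C1_path T A \<delta> c d"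
    and ends: "\<delta> c = \<gamma> t0" "\<delta> d = \<gamma> t1"
  define l where "l s = path_len G \<kappa> N \<gamma> t0 s" for s
  have cont\<gamma>: "continuous_map (top_of_set {a..b}) T \<gamma>" using \<gamma> unfolding piecewise_C1_path_def by blast
  then have carrier: "\<gamma> s \<in> carrier G" if "a \<le> s" "s \<le> b" for s
    using that topspace_eq_carrier unfolding continuous_map_def by auto
  define g where "g = inv (\<gamma> t0)"
  have g: "g \<in> carrier G" "g \<otimes> \<gamma> t0 = \<one>" unfolding g_def using carrier[of t0] t by simp_all
  have lower: "radial r (g \<otimes> \<gamma> t1) \<le> path_len G \<kappa> N \<delta> c d" if "0 \<le> r" "r < R" for r
    using radial_diff_le_path_len[OF that \<delta> order_refl cd order_refl g(1)] radial_one[OF that(1)] g(2)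
    unfolding ends by simp
  have ge: "min r (l s) \<le> radial r (g \<otimes> \<gamma> s)" if s: "t0 \<le> s" "s \<le> t1" "l s < R" for r s
  proof -
    have "AE u\<in>{t0..s} in lborel. \<phi> (left_velocity G \<kappa> \<gamma> u) = N (left_velocity G \<kappa> \<gamma> u)"
      using AE by eventually_elim (use s in auto)
    from norming_functional_Log[OF \<gamma> t(1) s(1) _ \<phi> this] s t
    have "g \<otimes> \<gamma> s \<in> E ` B" "\<phi> (Log (g \<otimes> \<gamma> s)) = l s" unfolding l_def g_def by auto
    moreover have "\<phi> (Log (g \<otimes> \<gamma> s)) \<le> N (Log (g \<otimes> \<gamma> s))" by (rule unit_functional_le[OF finsler \<phi>])
    ultimately show ?thesis by (auto simp: radial_def)
  qed
  show "path_len G \<kappa> N \<gamma> t0 t1 \<le> path_len G \<kappa> N \<delta> c d"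
  proof (cases "l t1 < R")
    case True
    have "0 \<le> l t1" unfolding l_def by (rule path_len_nonneg)
    then show ?thesis using ge[of t1 "l t1"] lower[of "l t1"] True t by (simp add: l_def)
  next
    case False
    then have l1: "l t1 = R" using len by (simp add: l_def)
    have l_cont: "continuous_on {t0..t1} l"
      unfolding l_def path_len_def
      by (intro indefinite_integral_continuous_1 len_integrable[OF \<gamma>] t)
    \<comment> \<open>Its least element t' is the first time at which the length reaches
      \<open>R\<close>. The estimate \<open>ge\<close> holds strictly before t', and on the rest of
      the interval \<gamma> has length zero.\<close>
    define S where "S = {s \<in> {t0..t1}. R \<le> l s}"
    have "S = {t0..t1} \<inter> l -` {R..}" by (auto simp: S_def)
    then have "closed S" using continuous_closed_preimage[OF l_cont] by simp
    moreover have "bounded S" using bounded_closed_interval[of t0 t1] by (rule bounded_subset) (auto simp: S_def)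
    ultimately have "compact S" by (simp add: compact_eq_bounded_closed)
    moreover have "t1 \<in> S" using t l1 by (simp add: S_def)
    ultimately obtain t' where t': "t' \<in> S" "\<And>s. s \<in> S \<Longrightarrow> t' \<le> s"
      using compact_attains_inf[of S] by blast
    have mem: "t0 \<le> t'" "t' \<le> t1" "R \<le> l t'" using t'(1) by (auto simp: S_def)
    have split: "l t' + path_len G \<kappa> N \<gamma> t' t1 = l t1"
      unfolding l_def using mem t by (intro path_len_combine[OF \<gamma>]) auto
    then have "path_len G \<kappa> N \<gamma> t' t1 = 0" and l': "l t' = R"
      using mem l1 path_len_nonneg[of \<gamma> t' t1] by linarith+
    then have eq: "\<gamma> t' = \<gamma> t1" using mem t by (intro path_len_zero_const[OF \<gamma>]) auto
    have "t0 < t'"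
      using mem l' R_pos by (cases "t0 = t'") (auto simp: l_def path_len_def)
    \<comment> \<open>For fixed r < R both sides of \<open>ge\<close> are continuous in s, so the
      estimate survives as s tends to t' from the left; afterwards r increases to
      \<open>R\<close>.\<close>
    have "r \<le> path_len G \<kappa> N \<delta> c d" if r: "0 \<le> r" "r < R" for r
    proof -
      have "limitin T \<gamma> (\<gamma> t') (at t' within {a..b})"
        using cont\<gamma> mem t unfolding continuous_map_Icc_iff_limitin by auto
      then have "limitin T \<gamma> (\<gamma> t') (at t' within {t0..t'})"
        using filter_leD[OF at_le[of "{t0..t'}" "{a..b}" t']] mem t unfolding limitin_def by simp
      then have "limitin T (\<lambda>s. g \<otimes> \<gamma> s) (g \<otimes> \<gamma> t') (at t' within {t0..t'})"
        using g topspace_eq_carrier by (intro limitin_mult) simp_all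
      from tendsto_radial[OF r(2) this]
      have lim: "((\<lambda>s. radial r (g \<otimes> \<gamma> s)) \<longlongrightarrow> radial r (g \<otimes> \<gamma> t')) (at t' within {t0..t'})" .
      have "(l \<longlongrightarrow> l t') (at t' within {t0..t1})" using l_cont mem by (auto simp: continuous_on_def)
      then have "(l \<longlongrightarrow> l t') (at t' within {t0..t'})" by (rule tendsto_within_subset) (use mem in auto)
      then have lim2: "((\<lambda>s. min r (l s)) \<longlongrightarrow> min r (l t')) (at t' within {t0..t'})"
        by (intro tendsto_min tendsto_const)
      have "\<forall>\<^sub>F s in at t' within {t0..t'}. s \<in> {t0..<t'}"
        unfolding eventually_at_filter by (auto intro: always_eventually)
      then have ev: "\<forall>\<^sub>F s in at t' within {t0..t'}. min r (l s) \<le> radial r (g \<otimes> \<gamma> s)"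
      proof eventually_elim
        case (elim s)
        then have "s \<notin> S" using t'(2)[of s] by auto
        then show ?case using elim mem by (intro ge) (auto simp: S_def)
      qed
      have "at t' within {t0..t'} \<noteq> bot" using \<open>t0 < t'\<close> by (simp add: at_within_Icc_at_left)
      from tendsto_le[OF this lim lim2 ev] have "r \<le> radial r (g \<otimes> \<gamma> t1)"
        using l' r eq by simp
      then show ?thesis using lower[OF r] by simp
    qed
    then have "R \<le> path_len G \<kappa> N \<delta> c d"
      using R_pos path_len_nonneg by (intro dense_le_bounded[of 0 R]) auto
    then show ?thesis using l1 by (simp add: l_def)
  qed
qed

end

theorem theoremA:
  fixes G :: "('g, 'm) monoid_scheme"
    and T :: "'g topology"
    and A :: "('g, 'e::euclidean_space) chart set"
    and \<kappa> :: "('g, 'e) chart"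
    and N :: "'e \<Rightarrow> real"
    and R a b :: real
    and \<gamma> :: "real \<Rightarrow> 'g"
  assumes "lie_group G T A"
    and "compact_space T"
    and "connected_space T"
    and "identity_chart G A \<kappa>"
    and "semisimple_algebra (lie_bracket G \<kappa>)"
    and "finsler_norm N"
    and "Ad_invariant G \<kappa> N"
    and "injectivity_radius G T A \<kappa> N R"
    and "a \<le> b"
    and "piecewise_C1_path T A \<gamma> a b"
  shows "(short_path G T A \<kappa> N \<gamma> a b \<longrightarrow>
            (\<exists>\<phi>. unit_functional N \<phi> \<and>
              (AE t\<in>{a..b} in lborel.
                 \<phi> (left_velocity G \<kappa> \<gamma> t) = N (left_velocity G \<kappa> \<gamma> t))))
       \<and> (\<forall>t0 t1 \<phi>. a \<le> t0 \<and> t0 \<le> t1 \<and> t1 \<le> b \<and> unit_functional N \<phi> \<and>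
            (AE t\<in>{t0..t1} in lborel.
               \<phi> (left_velocity G \<kappa> \<gamma> t) = N (left_velocity G \<kappa> \<gamma> t)) \<and>
            path_len G \<kappa> N \<gamma> t0 t1 \<le> R \<longrightarrow>
            short_path G T A \<kappa> N \<gamma> t0 t1)"
proof -
  interpret lie_group G T A by fact
  interpret exp_lie_group G T A \<kappa> N R
    using assms(4,6-8) unfolding injectivity_radius_def by unfold_locales auto
  show ?thesis
  proof (intro conjI impI allI, goal_cases)
    case 1
    then show ?case using short_path_norming[OF assms(10,9)] by blast
  next
    case (2 t0 t1 \<phi>)
    then show ?case by (intro norming_imp_short_path[OF assms(10)]) auto
  qed
qed

end
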